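(* For all integers $N\ge 2$ the discrete quantum groups $\widehat{U^+_N}$ and $\widehat{O^+_N}$ are residually finite.
   Context: A CQG algebra is a complex Hopf $*$-algebra $\mathcal{A}$ that is cosemisimple and whose unique unital (left and right) integral $h:\mathcal{A}\to\mathbb{C}$ is positive, i.e. $h(x^*x)\ge 0$ for all $x\in\mathcal{A}$. The category of compact quantum groups is the category dual to that of CQG algebras; $\mathcal{O}(G)$ denotes the CQG algebra attached to a compact quantum group $G$. The discrete quantum group $\widehat{G}$ dual to $G$ is a virtual object whose "group algebra" is $\mathcal{O}(G)$; properties of $\widehat{G}$ are defined as properties of $\mathcal{O}(G)$. Residual finiteness: $\widehat{G}$ is residually finite if $\mathcal{O}(G)$ is finitely generated and embeds as a $*$-algebra in a product of matrix algebras (full matrix algebras $M_n(\mathbb{C})$ with their usual $*$-structure). Free unitary group: for $N\ge 2$, $U^+_N$ is the compact quantum group whose CQG algebra $\mathcal{O}(U^+_N)$ is generated as a $*$-algebra by $u_{ij}$, $1\le i,j\le N$, subject to the relations that both matrices $u=(u_{ij})_{i,j}$ and $\overline{u}=(u_{ij}^* )_{i,j}$ in $M_N(\mathcal{O}(U^+_N))$ are unitary, with comultiplication $\Delta(u_{ij})=\sum_k u_{ik}\otimes u_{kj}$ and counit $\varepsilon(u_{ij})=\delta_{ij}$. Free orthogonal group: for $N\ge 2$, $O^+_N$ is defined in the same way, with the additional relations $u_{ij}=u_{ij}^*$ for all $i,j$. *)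

theory Defs
  imports
    "Jordan_Normal_Form.Schur_Decomposition"
    "HOL-Algebra.QuotRing"
    "HOL-Algebra.Subrings"
    "HOL-Library.Poly_Mapping"
begin

hide_const (open) Multiset.mult Polynomial.smult

section \<open>Complex star-algebras\<close>

record 'a star_algebra = "(complex, 'a) module" +
  star :: "'a \<Rightarrow> 'a"

locale star_algebra = ring A + Module.module "class_ring :: complex ring" A
  for A :: "'a star_algebra" (structure) +
  assumes smult_mult_left:
      "x \<in> carrier A \<Longrightarrow> y \<in> carrier A \<Longrightarrow> (c \<odot> x) \<otimes> y = c \<odot> (x \<otimes> y)"
    and smult_mult_right:
      "x \<in> carrier A \<Longrightarrow> y \<in> carrier A \<Longrightarrow> x \<otimes> (c \<odot> y) = c \<odot> (x \<otimes> y)"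
    and star_closed: "x \<in> carrier A \<Longrightarrow> star A x \<in> carrier A"
    and star_star: "x \<in> carrier A \<Longrightarrow> star A (star A x) = x"
    and star_add: "x \<in> carrier A \<Longrightarrow> y \<in> carrier A \<Longrightarrow> star A (x \<oplus> y) = star A x \<oplus> star A y"
    and star_smult: "x \<in> carrier A \<Longrightarrow> star A (c \<odot> x) = cnj c \<odot> star A x"
    and star_mult: "x \<in> carrier A \<Longrightarrow> y \<in> carrier A \<Longrightarrow> star A (x \<otimes> y) = star A y \<otimes> star A x"

definition star_hom :: "'a star_algebra \<Rightarrow> 'b star_algebra \<Rightarrow> ('a \<Rightarrow> 'b) set" where
  "star_hom A B = {h \<in> Ring.ring_hom A B.
     (\<forall>c. \<forall>x\<in>carrier A. h (c \<odot>\<^bsub>A\<^esub> x) = c \<odot>\<^bsub>B\<^esub> h x) \<and>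
     (\<forall>x\<in>carrier A. h (star A x) = star B (h x))}"

definition unital_subalgebra :: "'a set \<Rightarrow> 'a star_algebra \<Rightarrow> bool" where
  "unital_subalgebra B A \<longleftrightarrow> subring B A \<and> (\<forall>c. \<forall>x\<in>B. c \<odot>\<^bsub>A\<^esub> x \<in> B)"

(* Generation as an algebra. For a star-algebra this is the same as finite generation as a
   star-algebra, since the adjoints of the generators may be added to a finite generating set. *)
definition finitely_generated :: "'a star_algebra \<Rightarrow> bool" where
  "finitely_generated A \<longleftrightarrow>
     (\<exists>S. finite S \<and> S \<subseteq> carrier A \<and> \<Inter>{B. unital_subalgebra B A \<and> S \<subseteq> B} = carrier A)"

section \<open>Products of matrix algebras and residual finiteness\<close>

definition matrix_star_algebra :: "nat \<Rightarrow> complex mat star_algebra" where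
  "matrix_star_algebra n = \<lparr>
     carrier = carrier_mat n n, mult = (*), one = 1\<^sub>m n, zero = 0\<^sub>m n n, add = (+),
     smult = (\<cdot>\<^sub>m), star = mat_adjoint\<rparr>"

definition product_star_algebra :: "'i set \<Rightarrow> ('i \<Rightarrow> 'a star_algebra) \<Rightarrow> ('i \<Rightarrow> 'a) star_algebra" where
  "product_star_algebra I A = \<lparr>
     carrier = (\<Pi>\<^sub>E i\<in>I. carrier (A i)),
     mult = (\<lambda>x y. \<lambda>i\<in>I. x i \<otimes>\<^bsub>A i\<^esub> y i),
     one = (\<lambda>i\<in>I. \<one>\<^bsub>A i\<^esub>),
     zero = (\<lambda>i\<in>I. \<zero>\<^bsub>A i\<^esub>),
     add = (\<lambda>x y. \<lambda>i\<in>I. x i \<oplus>\<^bsub>A i\<^esub> y i),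
     smult = (\<lambda>c x. \<lambda>i\<in>I. c \<odot>\<^bsub>A i\<^esub> x i),
     star = (\<lambda>x. \<lambda>i\<in>I. star (A i) (x i))\<rparr>"

definition embeds_in_matrix_product :: "'i itself \<Rightarrow> 'a star_algebra \<Rightarrow> bool" where
  "embeds_in_matrix_product ty A \<longleftrightarrow>
     (\<exists>(I :: 'i set) n h. (\<forall>i\<in>I. n i \<ge> 1) \<and>
        h \<in> star_hom A (product_star_algebra I (\<lambda>i. matrix_star_algebra (n i))) \<and>
        inj_on h (carrier A))"

(* An existential quantifier cannot range over types, so the index set of the product is taken
   from the type of the elements of A. Lemma residually_finiteI shows that this is no loss of
   generality: an embedding into a product over an index set of any type yields one of this kind. *)
definition residually_finite :: "'a star_algebra \<Rightarrow> bool" where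
  "residually_finite A \<longleftrightarrow> finitely_generated A \<and> embeds_in_matrix_product TYPE('a) A"

section \<open>Star-algebras given by generators and relations\<close>

(* A word in the generators and their adjoints; (g, True) stands for the adjoint of g. *)
datatype 'g star_word = Word (letters: "('g \<times> bool) list")

instantiation star_word :: (type) monoid_add
begin

definition "0 = Word []"
definition "v + w = Word (letters v @ letters w)"

instance
  by standard (simp_all add: zero_star_word_def plus_star_word_def)

end

definition adjoint_word :: "'g star_word \<Rightarrow> 'g star_word" where
  "adjoint_word w = Word (rev (map (\<lambda>(g, b). (g, \<not> b)) (letters w)))"

(* Noncommutative star-polynomials: the multiplication of the monoid algebra of words is the
   convolution product provided by Poly_Mapping. *)
type_synonym 'g star_poly = "'g star_word \<Rightarrow>\<^sub>0 complex"

definition gen :: "'g \<Rightarrow> 'g star_poly" where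
  "gen g = Poly_Mapping.single (Word [(g, False)]) 1"

definition poly_star :: "'g star_poly \<Rightarrow> 'g star_poly" where
  "poly_star p =
     (\<Sum>w\<in>Poly_Mapping.keys p. Poly_Mapping.single (adjoint_word w) (cnj (Poly_Mapping.lookup p w)))"

definition free_star_algebra :: "'g set \<Rightarrow> 'g star_poly star_algebra" where
  "free_star_algebra X = \<lparr>
     carrier = {p. \<forall>w\<in>Poly_Mapping.keys p. fst ` set (letters w) \<subseteq> X},
     mult = (*), one = 1, zero = 0, add = (+),
     smult = (\<lambda>c p. Poly_Mapping.single 0 c * p), star = poly_star\<rparr>"

definition star_ideal_generated :: "'a star_algebra \<Rightarrow> 'a set \<Rightarrow> 'a set" where
  "star_ideal_generated A R = \<Inter>{I. ideal I A \<and> star A ` I \<subseteq> I \<and> R \<subseteq> I}"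

definition quotient_star_algebra :: "'a star_algebra \<Rightarrow> 'a set \<Rightarrow> 'a set star_algebra" where
  "quotient_star_algebra A I = \<lparr>
     carrier = a_rcosets\<^bsub>A\<^esub> I, mult = rcoset_mult A I, one = I +>\<^bsub>A\<^esub> \<one>\<^bsub>A\<^esub>, zero = I, add = set_add A,
     smult = (\<lambda>c X. \<Union>x\<in>X. I +>\<^bsub>A\<^esub> (c \<odot>\<^bsub>A\<^esub> x)),
     star = (\<lambda>X. \<Union>x\<in>X. I +>\<^bsub>A\<^esub> star A x)\<rparr>"

(* The universal star-algebra on generators X in which every element of R vanishes. *)
definition presented_star_algebra :: "'g set \<Rightarrow> 'g star_poly set \<Rightarrow> 'g star_poly set star_algebra" where
  "presented_star_algebra X R =
     quotient_star_algebra (free_star_algebra X) (star_ideal_generated (free_star_algebra X) R)"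

section \<open>The algebras of the free unitary and free orthogonal quantum groups\<close>

definition fundamental_matrix :: "nat \<Rightarrow> nat \<Rightarrow> (nat \<times> nat) star_poly" where
  "fundamental_matrix i j = gen (i, j)"

definition conjugate_matrix :: "(nat \<Rightarrow> nat \<Rightarrow> 'g star_poly) \<Rightarrow> nat \<Rightarrow> nat \<Rightarrow> 'g star_poly" where
  "conjugate_matrix v i j = poly_star (v i j)"

(* These vanish in the quotient iff the N x N matrix v is unitary: they are the entries of v w - 1
   and w v - 1, where w is the adjoint of v, whose (i, j) entry is the star of v_ji. *)
definition unitarity_relators :: "nat \<Rightarrow> (nat \<Rightarrow> nat \<Rightarrow> 'g star_poly) \<Rightarrow> 'g star_poly set" where
  "unitarity_relators N v =
     {(\<Sum>k=1..N. v i k * poly_star (v j k)) - (if i = j then 1 else 0) | i j. i \<in> {1..N} \<and> j \<in> {1..N}} \<union>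
     {(\<Sum>k=1..N. poly_star (v k i) * v k j) - (if i = j then 1 else 0) | i j. i \<in> {1..N} \<and> j \<in> {1..N}}"

definition free_unitary_relators :: "nat \<Rightarrow> (nat \<times> nat) star_poly set" where
  "free_unitary_relators N =
     unitarity_relators N fundamental_matrix \<union>
     unitarity_relators N (conjugate_matrix fundamental_matrix)"

definition free_orthogonal_relators :: "nat \<Rightarrow> (nat \<times> nat) star_poly set" where
  "free_orthogonal_relators N =
     free_unitary_relators N \<union>
     {gen (i, j) - poly_star (gen (i, j)) | i j. i \<in> {1..N} \<and> j \<in> {1..N}}"

definition free_unitary_algebra :: "nat \<Rightarrow> (nat \<times> nat) star_poly set star_algebra" where
  "free_unitary_algebra N =
     presented_star_algebra ({1..N} \<times> {1..N}) (free_unitary_relators N)"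

definition free_orthogonal_algebra :: "nat \<Rightarrow> (nat \<times> nat) star_poly set star_algebra" where
  "free_orthogonal_algebra N =
     presented_star_algebra ({1..N} \<times> {1..N}) (free_orthogonal_relators N)"

section \<open>The objects above are star-algebras\<close>

lemma class_ring_cring: "cring (class_ring :: complex ring)"
proof (rule cringI)
  show "abelian_group (class_ring :: complex ring)"
  proof (rule abelian_groupI)
    fix x :: complex
    show "\<exists>y\<in>carrier class_ring. y \<oplus>\<^bsub>class_ring\<^esub> x = \<zero>\<^bsub>class_ring\<^esub>"
      by (intro bexI[of _ "- x"]) auto
  qed auto
  show "Group.comm_monoid (class_ring :: complex ring)"
    by (rule comm_monoidI) auto
qed (simp add: distrib_right)

lemma star_algebraI:
  fixes A :: "'a star_algebra" (structure)
  assumes "ring A"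
    and "\<And>c x. x \<in> carrier A \<Longrightarrow> c \<odot> x \<in> carrier A"
    and "\<And>c d x. x \<in> carrier A \<Longrightarrow> (c + d) \<odot> x = c \<odot> x \<oplus> d \<odot> x"
    and "\<And>c x y. x \<in> carrier A \<Longrightarrow> y \<in> carrier A \<Longrightarrow> c \<odot> (x \<oplus> y) = c \<odot> x \<oplus> c \<odot> y"
    and "\<And>c d x. x \<in> carrier A \<Longrightarrow> (c * d) \<odot> x = c \<odot> (d \<odot> x)"
    and "\<And>x. x \<in> carrier A \<Longrightarrow> 1 \<odot> x = x"
    and "\<And>c x y. x \<in> carrier A \<Longrightarrow> y \<in> carrier A \<Longrightarrow> (c \<odot> x) \<otimes> y = c \<odot> (x \<otimes> y)"
    and "\<And>c x y. x \<in> carrier A \<Longrightarrow> y \<in> carrier A \<Longrightarrow> x \<otimes> (c \<odot> y) = c \<odot> (x \<otimes> y)"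
    and "\<And>x. x \<in> carrier A \<Longrightarrow> star A x \<in> carrier A"
    and "\<And>x. x \<in> carrier A \<Longrightarrow> star A (star A x) = x"
    and "\<And>x y. x \<in> carrier A \<Longrightarrow> y \<in> carrier A \<Longrightarrow> star A (x \<oplus> y) = star A x \<oplus> star A y"
    and "\<And>c x. x \<in> carrier A \<Longrightarrow> star A (c \<odot> x) = cnj c \<odot> star A x"
    and "\<And>x y. x \<in> carrier A \<Longrightarrow> y \<in> carrier A \<Longrightarrow> star A (x \<otimes> y) = star A y \<otimes> star A x"
  shows "star_algebra A"
  using assms
  by (auto intro!: star_algebra.intro star_algebra_axioms.intro moduleI class_ring_cring ring.is_abelian_group)

lemma ring_cong:
  assumes "ring R" "carrier S = carrier R" "mult S = mult R" "one S = one R" "zero S = zero R" "add S = add R"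
  shows "ring S"
proof -
  interpret R: ring R by fact
  note eqs = assms(2-)
  show ?thesis
  proof (rule ringI)
    show "abelian_group S"
    proof (rule abelian_groupI)
      fix x assume "x \<in> carrier S"
      then show "\<exists>y\<in>carrier S. y \<oplus>\<^bsub>S\<^esub> x = \<zero>\<^bsub>S\<^esub>"
        unfolding eqs using R.l_neg R.a_inv_closed by blast
    qed (simp_all add: eqs R.a_assoc R.a_comm R.a_lcomm)
    show "Group.monoid S"
      by (rule Group.monoidI) (simp_all add: eqs R.m_assoc)
  qed (simp_all add: eqs R.l_distr R.r_distr)
qed

lemma index_mat_adjoint:
  assumes "M \<in> carrier_mat n m" "i < m" "j < n"
  shows "mat_adjoint M $$ (i, j) = conjugate (M $$ (j, i))"
  using assms by (auto simp: mat_adjoint_def mat_of_rows_def)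

lemma carrier_mat_adjoint: "M \<in> carrier_mat n n \<Longrightarrow> mat_adjoint M \<in> carrier_mat n n"
  by (auto simp: mat_adjoint_def)

lemma star_algebra_matrix: "star_algebra (matrix_star_algebra n)"
proof (rule star_algebraI)
  show "ring (matrix_star_algebra n)"
    by (rule ring_cong[OF ring_mat[where 'a = complex, of n "()"]])
      (simp_all add: matrix_star_algebra_def ring_mat_simps)
next
  fix x y assume xy: "x \<in> carrier (matrix_star_algebra n)" "y \<in> carrier (matrix_star_algebra n)"
  have c: "mat_adjoint x \<in> carrier_mat n n" "mat_adjoint y \<in> carrier_mat n n"
    "mat_adjoint (x * y) \<in> carrier_mat n n"
    using xy by (auto simp: matrix_star_algebra_def intro!: carrier_mat_adjoint)
  have "mat_adjoint (x * y) = mat_adjoint y * mat_adjoint x"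
  proof (rule eq_matI)
    fix i j assume "i < dim_row (mat_adjoint y * mat_adjoint x)" "j < dim_col (mat_adjoint y * mat_adjoint x)"
    then have ij: "i < n" "j < n" using c by auto
    have X: "x \<in> carrier_mat n n" "y \<in> carrier_mat n n" "x * y \<in> carrier_mat n n"
      using xy by (auto simp: matrix_star_algebra_def)
    show "mat_adjoint (x * y) $$ (i, j) = (mat_adjoint y * mat_adjoint x) $$ (i, j)"
      using ij c X
      by (auto simp: index_mat_adjoint[OF X(3)] scalar_prod_def index_mat_adjoint[OF X(1)] index_mat_adjoint[OF X(2)] mult.commute intro!: sum.cong)
  qed (use c in auto)
  then show "star (matrix_star_algebra n) (x \<otimes>\<^bsub>matrix_star_algebra n\<^esub> y) =
    star (matrix_star_algebra n) y \<otimes>\<^bsub>matrix_star_algebra n\<^esub> star (matrix_star_algebra n) x"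
    by (simp add: matrix_star_algebra_def)
next
  fix x y assume xy: "x \<in> carrier (matrix_star_algebra n)" "y \<in> carrier (matrix_star_algebra n)"
  then have X: "x \<in> carrier_mat n n" "y \<in> carrier_mat n n" "x + y \<in> carrier_mat n n"
    by (auto simp: matrix_star_algebra_def)
  note c = this[THEN carrier_mat_adjoint]
  have "mat_adjoint (x + y) = mat_adjoint x + mat_adjoint y"
    by (rule eq_matI; use c X in \<open>auto simp: index_mat_adjoint[OF X(3)] index_mat_adjoint[OF X(1)] index_mat_adjoint[OF X(2)]\<close>)
  then show "star (matrix_star_algebra n) (x \<oplus>\<^bsub>matrix_star_algebra n\<^esub> y) =
    star (matrix_star_algebra n) x \<oplus>\<^bsub>matrix_star_algebra n\<^esub> star (matrix_star_algebra n) y"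
    by (simp add: matrix_star_algebra_def)
next
  fix x c assume xy: "x \<in> carrier (matrix_star_algebra n)"
  then have X: "x \<in> carrier_mat n n" "c \<cdot>\<^sub>m x \<in> carrier_mat n n"
    by (auto simp: matrix_star_algebra_def)
  note c = this[THEN carrier_mat_adjoint]
  have "mat_adjoint (c \<cdot>\<^sub>m x) = cnj c \<cdot>\<^sub>m mat_adjoint x"
    by (rule eq_matI; use c X in \<open>auto simp: index_mat_adjoint[OF X(1)] index_mat_adjoint[OF X(2)]\<close>)
  then show "star (matrix_star_algebra n) (c \<odot>\<^bsub>matrix_star_algebra n\<^esub> x) =
    cnj c \<odot>\<^bsub>matrix_star_algebra n\<^esub> star (matrix_star_algebra n) x"
    by (simp add: matrix_star_algebra_def)
next
  fix x assume xy: "x \<in> carrier (matrix_star_algebra n)"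
  then have X: "x \<in> carrier_mat n n"
    by (auto simp: matrix_star_algebra_def)
  note c = this[THEN carrier_mat_adjoint]
  have "mat_adjoint (mat_adjoint x) = x"
    using carrier_mat_adjoint[OF c]
    by (intro eq_matI; use c X in \<open>auto simp: index_mat_adjoint[OF X(1)] index_mat_adjoint[OF c]\<close>)
  then show "star (matrix_star_algebra n) (star (matrix_star_algebra n) x) = x"
    by (simp add: matrix_star_algebra_def)
qed (auto simp: matrix_star_algebra_def intro: carrier_mat_adjoint add_smult_distrib_right_mat add_smult_distrib_left_mat)

lemma star_algebra_product:
  assumes "\<And>i. i \<in> I \<Longrightarrow> star_algebra (A i)"
  shows "star_algebra (product_star_algebra I A)"
proof -
  note ring_i = star_algebra.axioms(1)[OF assms]
  note mod_i = star_algebra.axioms(2)[OF assms]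
  note ag_i = ring.is_abelian_group[OF ring_i]
  note am_i = abelian_group.axioms(1)[OF ag_i]
  note mon_i = ring.is_monoid[OF ring_i]
  let ?P = "product_star_algebra I A"
  have carrier: "x \<in> carrier ?P \<longleftrightarrow> x \<in> extensional I \<and> (\<forall>i\<in>I. x i \<in> carrier (A i))" for x
    by (auto simp: product_star_algebra_def PiE_iff)
  have ext: "x = y" if "x \<in> extensional I" "y \<in> extensional I" "\<And>i. i \<in> I \<Longrightarrow> x i = y i" for x y
    using that by (rule extensionalityI)
  have ops: "(x \<otimes>\<^bsub>?P\<^esub> y) \<in> extensional I" "(x \<oplus>\<^bsub>?P\<^esub> y) \<in> extensional I"
    "\<one>\<^bsub>?P\<^esub> \<in> extensional I" "\<zero>\<^bsub>?P\<^esub> \<in> extensional I" "(c \<odot>\<^bsub>?P\<^esub> x) \<in> extensional I" "star ?P x \<in> extensional I" for x y c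
    by (simp_all add: product_star_algebra_def)
  have app: "(x \<otimes>\<^bsub>?P\<^esub> y) i = x i \<otimes>\<^bsub>A i\<^esub> y i" "(x \<oplus>\<^bsub>?P\<^esub> y) i = x i \<oplus>\<^bsub>A i\<^esub> y i"
    "\<one>\<^bsub>?P\<^esub> i = \<one>\<^bsub>A i\<^esub>" "\<zero>\<^bsub>?P\<^esub> i = \<zero>\<^bsub>A i\<^esub>" "(c \<odot>\<^bsub>?P\<^esub> x) i = c \<odot>\<^bsub>A i\<^esub> x i" "star ?P x i = star (A i) (x i)"
    if "i \<in> I" for x y c i
    using that by (simp_all add: product_star_algebra_def)
  have "ring ?P"
  proof (rule ringI)
    show "abelian_group ?P"
    proof (rule abelian_groupI)
      fix x assume "x \<in> carrier ?P"
      then show "\<exists>y\<in>carrier ?P. y \<oplus>\<^bsub>?P\<^esub> x = \<zero>\<^bsub>?P\<^esub>"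
        by (intro bexI[of _ "\<lambda>i\<in>I. \<ominus>\<^bsub>A i\<^esub> x i"] ext)
          (auto simp: carrier ops app abelian_group.l_neg[OF ag_i] abelian_group.a_inv_closed[OF ag_i])
    next
      fix x y assume "x \<in> carrier ?P" "y \<in> carrier ?P"
      then show "x \<oplus>\<^bsub>?P\<^esub> y = y \<oplus>\<^bsub>?P\<^esub> x"
        by (intro ext) (auto simp: carrier ops app intro!: abelian_monoid.a_comm[OF am_i])
    qed (auto simp: carrier ops app abelian_monoid.a_closed[OF am_i] abelian_monoid.zero_closed[OF am_i]
          abelian_monoid.a_assoc[OF am_i] abelian_monoid.l_zero[OF am_i]
          intro!: ext)
    show "Group.monoid ?P"
      by (rule Group.monoidI)
       (auto simp: carrier ops app monoid.m_closed[OF mon_i] monoid.one_closed[OF mon_i]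
          monoid.m_assoc[OF mon_i] monoid.l_one[OF mon_i] monoid.r_one[OF mon_i] intro!: ext)
  qed (auto simp: carrier ops app ring.ring_simprules(13)[OF ring_i] ring.ring_simprules(23)[OF ring_i]
        intro!: ext)
  then show ?thesis
    by (rule star_algebraI)
     (auto simp: carrier ops app intro!: ext simp:
       module.smult_closed[OF mod_i] module.smult_l_distr[OF mod_i, simplified] module.smult_r_distr[OF mod_i, simplified]
       module.smult_assoc1[OF mod_i, simplified] module.smult_one[OF mod_i, simplified]
       star_algebra.smult_mult_left[OF assms] star_algebra.smult_mult_right[OF assms]
       star_algebra.star_closed[OF assms] star_algebra.star_star[OF assms] star_algebra.star_add[OF assms]
       star_algebra.star_smult[OF assms] star_algebra.star_mult[OF assms])
qed

lemma letters_zero [simp]: "letters 0 = []"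
  by (simp add: zero_star_word_def)

lemma letters_plus [simp]: "letters (v + w) = letters v @ letters w"
  by (simp add: plus_star_word_def)

lemma adjoint_word_adjoint_word [simp]: "adjoint_word (adjoint_word w) = w"
  by (cases w) (auto simp: adjoint_word_def rev_map[symmetric] o_def case_prod_beta)

lemma adjoint_word_plus: "adjoint_word (v + w) = adjoint_word w + adjoint_word v"
  by (simp add: adjoint_word_def plus_star_word_def)

lemma adjoint_word_zero [simp]: "adjoint_word 0 = 0"
  by (simp add: adjoint_word_def zero_star_word_def)

lemma fst_letters_adjoint_word: "fst ` set (letters (adjoint_word w)) = fst ` set (letters w)"
  by (force simp: adjoint_word_def)

lemma lookup_poly_star: "Poly_Mapping.lookup (poly_star p) w = cnj (Poly_Mapping.lookup p (adjoint_word w))"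
proof -
  have eq: "(adjoint_word v = w) = (v = adjoint_word w)" for v
    by auto
  show ?thesis
    by (auto simp: poly_star_def lookup_sum lookup_single when_def eq in_keys_iff)
qed

lemma keys_poly_star: "w \<in> Poly_Mapping.keys (poly_star p) \<longleftrightarrow> adjoint_word w \<in> Poly_Mapping.keys p"
  by (simp add: in_keys_iff lookup_poly_star)

lemma poly_star_add: "poly_star (p + q) = poly_star p + poly_star q"
  by (rule poly_mapping_eqI) (simp add: lookup_poly_star lookup_add)

lemma poly_star_zero: "poly_star 0 = 0"
  by (rule poly_mapping_eqI) (simp add: lookup_poly_star)

lemma poly_star_sum: "poly_star (sum f S) = (\<Sum>x\<in>S. poly_star (f x))"
  by (induction S rule: infinite_finite_induct) (simp_all add: poly_star_add poly_star_zero)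

lemma poly_star_single:
  "poly_star (Poly_Mapping.single w c) = Poly_Mapping.single (adjoint_word w) (cnj c)"
  by (rule poly_mapping_eqI) (auto simp: lookup_poly_star lookup_single when_def)

lemma poly_star_poly_star [simp]: "poly_star (poly_star p) = p"
  by (rule poly_mapping_eqI) (simp add: lookup_poly_star)

lemma star_poly_expand: "p = (\<Sum>w\<in>Poly_Mapping.keys p. Poly_Mapping.single w (Poly_Mapping.lookup p w))"
  for p :: "'g star_poly"
  by (rule poly_mapping_eqI) (auto simp: lookup_sum lookup_single when_def in_keys_iff)

lemma star_poly_mult_expand:
  "p * q = (\<Sum>v\<in>Poly_Mapping.keys p. \<Sum>w\<in>Poly_Mapping.keys q.
     Poly_Mapping.single (v + w) (Poly_Mapping.lookup p v * Poly_Mapping.lookup q w))"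
  for p q :: "'g star_poly"
proof -
  have "(\<Sum>v\<in>Poly_Mapping.keys p. Poly_Mapping.single v (Poly_Mapping.lookup p v)) *
      (\<Sum>w\<in>Poly_Mapping.keys q. Poly_Mapping.single w (Poly_Mapping.lookup q w)) =
    (\<Sum>v\<in>Poly_Mapping.keys p. \<Sum>w\<in>Poly_Mapping.keys q.
       Poly_Mapping.single (v + w) (Poly_Mapping.lookup p v * Poly_Mapping.lookup q w))"
    by (simp only: sum_product mult_single)
  then show ?thesis
    by (simp only: star_poly_expand[symmetric])
qed

lemma poly_star_mult: "poly_star (p * q) = poly_star q * poly_star p"
proof -
  have "poly_star (p * q) = (\<Sum>v\<in>Poly_Mapping.keys p. \<Sum>w\<in>Poly_Mapping.keys q.
      Poly_Mapping.single (adjoint_word w) (cnj (Poly_Mapping.lookup q w)) *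
      Poly_Mapping.single (adjoint_word v) (cnj (Poly_Mapping.lookup p v)))"
    by (subst star_poly_mult_expand)
      (simp only: poly_star_sum poly_star_single mult_single adjoint_word_plus complex_cnj_mult mult.commute)
  also have "\<dots> = (\<Sum>w\<in>Poly_Mapping.keys q. \<Sum>v\<in>Poly_Mapping.keys p.
      Poly_Mapping.single (adjoint_word w) (cnj (Poly_Mapping.lookup q w)) *
      Poly_Mapping.single (adjoint_word v) (cnj (Poly_Mapping.lookup p v)))"
    by (rule sum.swap)
  also have "\<dots> = poly_star q * poly_star p"
    by (simp only: poly_star_def sum_product)
  finally show ?thesis .
qed

lemma single_zero_commute: "p * Poly_Mapping.single 0 c = Poly_Mapping.single 0 c * p"
  for p :: "'g star_poly"
proof -
  have "(\<Sum>v\<in>Poly_Mapping.keys p. Poly_Mapping.single v (Poly_Mapping.lookup p v)) * Poly_Mapping.single 0 c =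
      Poly_Mapping.single 0 c * (\<Sum>v\<in>Poly_Mapping.keys p. Poly_Mapping.single v (Poly_Mapping.lookup p v))"
    by (simp add: sum_distrib_left sum_distrib_right mult_single mult.commute)
  then show ?thesis
    by (simp only: star_poly_expand[symmetric])
qed

lemma star_algebra_free: "star_algebra (free_star_algebra X)"
proof (rule star_algebraI)
  show "ring (free_star_algebra X)"
  proof (rule ringI)
    show "abelian_group (free_star_algebra X)"
    proof (rule abelian_groupI)
      fix x assume "x \<in> carrier (free_star_algebra X)"
      then show "\<exists>y\<in>carrier (free_star_algebra X). y \<oplus>\<^bsub>free_star_algebra X\<^esub> x = \<zero>\<^bsub>free_star_algebra X\<^esub>"
        by (intro bexI[of _ "- x"]) (auto simp: free_star_algebra_def in_keys_iff)
    qed (use keys_add in \<open>fastforce simp: free_star_algebra_def add.assoc add.commute\<close>)+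
    show "Group.monoid (free_star_algebra X)"
      using keys_mult by (intro Group.monoidI) (fastforce simp: free_star_algebra_def mult.assoc)+
  qed (auto simp: free_star_algebra_def algebra_simps)
next
  fix c x assume "x \<in> carrier (free_star_algebra X)"
  then show "c \<odot>\<^bsub>free_star_algebra X\<^esub> x \<in> carrier (free_star_algebra X)"
    using keys_mult[of "Poly_Mapping.single 0 c" x] by (fastforce simp: free_star_algebra_def split: if_splits)
next
  fix x assume "x \<in> carrier (free_star_algebra X)"
  then have x: "fst ` set (letters w) \<subseteq> X" if "w \<in> Poly_Mapping.keys x" for w
    using that by (simp add: free_star_algebra_def)
  have "fst ` set (letters w) \<subseteq> X" if "w \<in> Poly_Mapping.keys (poly_star x)" for w
    using x[of "adjoint_word w"] that by (simp only: keys_poly_star fst_letters_adjoint_word)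
  then show "star (free_star_algebra X) x \<in> carrier (free_star_algebra X)"
    by (simp add: free_star_algebra_def)
next
  fix c x y assume "x \<in> carrier (free_star_algebra X)" "y \<in> carrier (free_star_algebra X)"
  have "x * (Poly_Mapping.single 0 c * y) = Poly_Mapping.single 0 c * (x * y)"
    by (metis single_zero_commute mult.assoc)
  then show "x \<otimes>\<^bsub>free_star_algebra X\<^esub> (c \<odot>\<^bsub>free_star_algebra X\<^esub> y) =
      c \<odot>\<^bsub>free_star_algebra X\<^esub> (x \<otimes>\<^bsub>free_star_algebra X\<^esub> y)"
    by (simp add: free_star_algebra_def)
next
  fix c x
  show "star (free_star_algebra X) (c \<odot>\<^bsub>free_star_algebra X\<^esub> x) =
      cnj c \<odot>\<^bsub>free_star_algebra X\<^esub> star (free_star_algebra X) x"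
    by (simp add: free_star_algebra_def poly_star_mult poly_star_single) (rule single_zero_commute)
qed (simp_all add: free_star_algebra_def single_add distrib_right distrib_left mult_single mult.assoc[symmetric]
      poly_star_add poly_star_mult)

lemma star_algebra_quotient:
  assumes "star_algebra A" "ideal I A" "star A ` I \<subseteq> I"
  shows "star_algebra (quotient_star_algebra A I)"
proof -
  interpret star_algebra A by fact
  interpret ideal I A by fact
  let ?Q = "quotient_star_algebra A I"
  have sc [simp]: "c \<odot>\<^bsub>A\<^esub> x \<in> carrier A" if "x \<in> carrier A" for c x
    using that smult_closed[of c x] by simp
  have smult_I: "c \<odot>\<^bsub>A\<^esub> x \<in> I" if "x \<in> I" for c x
  proof -
    have "x \<in> carrier A" using that a_Hcarr by blast
    then have "c \<odot>\<^bsub>A\<^esub> x = (c \<odot>\<^bsub>A\<^esub> \<one>\<^bsub>A\<^esub>) \<otimes>\<^bsub>A\<^esub> x"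
      by (simp add: smult_mult_left)
    then show ?thesis
      using I_l_closed[OF that, of "c \<odot>\<^bsub>A\<^esub> \<one>\<^bsub>A\<^esub>"] by simp
  qed
  have union_cosets: "(\<Union>x\<in>I +>\<^bsub>A\<^esub> a. I +>\<^bsub>A\<^esub> f x) = I +>\<^bsub>A\<^esub> f a"
    if f: "a \<in> carrier A" "\<And>x. x \<in> carrier A \<Longrightarrow> f x \<in> carrier A" "\<And>x. x \<in> I \<Longrightarrow> f x \<in> I"
      "\<And>x y. x \<in> carrier A \<Longrightarrow> y \<in> carrier A \<Longrightarrow> f (x \<oplus>\<^bsub>A\<^esub> y) = f x \<oplus>\<^bsub>A\<^esub> f y" for a f
  proof -
    have "I +>\<^bsub>A\<^esub> f x = I +>\<^bsub>A\<^esub> f a" if x: "x \<in> I +>\<^bsub>A\<^esub> a" for x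
    proof -
      obtain i where i: "i \<in> I" "x = i \<oplus>\<^bsub>A\<^esub> a"
        using x by (auto simp: a_r_coset_def r_coset_def)
      then have "f x = f i \<oplus>\<^bsub>A\<^esub> f a" "f i \<in> I"
        using f i a_Hcarr by simp_all
      then have "f x \<in> I +>\<^bsub>A\<^esub> f a"
        by (auto simp: a_r_coset_def r_coset_def)
      then show ?thesis
        using f(1,2) additive_subgroup.a_subgroup[OF is_additive_subgroup]
        by (intro a_repr_independence[symmetric]) auto
    qed
    then show ?thesis using a_rcos_self[OF f(1)] by blast
  qed
  have smult_coset: "c \<odot>\<^bsub>?Q\<^esub> (I +>\<^bsub>A\<^esub> a) = I +>\<^bsub>A\<^esub> (c \<odot>\<^bsub>A\<^esub> a)" if "a \<in> carrier A" for c a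
    using union_cosets[OF that, of "\<lambda>x. c \<odot>\<^bsub>A\<^esub> x"] smult_I
    by (simp add: quotient_star_algebra_def smult_r_distr)
  have star_coset: "star ?Q (I +>\<^bsub>A\<^esub> a) = I +>\<^bsub>A\<^esub> star A a" if "a \<in> carrier A" for a
    using union_cosets[OF that, of "star A"] assms(3)
    by (simp add: quotient_star_algebra_def star_closed star_add image_subset_iff)
  have mult_coset: "(I +>\<^bsub>A\<^esub> a) \<otimes>\<^bsub>?Q\<^esub> (I +>\<^bsub>A\<^esub> b) = I +>\<^bsub>A\<^esub> (a \<otimes>\<^bsub>A\<^esub> b)"
    and add_coset: "(I +>\<^bsub>A\<^esub> a) \<oplus>\<^bsub>?Q\<^esub> (I +>\<^bsub>A\<^esub> b) = I +>\<^bsub>A\<^esub> (a \<oplus>\<^bsub>A\<^esub> b)"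
    if "a \<in> carrier A" "b \<in> carrier A" for a b
    using that by (simp_all add: quotient_star_algebra_def rcoset_mult_add a_rcos_sum)
  have carrier: "X \<in> carrier ?Q \<longleftrightarrow> (\<exists>a\<in>carrier A. X = I +>\<^bsub>A\<^esub> a)" for X
    by (simp add: quotient_star_algebra_def A_RCOSETS_def' RCOSETS_def a_r_coset_def r_coset_def)
  have "ring ?Q"
    by (rule ring_cong[OF quotient_is_ring]) (simp_all add: FactRing_def quotient_star_algebra_def)
  moreover have "(c + d) \<odot>\<^bsub>A\<^esub> x = c \<odot>\<^bsub>A\<^esub> x \<oplus>\<^bsub>A\<^esub> d \<odot>\<^bsub>A\<^esub> x" "c \<odot>\<^bsub>A\<^esub> (x \<oplus>\<^bsub>A\<^esub> y) = c \<odot>\<^bsub>A\<^esub> x \<oplus>\<^bsub>A\<^esub> c \<odot>\<^bsub>A\<^esub> y"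
    "(c * d) \<odot>\<^bsub>A\<^esub> x = c \<odot>\<^bsub>A\<^esub> (d \<odot>\<^bsub>A\<^esub> x)" "1 \<odot>\<^bsub>A\<^esub> x = x"
    if "x \<in> carrier A" "y \<in> carrier A" for c d x y
    using that smult_l_distr[of c d x] smult_r_distr[of c x y] smult_assoc1[of c d x] smult_one[of x]
    by simp_all
  ultimately show ?thesis
    by (intro star_algebraI)
      (auto simp: carrier smult_coset star_coset mult_coset add_coset smult_mult_left smult_mult_right
        star_closed star_star star_add star_smult star_mult)
qed

lemma star_ideal_generated:
  assumes "star_algebra A" "R \<subseteq> carrier A"
  shows "ideal (star_ideal_generated A R) A"
    and "star A ` star_ideal_generated A R \<subseteq> star_ideal_generated A R"
    and "R \<subseteq> star_ideal_generated A R"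
proof -
  interpret star_algebra A by fact
  have "carrier A \<in> {I. ideal I A \<and> star A ` I \<subseteq> I \<and> R \<subseteq> I}"
    using assms(2) oneideal star_closed by auto
  then show "ideal (star_ideal_generated A R) A"
    unfolding star_ideal_generated_def by (intro i_Intersect) auto
  show "star A ` star_ideal_generated A R \<subseteq> star_ideal_generated A R"
    unfolding star_ideal_generated_def by blast
  show "R \<subseteq> star_ideal_generated A R"
    unfolding star_ideal_generated_def by blast
qed

lemma star_algebra_presented:
  "R \<subseteq> carrier (free_star_algebra X) \<Longrightarrow> star_algebra (presented_star_algebra X R)"
  unfolding presented_star_algebra_def
  by (intro star_algebra_quotient star_ideal_generated star_algebra_free)

lemma free_carrier_simps:
  fixes p q :: "'g star_poly"
  shows
  "g \<in> X \<Longrightarrow> gen g \<in> carrier (free_star_algebra X)"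
  "p \<in> carrier (free_star_algebra X) \<Longrightarrow> poly_star p \<in> carrier (free_star_algebra X)"
  "p \<in> carrier (free_star_algebra X) \<Longrightarrow> q \<in> carrier (free_star_algebra X) \<Longrightarrow> p * q \<in> carrier (free_star_algebra X)"
  "p \<in> carrier (free_star_algebra X) \<Longrightarrow> q \<in> carrier (free_star_algebra X) \<Longrightarrow> p - q \<in> carrier (free_star_algebra X)"
  "0 \<in> carrier (free_star_algebra X)" "1 \<in> carrier (free_star_algebra X)"
  "(\<And>x. x \<in> S \<Longrightarrow> f x \<in> carrier (free_star_algebra X)) \<Longrightarrow> sum f S \<in> carrier (free_star_algebra X)"
proof -
  have iff: "a \<in> carrier (free_star_algebra X) \<longleftrightarrow> (\<forall>w\<in>Poly_Mapping.keys a. fst ` set (letters w) \<subseteq> X)"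
    for a :: "'g star_poly"
    by (simp add: free_star_algebra_def)
  have keys_sub: "w \<in> Poly_Mapping.keys a \<or> w \<in> Poly_Mapping.keys b" if "w \<in> Poly_Mapping.keys (a - b)"
    for w :: "'g star_word" and a b :: "'g star_poly"
    using that by (auto simp: in_keys_iff lookup_minus)
  interpret star_algebra "free_star_algebra X" by (rule star_algebra_free)
  show "g \<in> X \<Longrightarrow> gen g \<in> carrier (free_star_algebra X)"
    by (simp add: free_star_algebra_def gen_def)
  show "p \<in> carrier (free_star_algebra X) \<Longrightarrow> poly_star p \<in> carrier (free_star_algebra X)"
    using star_closed[of p] by (simp add: free_star_algebra_def)
  show "p \<in> carrier (free_star_algebra X) \<Longrightarrow> q \<in> carrier (free_star_algebra X) \<Longrightarrow> p * q \<in> carrier (free_star_algebra X)"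
    using m_closed[of p q] by (simp add: free_star_algebra_def)
  show "p \<in> carrier (free_star_algebra X) \<Longrightarrow> q \<in> carrier (free_star_algebra X) \<Longrightarrow> p - q \<in> carrier (free_star_algebra X)"
    using keys_sub unfolding iff by blast
  show zero: "0 \<in> carrier (free_star_algebra X)"
    unfolding iff by simp
  show "1 \<in> carrier (free_star_algebra X)"
    unfolding iff by simp
  have plus: "p + q \<in> carrier (free_star_algebra X)"
    if "p \<in> carrier (free_star_algebra X)" "q \<in> carrier (free_star_algebra X)" for p q
    using that keys_add[of p q] unfolding iff by blast
  show "sum f S \<in> carrier (free_star_algebra X)" if "\<And>x. x \<in> S \<Longrightarrow> f x \<in> carrier (free_star_algebra X)"
    using that
  proof (induction S rule: infinite_finite_induct)
    case (insert x F)
    then have "f x \<in> carrier (free_star_algebra X)" "sum f F \<in> carrier (free_star_algebra X)" by blast+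
    then show ?case using insert.hyps plus by simp
  qed (auto intro: zero)
qed

lemma unitarity_relators_carrier:
  assumes "\<And>i j. i \<in> {1..N} \<Longrightarrow> j \<in> {1..N} \<Longrightarrow> v i j \<in> carrier (free_star_algebra X)"
  shows "unitarity_relators N v \<subseteq> carrier (free_star_algebra X)"
proof -
  have delta: "(if i = j then 1 else 0) \<in> carrier (free_star_algebra X)" for i j :: nat
    by (cases "i = j") (simp_all only: if_True if_False free_carrier_simps refl)
  show ?thesis
    unfolding unitarity_relators_def
    by (intro Un_least subsetI; elim CollectE exE conjE; hypsubst; intro free_carrier_simps delta assms; assumption)
qed

lemma free_unitary_relators_carrier:
  "free_unitary_relators N \<subseteq> carrier (free_star_algebra ({1..N} \<times> {1..N}))"
  unfolding free_unitary_relators_def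
  by (intro Un_least unitarity_relators_carrier)
    (simp_all only: fundamental_matrix_def conjugate_matrix_def free_carrier_simps mem_Sigma_iff simp_thms)

lemma free_orthogonal_relators_carrier:
  "free_orthogonal_relators N \<subseteq> carrier (free_star_algebra ({1..N} \<times> {1..N}))"
proof -
  have "gen (i, j) - poly_star (gen (i, j)) \<in> carrier (free_star_algebra ({1..N} \<times> {1..N}))"
    if "i \<in> {1..N}" "j \<in> {1..N}" for i j
    using that by (intro free_carrier_simps) simp_all
  then show ?thesis
    using free_unitary_relators_carrier unfolding free_orthogonal_relators_def by blast
qed

lemma star_algebra_free_unitary: "star_algebra (free_unitary_algebra N)"
  unfolding free_unitary_algebra_def
  by (rule star_algebra_presented[OF free_unitary_relators_carrier])

lemma star_algebra_free_orthogonal: "star_algebra (free_orthogonal_algebra N)"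
  unfolding free_orthogonal_algebra_def
  by (rule star_algebra_presented[OF free_orthogonal_relators_carrier])

section \<open>Independence of the index type\<close>

lemma embeds_in_matrix_product_index:
  fixes A :: "'a star_algebra"
  assumes "star_algebra A" "embeds_in_matrix_product TYPE('i) A"
  shows "embeds_in_matrix_product TYPE('a) A"
proof -
  interpret star_algebra A by fact
  from assms(2) obtain I :: "'i set" and n h where n: "\<forall>i\<in>I. n i \<ge> 1"
    and h: "h \<in> star_hom A (product_star_algebra I (\<lambda>i. matrix_star_algebra (n i)))"
    and inj: "inj_on h (carrier A)"
    unfolding embeds_in_matrix_product_def by blast
  define I' where "I' = carrier A - {\<zero>\<^bsub>A\<^esub>}"
  have closed: "h a \<in> (\<Pi>\<^sub>E i\<in>I. carrier_mat (n i) (n i))" if "a \<in> carrier A" for a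
    using h that by (auto simp: star_hom_def Ring.ring_hom_def product_star_algebra_def matrix_star_algebra_def)
  have "\<exists>i\<in>I. h a i \<noteq> h \<zero>\<^bsub>A\<^esub> i" if a: "a \<in> I'" for a
  proof (rule ccontr)
    assume "\<not> ?thesis"
    then have "h a = h \<zero>\<^bsub>A\<^esub>"
      using closed[of a] closed[of "\<zero>\<^bsub>A\<^esub>"] a by (intro PiE_ext) (auto simp: I'_def)
    then show False using inj a by (auto simp: I'_def inj_on_def)
  qed
  then obtain j where j: "\<And>a. a \<in> I' \<Longrightarrow> j a \<in> I \<and> h a (j a) \<noteq> h \<zero>\<^bsub>A\<^esub> (j a)"
    by metis
  define h' where "h' a = (\<lambda>b\<in>I'. h a (j b))" for a
  have hadd: "h (a \<oplus>\<^bsub>A\<^esub> b) i = h a i + h b i" if "a \<in> carrier A" "b \<in> carrier A" "i \<in> I" for a b i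
    using h that by (auto simp: star_hom_def Ring.ring_hom_def product_star_algebra_def matrix_star_algebra_def)
  have cancel: "X = 0\<^sub>m k k" if "X \<in> carrier_mat k k" "Y \<in> carrier_mat k k" "X + Y = Y"
    for X Y :: "complex mat" and k
  proof (rule eq_matI)
    fix r s assume "r < dim_row (0\<^sub>m k k :: complex mat)" "s < dim_col (0\<^sub>m k k :: complex mat)"
    then have rs: "r < k" "s < k" by auto
    then have "(X + Y) $$ (r, s) = X $$ (r, s) + Y $$ (r, s)" using that(1,2) by auto
    then have "X $$ (r, s) = 0" unfolding that(3) by simp
    then show "X $$ (r, s) = 0\<^sub>m k k $$ (r, s)" using rs by simp
  qed (use that in auto)
  have closed_j: "h a (j b) \<in> carrier_mat (n (j b)) (n (j b))" if "a \<in> carrier A" "b \<in> I'" for a b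
    using closed[OF that(1)] j[OF that(2)] by (auto simp: PiE_iff)
  have "h' \<in> star_hom A (product_star_algebra I' (\<lambda>b. matrix_star_algebra (n (j b))))"
    using h j closed_j unfolding star_hom_def Ring.ring_hom_def
    by (auto simp: product_star_algebra_def matrix_star_algebra_def h'_def fun_eq_iff PiE_iff
          restrict_def intro!: ext)
  moreover have "inj_on h' (carrier A)"
  proof (rule inj_onI, rule ccontr)
    fix a b assume ab: "a \<in> carrier A" "b \<in> carrier A" "h' a = h' b" "a \<noteq> b"
    define d where "d = a \<ominus>\<^bsub>A\<^esub> b"
    have d: "d \<in> I'" "d \<in> carrier A" "d \<oplus>\<^bsub>A\<^esub> b = a"
      using ab by (auto simp: d_def I'_def a_minus_def a_assoc l_neg r_right_minus_eq[unfolded a_minus_def])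
    have jd: "j d \<in> I" using j d by auto
    have "h d (j d) + h b (j d) = h a (j d)" using hadd[OF d(2) ab(2) jd] d(3) by simp
    also have "\<dots> = h b (j d)" using ab(3) d(1) by (auto simp: h'_def fun_eq_iff restrict_def split: if_splits)
    finally have "h d (j d) = 0\<^sub>m (n (j d)) (n (j d))"
      using closed[OF d(2)] closed[OF ab(2)] jd by (intro cancel[of _ _ "h b (j d)"]) auto
    moreover have "h \<zero>\<^bsub>A\<^esub> (j d) = 0\<^sub>m (n (j d)) (n (j d))"
      using closed[OF zero_closed] closed[OF ab(2)] jd hadd[OF zero_closed ab(2) jd] ab(2)
      by (intro cancel[of _ _ "h b (j d)"]) auto
    ultimately show False using j[OF d(1)] by simp
  qed
  ultimately show ?thesis
    unfolding embeds_in_matrix_product_def using n j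
    by (intro exI[of _ I'] exI[of _ "\<lambda>b. n (j b)"] exI[of _ h']) auto
qed

lemma residually_finiteI:
  fixes A :: "'a star_algebra"
  assumes "star_algebra A" "finitely_generated A" "embeds_in_matrix_product TYPE('i) A"
  shows "residually_finite A"
  using assms embeds_in_matrix_product_index unfolding residually_finite_def by blast

end

theory Submission
  imports Defs
begin

text \<open>
  A finite-dimensional representation is a matrix \<open>u\<close> with matrix entries such that \<open>u\<close> and its entrywise
  adjoint are unitary. Such matrices come from finite directed graphs whose edges carry a pair of unit
  vectors \<open>(a, b)\<close> of \<open>\<real>\<^sup>N\<close>: if at every vertex the labels \<open>a\<close> of the incoming edges form an orthonormal basis, and
  likewise for \<open>b\<close> and for the outgoing edges, then the sum of \<open>a b\<^sup>T \<otimes> |target\<rangle>\<langle>source|\<close> is biunitary. A path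
  whose consecutive labels are orthogonal where both edges enter or both edges leave the common vertex can be
  completed to such a graph: take a second copy of the path with all edges reversed and connect every vertex
  with its copy. If the edge directions of the path follow the stars of a word of length \<open>m\<close>, then the entry
  belonging to its end points vanishes on all shorter words and on words of length \<open>m\<close> with other stars, and
  evaluates the remaining monomials at the labels \<open>(a, b)\<close>. Self-adjoint entries correspond to undirected edges.

  On the algebraic side the unitarity relations rewrite two adjacent letters whose row (or column) indices
  both equal a pivot, which alternates between \<open>1\<close> and \<open>N\<close> along the word; so every element is congruent to a
  combination of words without such pairs. A multilinear function supported on these words that vanishes on
  all chains of orthogonal vectors is zero, and applying this to the top-degree part of a reduced polynomial,
  first in the row and then in the column indices, shows that the path representations separate points.
\<close>

section \<open>Chains of vectors and reduced words\<close>

text \<open>The pivot alternates along a word so that the rewriting rules for two adjacent pivots never overlap.\<close>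

definition pivot :: "nat \<Rightarrow> bool \<Rightarrow> nat" where
  "pivot N d = (if d then 1 else N)"

definition dot :: "nat \<Rightarrow> (nat \<Rightarrow> real) \<Rightarrow> (nat \<Rightarrow> real) \<Rightarrow> real" where
  "dot N a b = (\<Sum>i=1..N. a i * b i)"

text \<open>\<open>\<xi>\<close> is read as the coefficients of a multilinear form in the standard
  basis. Vectors are functions of which only the coordinates in \<open>{1..N}\<close>
  matter.\<close>

fun tensor_eval :: "nat \<Rightarrow> (nat list \<Rightarrow> complex) \<Rightarrow> (nat \<Rightarrow> real) list \<Rightarrow> complex" where
  "tensor_eval N \<xi> [] = \<xi> []"
| "tensor_eval N \<xi> (a # as) = (\<Sum>i=1..N. of_real (a i) * tensor_eval N (\<lambda>l. \<xi> (i # l)) as)"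

text \<open>\<open>F c c'\<close> tells whether the edges of adjacent letters with stars
  \<open>c\<close> and \<open>c'\<close> both enter or both leave their common vertex. It is a
  parameter because this always happens for undirected edges, and only for differing stars
  otherwise.\<close>

fun chain :: "nat \<Rightarrow> (bool \<Rightarrow> bool \<Rightarrow> bool) \<Rightarrow> bool list \<Rightarrow> (nat \<Rightarrow> real) list \<Rightarrow> bool" where
  "chain N F (c # c' # cs) (a # b # as) \<longleftrightarrow> (F c c' \<longrightarrow> dot N a b = 0) \<and> chain N F (c' # cs) (b # as)"
| "chain N F _ _ \<longleftrightarrow> True"

text \<open>Each orthogonality condition of a chain is matched by one excluded pair of indices, in
  accordance with the fact that the bilinear forms vanishing on all orthogonal pairs are the
  multiples of \<open>dot\<close>, a one-dimensional space.\<close>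

fun reduced :: "nat \<Rightarrow> (bool \<Rightarrow> bool \<Rightarrow> bool) \<Rightarrow> bool \<Rightarrow> bool list \<Rightarrow> nat list \<Rightarrow> bool" where
  "reduced N F d (c # c' # cs) (i # j # l) \<longleftrightarrow>
     \<not> (F c c' \<and> i = pivot N d \<and> j = pivot N d) \<and> reduced N F (\<not> d) (c' # cs) (j # l)"
| "reduced N F d _ _ \<longleftrightarrow> True"

definition words :: "nat \<Rightarrow> nat \<Rightarrow> nat list set" where
  "words N m = {l. length l = m \<and> set l \<subseteq> {1..N}}"

lemma words_Suc: "i # l \<in> words N (Suc m) \<longleftrightarrow> i \<in> {1..N} \<and> l \<in> words N m"
  by (auto simp: words_def)

lemma reduced_ConsD: "reduced N F d (c # cs) (i # l) \<Longrightarrow> reduced N F (\<not> d) cs l"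
  by (cases cs; cases l) auto

lemma tensor_eval_eq_0:
  assumes "\<And>l. l \<in> words N (length as) \<Longrightarrow> \<xi> l = 0"
  shows "tensor_eval N \<xi> as = 0"
  using assms
  by (induction as arbitrary: \<xi>) (auto simp: words_def intro!: sum.neutral)

section \<open>Rotations of chains in a coordinate plane\<close>

definition rotate_plane :: "nat \<Rightarrow> nat \<Rightarrow> real \<Rightarrow> (nat \<Rightarrow> real) \<Rightarrow> nat \<Rightarrow> real" where
  "rotate_plane s i \<theta> x = (\<lambda>k. if k = s then cos \<theta> * x s - sin \<theta> * x i
     else if k = i then sin \<theta> * x s + cos \<theta> * x i else x k)"

lemma dot_rotate_plane:
  assumes "s \<in> {1..N}" "i \<in> {1..N}" "s \<noteq> i"
  shows "dot N (rotate_plane s i \<theta> x) (rotate_plane s i \<theta> y) = dot N x y"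
proof -
  have split: "(\<Sum>k=1..N. f k) = f s + f i + (\<Sum>k\<in>{1..N} - {s} - {i}. f k)" for f :: "nat \<Rightarrow> real"
    using sum.remove[of "{1..N}" s f] sum.remove[of "{1..N} - {s}" i f] assms by simp
  have "(C * p - S * q) * (C * u - S * v) + (S * p + C * q) * (S * u + C * v) = (S\<^sup>2 + C\<^sup>2) * (p * u + q * v)"
    for C S p q u v :: real
    by (simp add: algebra_simps power2_eq_square)
  then have "(cos \<theta> * x s - sin \<theta> * x i) * (cos \<theta> * y s - sin \<theta> * y i)
      + (sin \<theta> * x s + cos \<theta> * x i) * (sin \<theta> * y s + cos \<theta> * y i)
      = ((sin \<theta>)\<^sup>2 + (cos \<theta>)\<^sup>2) * (x s * y s + x i * y i)"
    by blast
  moreover have "(\<Sum>k\<in>{1..N} - {s} - {i}. rotate_plane s i \<theta> x k * rotate_plane s i \<theta> y k)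
      = (\<Sum>k\<in>{1..N} - {s} - {i}. x k * y k)"
    by (intro sum.cong) (auto simp: rotate_plane_def)
  ultimately show ?thesis
    unfolding dot_def split using assms(3) by (simp add: rotate_plane_def)
qed

lemma chain_map:
  assumes "\<And>x y. dot N (f x) (f y) = dot N x y"
  shows "chain N F cs (map f as) \<longleftrightarrow> chain N F cs as"
proof (induction cs arbitrary: as)
  case (Cons c cs)
  show ?case
  proof (cases "\<exists>c' cs' a b bs. cs = c' # cs' \<and> as = a # b # bs")
    case True
    then obtain c' cs' a b bs where "cs = c' # cs'" "as = a # b # bs" by blast
    then show ?thesis using Cons.IH[of "b # bs"] assms by simp
  next
    case False
    then show ?thesis by (cases cs; cases as; cases "tl as") auto
  qed
qed simp

lemma isCont_tensor_eval_rotate_plane: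
  "isCont (\<lambda>\<theta>. tensor_eval N \<xi> (map (rotate_plane s i \<theta>) as)) \<theta>0"
proof (induction as arbitrary: \<xi>)
  case (Cons a as)
  have "isCont (\<lambda>\<theta>. rotate_plane s i \<theta> a k) \<theta>0" for k
    unfolding rotate_plane_def by (cases "k = s"; cases "k = i") (auto intro!: continuous_intros)
  then show ?case
    using Cons.IH by (auto intro!: continuous_intros)
qed simp

text \<open>A simultaneous small rotation of a chain is a chain and makes any coordinate of a nonzero vector nonzero.\<close>

lemma chain_eval_density:
  assumes vanish: "\<And>a as. length (a # as) = length cs \<Longrightarrow> chain N F cs (a # as) \<Longrightarrow> a s \<noteq> 0 \<Longrightarrow>
      tensor_eval N \<xi> (a # as) = 0"
    and s: "s \<in> {1..N}" and as: "length (a # as) = length cs" "chain N F cs (a # as)"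
  shows "tensor_eval N \<xi> (a # as) = 0"
proof (cases "\<exists>i\<in>{1..N}. a i \<noteq> 0")
  case False
  then show ?thesis by auto
next
  case True
  then obtain i where i: "i \<in> {1..N}" "a i \<noteq> 0" by blast
  show ?thesis
  proof (cases "a s = 0")
    case False
    then show ?thesis using vanish as by blast
  next
    case True
    then have si: "s \<noteq> i" using i by auto
    define f where "f \<theta> = tensor_eval N \<xi> (map (rotate_plane s i \<theta>) (a # as))" for \<theta>
    \<comment> \<open>As \<open>a s = 0\<close>, the rotated vector has the coordinate
      \<open>- sin \<theta> * a i\<close> at \<open>s\<close>, which is nonzero on this
      interval.\<close>
    have "f \<theta> = 0" if "0 < \<theta>" "\<theta> < pi" for \<theta>
    proof -
      have "rotate_plane s i \<theta> a s \<noteq> 0"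
        using sin_gt_zero[OF that] i True by (simp add: rotate_plane_def)
      moreover have "chain N F cs (map (rotate_plane s i \<theta>) (a # as))"
        using as(2) chain_map[OF dot_rotate_plane[OF s i(1) si]] by blast
      ultimately show ?thesis
        unfolding f_def using vanish as(1) by simp
    qed
    \<comment> \<open>\<open>f\<close> vanishes to the right of \<open>0\<close>, hence at
      \<open>0\<close> by continuity, and the angle \<open>0\<close> gives back the original
      chain.\<close>
    then have "eventually (\<lambda>\<theta>. f \<theta> = 0) (at_right 0)"
      unfolding eventually_at_right_field using pi_gt_zero by (intro exI[of _ pi]) simp
    moreover have "(f \<longlongrightarrow> f 0) (at_right 0)"
      unfolding f_def
      by (rule tendsto_within_subset[OF isCont_tensor_eval_rotate_plane[unfolded isCont_def]]) auto
    ultimately have "f 0 = 0"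
      using tendsto_unique[of "at_right (0::real)" f 0 "f 0"] tendsto_eventually[of f 0 "at_right 0"]
      by simp
    moreover have "rotate_plane s i 0 = id"
      by (auto simp: rotate_plane_def fun_eq_iff)
    ultimately show ?thesis
      by (simp add: f_def)
  qed
qed

text \<open>The flag \<open>z\<close> strengthens the induction: if only chains whose first vector has vanishing pivot coordinate are
  tested, then words starting with that pivot have to be excluded. Prepending the basis vector of the pivot
  reduces the slice of words starting with the pivot to the case \<open>z\<close> for the tail; once this slice vanishes,
  prepending \<open>e\<^sub>i - (b\<^sub>i / b\<^sub>s) e\<^sub>s\<close> to a chain starting with \<open>b\<close> handles the other slices.\<close>

lemma reduced_vanishing:
  assumes "N \<ge> 2"
    and "\<And>l. l \<in> words N (length cs) \<Longrightarrow> \<not> reduced N F d cs l \<Longrightarrow> \<xi> l = 0"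
    and "\<And>l. z \<Longrightarrow> l \<in> words N (length cs) \<Longrightarrow> l \<noteq> [] \<Longrightarrow> hd l = pivot N (\<not> d) \<Longrightarrow> \<xi> l = 0"
    and "\<And>as. length as = length cs \<Longrightarrow> chain N F cs as \<Longrightarrow>
      (z \<Longrightarrow> as \<noteq> [] \<Longrightarrow> hd as (pivot N (\<not> d)) = 0) \<Longrightarrow> tensor_eval N \<xi> as = 0"
    and "l \<in> words N (length cs)"
  shows "\<xi> l = 0"
  using assms(2-)
proof (induction cs arbitrary: d \<xi> z l)
  case Nil
  from Nil(3)[of "[]"] Nil(4) show ?case
    by (simp add: words_def)
next
  case (Cons c cs)
  define e where "e i = (\<lambda>k::nat. if k = i then 1 else 0 :: real)" for i
  note supp = Cons.prems(1) and zsupp = Cons.prems(2) and van = Cons.prems(3)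
  have eval_e: "tensor_eval N \<xi> (e i # as) = tensor_eval N (\<lambda>l. \<xi> (i # l)) as" if "i \<in> {1..N}" for i as
  proof -
    have "tensor_eval N \<xi> (e i # as) = (\<Sum>k=1..N. if k = i then tensor_eval N (\<lambda>l. \<xi> (k # l)) as else 0)"
      unfolding tensor_eval.simps e_def by (intro sum.cong) auto
    then show ?thesis using that by simp
  qed
  obtain i0 l0 where l: "l = i0 # l0" "i0 \<in> {1..N}" "l0 \<in> words N (length cs)"
    using Cons.prems(4) by (cases l) (auto simp: words_def)
  have supp': "\<xi> (i # l) = 0"
    if "i \<in> {1..N}" "l \<in> words N (length cs)" "\<not> reduced N F (\<not> d) cs l" for i l
    using supp[of "i # l"] reduced_ConsD[of N F d c cs i l] that by (auto simp: words_Suc)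
  show ?case
  proof (cases "z \<and> i0 = pivot N (\<not> d)")
    case True
    then show ?thesis using zsupp Cons.prems(4) l by simp
  next
    case nz: False
    have e0: "z \<Longrightarrow> e i0 (pivot N (\<not> d)) = 0"
      using nz by (auto simp: e_def)
    show ?thesis
    proof (cases "\<exists>c' cs'. cs = c' # cs' \<and> F c c'")
      case False
      \<comment> \<open>No condition links the first vector to the second, so \<open>e i0\<close>
        may be put in front of every chain for \<open>cs\<close>.\<close>
      have ch: "chain N F (c # cs) (a # as)" if "chain N F cs as" for a as
        using False that by (cases cs; cases as) auto
      have "\<xi> (i0 # l0) = 0"
      proof (rule Cons.IH[of "\<not> d" "\<lambda>l. \<xi> (i0 # l)" False])
        fix as :: "(nat \<Rightarrow> real) list"
        assume "length as = length cs" "chain N F cs as"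
        then show "tensor_eval N (\<lambda>l. \<xi> (i0 # l)) as = 0"
          using van[of "e i0 # as"] ch e0 eval_e[OF l(2)] by simp
      qed (use supp' l in auto)
      then show ?thesis using l by simp
    next
      case True
      then obtain c' cs' where cs: "cs = c' # cs'" "F c c'" by blast
      \<comment> \<open>\<open>s\<close> is the pivot of the first pair. It differs from the
        coordinate \<open>pivot N (\<not> d)\<close> that \<open>z\<close> restricts, so
        \<open>e s\<close> always meets that restriction.\<close>
      define s where "s = pivot N d"
      have s: "s \<in> {1..N}" "s \<noteq> pivot N (\<not> d)"
        using assms(1) by (auto simp: s_def pivot_def)
      have es: "e s (pivot N (\<not> d)) = 0"
        using s by (auto simp: e_def)
      have dot_e: "dot N (e i) b = b i" if "i \<in> {1..N}" for i b
      proof -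
        have "dot N (e i) b = (\<Sum>k=1..N. if k = i then b k else 0)"
          unfolding dot_def e_def by (intro sum.cong) auto
        then show ?thesis using that by simp
      qed
      have ch: "chain N F (c # cs) (a # b # as)" if "chain N F cs (b # as)" "dot N a b = 0" for a b as
        using that cs by simp
      \<comment> \<open>\<open>e s\<close> is orthogonal to \<open>b\<close> only if
        \<open>b s = 0\<close>, so just these chains can be tested. This is the flag
        \<open>True\<close> for the tail; the first letter to be excluded there is again
        \<open>s\<close>, and words starting with \<open>s\<close> twice are not reduced.\<close>
      have zero_s: "\<xi> (s # l) = 0" if "l \<in> words N (length cs)" for l
      proof (rule Cons.IH[of "\<not> d" "\<lambda>l. \<xi> (s # l)" True])
        fix as :: "(nat \<Rightarrow> real) list"
        assume as: "length as = length cs" "chain N F cs as"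
          "True \<Longrightarrow> as \<noteq> [] \<Longrightarrow> hd as (pivot N (\<not> \<not> d)) = 0"
        then obtain b bs where b: "as = b # bs" using cs by (cases as) auto
        have "b s = 0" using as(3) b by (simp add: s_def)
        then show "tensor_eval N (\<lambda>l. \<xi> (s # l)) as = 0"
          using van[of "e s # as"] ch[of b bs "e s"] as es b dot_e[OF s(1)] eval_e[OF s(1)]
          by (simp del: tensor_eval.simps)
      next
        fix l assume l: "l \<in> words N (length cs)" "l \<noteq> []" "hd l = pivot N (\<not> \<not> d)"
        then obtain l' where "l = s # l'" by (cases l) (auto simp: s_def)
        then show "\<xi> (s # l) = 0"
          using supp[of "s # l"] l(1) s cs by (simp add: words_Suc s_def)
      qed (use supp' s that in auto)
      show ?thesis
      proof (cases "i0 = s")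
        case True
        then show ?thesis using zero_s l by simp
      next
        case False
        have van': "tensor_eval N (\<lambda>l. \<xi> (i0 # l)) (b # as) = 0"
          if b: "length (b # as) = length cs" "chain N F cs (b # as)" "b s \<noteq> 0" for b as
        proof -
          define a where "a = (\<lambda>k. e i0 k - b i0 / b s * e s k)"
          have "dot N a b = dot N (e i0) b - b i0 / b s * dot N (e s) b"
            by (simp add: dot_def a_def sum_subtractf sum_distrib_left algebra_simps)
          then have 1: "dot N a b = 0" using b(3) l(2) s(1) by (simp add: dot_e)
          have "tensor_eval N \<xi> (a # b # as) = tensor_eval N \<xi> (e i0 # b # as)
              - of_real (b i0 / b s) * tensor_eval N \<xi> (e s # b # as)"
            unfolding tensor_eval.simps(2)[of N \<xi>] a_def of_real_diff of_real_mult
              sum_distrib_left sum_subtractf[symmetric] by (intro sum.cong) (auto simp: algebra_simps)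
          also have "\<dots> = tensor_eval N (\<lambda>l. \<xi> (i0 # l)) (b # as)"
            using tensor_eval_eq_0[of N "b # as" "\<lambda>l. \<xi> (s # l)"] zero_s b(1) eval_e[OF l(2)] eval_e[OF s(1)]
            by (simp del: tensor_eval.simps)
          finally show ?thesis
            using van[of "a # b # as"] ch[OF b(2) 1] b(1) e0 es by (simp add: a_def del: tensor_eval.simps)
        qed
        have "\<xi> (i0 # l0) = 0"
        proof (rule Cons.IH[of "\<not> d" "\<lambda>l. \<xi> (i0 # l)" False])
          fix as :: "(nat \<Rightarrow> real) list"
          assume as: "length as = length cs" "chain N F cs as"
          then obtain b bs where b: "as = b # bs" using cs by (cases as) auto
          \<comment> \<open>The division by \<open>b s\<close> confines \<open>van'\<close> to
            chains with \<open>b s \<noteq> 0\<close>; density removes this restriction.\<close>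
          show "tensor_eval N (\<lambda>l. \<xi> (i0 # l)) as = 0"
            unfolding b by (rule chain_eval_density[OF van' s(1)]) (use as b in auto)
        qed (use supp' l in auto)
        then show ?thesis using l by simp
      qed
    qed
  qed
qed

section \<open>Completing partial isometries\<close>

lemma sum_delta_mult:
  "finite S \<Longrightarrow> (\<Sum>j\<in>S. (if i = j then 1 else 0) * f j) = (if i \<in> S then f i else 0 :: real)"
  by (subst sum.cong[OF refl, of _ _ "\<lambda>j. if i = j then f j else 0"]) auto

text \<open>In the application \<open>p\<close> is \<open>r b\<close> and \<open>q\<close> is the
  transpose of \<open>r\<close> applied to \<open>a\<close>; the vectors multiplied are rows of the
  reflected \<open>r\<close> minus the rank-one matrix of \<open>a\<close> and \<open>b\<close>.
  Keeping \<open>p\<close>, \<open>q\<close> and \<open>h\<close> abstract lets the identity serve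
  the columns too, with \<open>a\<close>, \<open>p\<close> and \<open>b\<close>, \<open>q\<close>
  exchanged.\<close>

lemma reflected_rows:
  fixes r :: "nat \<Rightarrow> nat \<Rightarrow> real"
  assumes rr: "(\<Sum>k\<in>S. r i k * r j k) = D"
    and p: "(\<Sum>k\<in>S. r i k * b k) = p i" "(\<Sum>k\<in>S. r j k * b k) = p j"
    and q: "(\<Sum>k\<in>S. r i k * q k) = a i" "(\<Sum>k\<in>S. r j k * q k) = a j"
    and bb: "(\<Sum>k\<in>S. b k * b k) = 1" and qq: "(\<Sum>k\<in>S. q k * q k) = 1"
    and bq: "(\<Sum>k\<in>S. b k * q k) = c"
    and h: "h * (1 - c) = 1 \<or> h = 0 \<and> p i = a i \<and> p j = a j"
  shows "(\<Sum>k\<in>S. (r i k - h * (p i - a i) * (b k - q k) - a i * b k) *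
      (r j k - h * (p j - a j) * (b k - q k) - a j * b k)) = D - a i * a j"
proof -
  have "(\<Sum>k\<in>S. (r i k - h * (p i - a i) * (b k - q k) - a i * b k) *
      (r j k - h * (p j - a j) * (b k - q k) - a j * b k)) =
    (\<Sum>k\<in>S. r i k * r j k
      + (- h * (p j - a j) - a j) * (r i k * b k) + h * (p j - a j) * (r i k * q k)
      + (- h * (p i - a i) - a i) * (r j k * b k) + h * (p i - a i) * (r j k * q k)
      + (h * (p i - a i) + a i) * (h * (p j - a j) + a j) * (b k * b k)
      - ((h * (p i - a i) + a i) * (h * (p j - a j)) + h * (p i - a i) * (h * (p j - a j) + a j)) * (b k * q k)
      + h * (p i - a i) * (h * (p j - a j)) * (q k * q k))"
    by (intro sum.cong refl) (simp add: algebra_simps)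
  also have "\<dots> = D
      + (- h * (p j - a j) - a j) * p i + h * (p j - a j) * a i
      + (- h * (p i - a i) - a i) * p j + h * (p i - a i) * a j
      + (h * (p i - a i) + a i) * (h * (p j - a j) + a j)
      - ((h * (p i - a i) + a i) * (h * (p j - a j)) + h * (p i - a i) * (h * (p j - a j) + a j)) * c
      + h * (p i - a i) * (h * (p j - a j))"
    by (simp only: sum.distrib sum_subtractf sum_distrib_left[symmetric] rr p q bb qq bq mult_1_right)
  also have "\<dots> = D - a i * a j"
    using h
  proof
    assume h: "h * (1 - c) = 1"
    \<comment> \<open>The discrepancy contains the factor \<open>h * (1 - c) - 1\<close>, which is
      zero.\<close>
    have "D
      + (- h * (p j - a j) - a j) * p i + h * (p j - a j) * a i
      + (- h * (p i - a i) - a i) * p j + h * (p i - a i) * a j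
      + (h * (p i - a i) + a i) * (h * (p j - a j) + a j)
      - ((h * (p i - a i) + a i) * (h * (p j - a j)) + h * (p i - a i) * (h * (p j - a j) + a j)) * c
      + h * (p i - a i) * (h * (p j - a j)) - (D - a i * a j) =
      (h * (1 - c) - 1) * (2 * h * (p i - a i) * (p j - a j) + a i * (p j - a j) + a j * (p i - a i))"
      by (simp add: algebra_simps)
    then show ?thesis using h by simp
  qed (simp add: algebra_simps)
  finally show ?thesis .
qed

text \<open>For orthonormal families, possibly padded with zero vectors, \<open>r\<close> is a
  partial isometry: it annihilates the \<open>\<beta> t\<close> and maps their orthogonal complement
  isometrically onto that of the \<open>\<alpha> t\<close>.\<close>

definition complements ::
    "nat set \<Rightarrow> nat \<Rightarrow> (nat \<Rightarrow> nat \<Rightarrow> real) \<Rightarrow> (nat \<Rightarrow> nat \<Rightarrow> real) \<Rightarrow> (nat \<Rightarrow> nat \<Rightarrow> real) \<Rightarrow> bool" where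
  "complements S n \<alpha> \<beta> r \<longleftrightarrow>
     (\<forall>i\<in>S. \<forall>j\<in>S. (\<Sum>k\<in>S. r i k * r j k) = (if i = j then 1 else 0) - (\<Sum>t<n. \<alpha> t i * \<alpha> t j)) \<and>
     (\<forall>i\<in>S. \<forall>j\<in>S. (\<Sum>k\<in>S. r k i * r k j) = (if i = j then 1 else 0) - (\<Sum>t<n. \<beta> t i * \<beta> t j)) \<and>
     (\<forall>i\<in>S. \<forall>t<n. (\<Sum>k\<in>S. r i k * \<beta> t k) = 0 \<and> (\<Sum>k\<in>S. r k i * \<alpha> t k) = 0)"

text \<open>With \<open>H\<close> the Householder reflection exchanging the unit vectors \<open>r b\<close> and \<open>a\<close>, the new partial isometry
  is \<open>H r - a b\<^sup>T\<close>. If \<open>r b = a\<close>, then \<open>1 / (1 - c) = 1 / 0 = 0\<close> and the correction term vanishes, as it should.\<close>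

lemma complements_Suc:
  fixes r :: "nat \<Rightarrow> nat \<Rightarrow> real"
  assumes "finite S" and r: "complements S n \<alpha> \<beta> r"
    and unit: "(\<Sum>k\<in>S. \<alpha> n k * \<alpha> n k) = 1" "(\<Sum>k\<in>S. \<beta> n k * \<beta> n k) = 1"
    and orth: "\<And>t. t < n \<Longrightarrow> (\<Sum>k\<in>S. \<alpha> t k * \<alpha> n k) = 0" "\<And>t. t < n \<Longrightarrow> (\<Sum>k\<in>S. \<beta> t k * \<beta> n k) = 0"
  shows "\<exists>s. complements S (Suc n) \<alpha> \<beta> s"
proof -
  define a where "a = \<alpha> n"
  define b where "b = \<beta> n"
  note unit = unit[folded a_def b_def]
  note orth = orth[folded a_def b_def]
  from r have rows: "\<And>i j. i \<in> S \<Longrightarrow> j \<in> S \<Longrightarrow> (\<Sum>k\<in>S. r i k * r j k) = (if i = j then 1 else 0) - (\<Sum>t<n. \<alpha> t i * \<alpha> t j)"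
    and columns: "\<And>i j. i \<in> S \<Longrightarrow> j \<in> S \<Longrightarrow> (\<Sum>k\<in>S. r k i * r k j) = (if i = j then 1 else 0) - (\<Sum>t<n. \<beta> t i * \<beta> t j)"
    and kernel: "\<And>i t. i \<in> S \<Longrightarrow> t < n \<Longrightarrow> (\<Sum>k\<in>S. r i k * \<beta> t k) = 0"
      "\<And>i t. i \<in> S \<Longrightarrow> t < n \<Longrightarrow> (\<Sum>k\<in>S. r k i * \<alpha> t k) = 0"
    unfolding complements_def by simp_all
  \<comment> \<open>\<open>c\<close> is the inner product of \<open>a\<close> and
    \<open>r b\<close>. Both are unit vectors, so \<open>p - a\<close> has squared length
    \<open>2 * (1 - c)\<close>; hence \<open>h\<close> is the coefficient of the Householder
    reflection.\<close>
  define p where "p i = (\<Sum>k\<in>S. r i k * b k)" for i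
  define q where "q i = (\<Sum>k\<in>S. r k i * a k)" for i
  define c where "c = (\<Sum>k\<in>S. b k * q k)"
  define h where "h = 1 / (1 - c)"
  define s where "s i k = r i k - h * (p i - a i) * (b k - q k) - a i * b k" for i k
  \<comment> \<open>\<open>R\<close> times its transpose is the projection onto the complement of
    the \<open>\<gamma> t\<close>, so it fixes \<open>x\<close>.\<close>
  have recover: "(\<Sum>k\<in>S. R i k * (\<Sum>l\<in>S. R l k * x l)) = x i"
    if R: "\<And>j. j \<in> S \<Longrightarrow> (\<Sum>k\<in>S. R i k * R j k) = (if i = j then 1 else 0) - (\<Sum>t<n. \<gamma> t i * \<gamma> t j)"
      and x: "\<And>t. t < n \<Longrightarrow> (\<Sum>k\<in>S. \<gamma> t k * x k) = 0" and i: "i \<in> S"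
    for R :: "nat \<Rightarrow> nat \<Rightarrow> real" and \<gamma> x i
  proof -
    have "(\<Sum>k\<in>S. R i k * (\<Sum>l\<in>S. R l k * x l)) = (\<Sum>l\<in>S. (\<Sum>k\<in>S. R i k * R l k) * x l)"
      unfolding sum_distrib_left sum_distrib_right by (subst sum.swap) (simp add: mult.assoc)
    also have "\<dots> = (\<Sum>l\<in>S. (if i = l then 1 else 0) * x l) - (\<Sum>l\<in>S. (\<Sum>t<n. \<gamma> t i * \<gamma> t l) * x l)"
      unfolding sum_subtractf[symmetric] by (intro sum.cong) (simp_all add: R left_diff_distrib)
    also have "(\<Sum>l\<in>S. (\<Sum>t<n. \<gamma> t i * \<gamma> t l) * x l) = (\<Sum>t<n. \<gamma> t i * (\<Sum>l\<in>S. \<gamma> t l * x l))"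
      unfolding sum_distrib_left sum_distrib_right by (subst sum.swap) (simp add: mult.assoc)
    also have "\<dots> = 0" using x by simp
    finally show ?thesis using i assms(1) sum_delta_mult[of S i x] by simp
  qed
  have rq: "(\<Sum>k\<in>S. r i k * q k) = a i" if "i \<in> S" for i
    unfolding q_def using recover[where R = r and \<gamma> = \<alpha> and x = a] rows orth that by blast
  have rp: "(\<Sum>k\<in>S. r k i * p k) = b i" if "i \<in> S" for i
    unfolding p_def using recover[where R = "\<lambda>i k. r k i" and \<gamma> = \<beta> and x = b] columns orth that by blast
  have move: "(\<Sum>k\<in>S. (\<Sum>l\<in>S. r k l * x l) * y k) = (\<Sum>l\<in>S. x l * (\<Sum>k\<in>S. r k l * y k))" for x y
    unfolding sum_distrib_left sum_distrib_right
    by (subst sum.swap) (simp add: mult.assoc mult.left_commute)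
  have pp: "(\<Sum>k\<in>S. p k * p k) = 1"
    using move[of b p] rp unit by (simp add: p_def[symmetric])
  have qq: "(\<Sum>k\<in>S. q k * q k) = 1"
    using move[of q a] rq unit by (simp add: q_def[symmetric])
  have pa: "(\<Sum>k\<in>S. a k * p k) = c"
    using move[of b a] by (simp add: p_def[symmetric] q_def[symmetric] c_def mult.commute[of "a _" "p _"])
  have pt: "(\<Sum>k\<in>S. p k * \<alpha> t k) = 0" if "t < n" for t
    using move[of b "\<alpha> t"] kernel(2)[OF _ that] by (simp add: p_def[symmetric])
  have qt: "(\<Sum>k\<in>S. q k * \<beta> t k) = 0" if "t < n" for t
    using move[of "\<beta> t" a] kernel(1)[OF _ that] by (simp add: q_def[symmetric] mult.commute[of "\<beta> t _" "q _"])
  \<comment> \<open>This is the equality case of Cauchy-Schwarz; it shows that \<open>c = 1\<close>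
    forces \<open>p = a\<close> and \<open>q = b\<close>.\<close>
  have equal: "x i = y i"
    if "(\<Sum>k\<in>S. x k * x k) = 1" "(\<Sum>k\<in>S. y k * y k) = 1" "(\<Sum>k\<in>S. y k * x k) = 1" "i \<in> S"
    for x y :: "nat \<Rightarrow> real" and i
  proof -
    have "(\<Sum>k\<in>S. (x k - y k)\<^sup>2) = (\<Sum>k\<in>S. x k * x k - 2 * (y k * x k) + y k * y k)"
      by (intro sum.cong) (auto simp: power2_eq_square algebra_simps)
    also have "\<dots> = 0"
      by (simp only: sum.distrib sum_subtractf sum_distrib_left[symmetric] that)
    finally have "(\<Sum>k\<in>S. (x k - y k)\<^sup>2) = 0" .
    then have "(x i - y i)\<^sup>2 = 0"
      using assms(1) that(4) by (subst (asm) sum_nonneg_eq_0_iff) auto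
    then show ?thesis by simp
  qed
  have h: "h * (1 - c) = 1 \<or> h = 0 \<and> (\<forall>i\<in>S. p i = a i \<and> q i = b i)"
  proof (cases "c = 1")
    case True
    then have "p i = a i" "q i = b i" if "i \<in> S" for i
      using equal[OF pp unit(1) _ that] equal[OF qq unit(2) _ that] pa c_def by simp_all
    then show ?thesis using True by (simp add: h_def)
  qed (simp add: h_def)
  have hp: "h * (p i - a i) * (1 - c) = p i - a i" and hq: "h * (q i - b i) * (1 - c) = q i - b i" if "i \<in> S" for i
    using h that by (auto simp: mult.commute mult.left_commute)
  \<comment> \<open>The transpose of \<open>s\<close> has the same form with \<open>a\<close>,
    \<open>p\<close> and \<open>b\<close>, \<open>q\<close> exchanged, so its rows are covered by
    \<open>reflected_rows\<close> as well.\<close>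
  have s': "s k i = r k i - h * (q i - b i) * (a k - p k) - b i * a k" for i k
    by (simp add: s_def algebra_simps)
  have srow: "(\<Sum>k\<in>S. s i k * s j k) = (if i = j then 1 else 0) - (\<Sum>t<n. \<alpha> t i * \<alpha> t j) - a i * a j"
    if "i \<in> S" "j \<in> S" for i j
    unfolding s_def
    by (rule reflected_rows[where c = c]) (use that rows rq unit qq h c_def p_def in auto)
  have scol: "(\<Sum>k\<in>S. s k i * s k j) = (if i = j then 1 else 0) - (\<Sum>t<n. \<beta> t i * \<beta> t j) - b i * b j"
    if "i \<in> S" "j \<in> S" for i j
    unfolding s'
    by (rule reflected_rows[where c = c and r = "\<lambda>i k. r k i" and a = b and b = a and p = q and q = p])
      (use that columns rp unit pp h pa q_def in auto)
  have sx: "(\<Sum>k\<in>S. s i k * x k) = (\<Sum>k\<in>S. r i k * x k)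
      - h * (p i - a i) * ((\<Sum>k\<in>S. b k * x k) - (\<Sum>k\<in>S. q k * x k)) - a i * (\<Sum>k\<in>S. b k * x k)" for i x
    by (simp add: s_def left_diff_distrib sum_subtractf sum_distrib_left algebra_simps)
  have sy: "(\<Sum>k\<in>S. s k i * x k) = (\<Sum>k\<in>S. r k i * x k)
      - h * (q i - b i) * ((\<Sum>k\<in>S. a k * x k) - (\<Sum>k\<in>S. p k * x k)) - b i * (\<Sum>k\<in>S. a k * x k)" for i x
    by (simp add: s' left_diff_distrib sum_subtractf sum_distrib_left algebra_simps)
  have qb: "(\<Sum>k\<in>S. q k * b k) = c" and pa': "(\<Sum>k\<in>S. p k * a k) = c"
    using pa by (simp_all add: c_def mult.commute)
  \<comment> \<open>The reflection sends \<open>r b = p\<close> to \<open>p - (p - a) = a\<close>,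
    which the rank-one term cancels; the transpose behaves alike.\<close>
  have "(\<Sum>k\<in>S. s i k * b k) = 0" "(\<Sum>k\<in>S. s k i * a k) = 0" if "i \<in> S" for i
    using hp[OF that] hq[OF that] unfolding sx sy unit qb pa' p_def[symmetric] q_def[symmetric] by linarith+
  moreover have "(\<Sum>k\<in>S. s i k * \<beta> t k) = 0" "(\<Sum>k\<in>S. s k i * \<alpha> t k) = 0" if "i \<in> S" "t < n" for i t
    using orth[OF that(2)] pt[OF that(2)] qt[OF that(2)] kernel that unfolding sx sy
    by (simp_all add: mult.commute)
  ultimately have "complements S (Suc n) \<alpha> \<beta> s"
    using srow scol by (auto simp: complements_def less_Suc_eq a_def b_def diff_diff_eq)
  then show ?thesis by blast
qed

text \<open>Induction on the number of pairs, starting from the identity matrix. Pairs of zero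
  vectors leave the matrix as it is; admitting them allows one index range for the edges at a
  vertex, with zero labels for absent edges.\<close>

lemma complements_exists:
  assumes "finite S"
    and "\<And>t. t < n \<Longrightarrow> (\<Sum>k\<in>S. \<alpha> t k * \<alpha> t k) = 1 \<and> (\<Sum>k\<in>S. \<beta> t k * \<beta> t k) = 1 \<or> (\<forall>k. \<alpha> t k = 0 \<and> \<beta> t k = 0)"
    and "\<And>t u. t < n \<Longrightarrow> u < n \<Longrightarrow> t \<noteq> u \<Longrightarrow> (\<Sum>k\<in>S. \<alpha> t k * \<alpha> u k) = 0 \<and> (\<Sum>k\<in>S. \<beta> t k * \<beta> u k) = 0"
  shows "\<exists>r. complements S n \<alpha> \<beta> r"
  using assms(2,3)
proof (induction n)
  case 0
  have "(\<Sum>k\<in>S. (if i = k then 1 else 0) * (if j = k then 1 else 0)) = (if i = j then 1 else 0 :: real)"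
    "(\<Sum>k\<in>S. (if k = i then 1 else 0) * (if k = j then 1 else 0)) = (if i = j then 1 else 0 :: real)"
    if "i \<in> S" for i j
  proof -
    show "(\<Sum>k\<in>S. (if i = k then 1 else 0) * (if j = k then 1 else 0)) = (if i = j then 1 else 0 :: real)"
      using sum_delta_mult[OF assms(1), of i "\<lambda>k. if j = k then 1 else 0"] that by auto
    also have "(\<Sum>k\<in>S. (if i = k then 1 else 0) * (if j = k then 1 else 0)) =
      (\<Sum>k\<in>S. (if k = i then 1 else 0) * (if k = j then 1 else 0 :: real))"
      by (intro sum.cong) auto
    finally show "(\<Sum>k\<in>S. (if k = i then 1 else 0) * (if k = j then 1 else 0)) = (if i = j then 1 else 0 :: real)" .
  qed
  then show ?case
    by (intro exI[of _ "\<lambda>i j. if i = j then 1 else 0"]) (simp add: complements_def)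
next
  case (Suc n)
  have "\<exists>r. complements S n \<alpha> \<beta> r"
    by (rule Suc.IH) (use Suc.prems in auto)
  then obtain r where r: "complements S n \<alpha> \<beta> r" by blast
  from Suc.prems(1)[of n] consider "(\<Sum>k\<in>S. \<alpha> n k * \<alpha> n k) = 1" "(\<Sum>k\<in>S. \<beta> n k * \<beta> n k) = 1"
    | "\<forall>k. \<alpha> n k = 0 \<and> \<beta> n k = 0" by blast
  then show ?case
  proof cases
    case 1
    show ?thesis
      by (rule complements_Suc[OF assms(1) r 1]) (use Suc.prems(2) in auto)
  next
    case 2
    then have "complements S (Suc n) \<alpha> \<beta> r"
      using r by (auto simp: complements_def less_Suc_eq)
    then show ?thesis by blast
  qed
qed

section \<open>Biunitary matrices of labelled graphs\<close>

text \<open>\<open>A v t\<close> and \<open>B v t\<close> label the edge from \<open>t\<close> to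
  \<open>v\<close>, and zero labels mean that there is none. Row \<open>v\<close> collects the edges
  entering \<open>v\<close>, column \<open>v\<close> those leaving it; the labels in each are
  orthonormal, but not yet a basis.\<close>

definition bipartial :: "nat set \<Rightarrow> nat \<Rightarrow> (nat \<Rightarrow> nat \<Rightarrow> nat \<Rightarrow> real) \<Rightarrow> (nat \<Rightarrow> nat \<Rightarrow> nat \<Rightarrow> real) \<Rightarrow> bool" where
  "bipartial S M A B \<longleftrightarrow>
     (\<forall>v<M. \<forall>t<M. (\<Sum>k\<in>S. A v t k * A v t k) = 1 \<and> (\<Sum>k\<in>S. B v t k * B v t k) = 1 \<or> (\<forall>k. A v t k = 0 \<and> B v t k = 0)) \<and>
     (\<forall>v<M. \<forall>t<M. \<forall>u<M. t \<noteq> u \<longrightarrow>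
        (\<Sum>k\<in>S. A v t k * A v u k) = 0 \<and> (\<Sum>k\<in>S. B v t k * B v u k) = 0 \<and>
        (\<Sum>k\<in>S. A t v k * A u v k) = 0 \<and> (\<Sum>k\<in>S. B t v k * B u v k) = 0)"

text \<open>The vertex \<open>v\<close> of the path is the index \<open>2 * v\<close> and its copy is \<open>2 * v + 1\<close>. The matrices \<open>q v\<close> and \<open>r v\<close>
  collect the edges joining the two that complete the incoming and the outgoing edges at \<open>v\<close>.\<close>

definition doubled ::
    "(nat \<Rightarrow> nat \<Rightarrow> nat \<Rightarrow> real) \<Rightarrow> (nat \<Rightarrow> nat \<Rightarrow> nat \<Rightarrow> real) \<Rightarrow> (nat \<Rightarrow> nat \<Rightarrow> nat \<Rightarrow> real) \<Rightarrow> (nat \<Rightarrow> nat \<Rightarrow> nat \<Rightarrow> real) \<Rightarrow>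
     nat \<Rightarrow> nat \<Rightarrow> nat \<Rightarrow> nat \<Rightarrow> real" where
  "doubled A B q r i j x y =
     (if even x then
        if even y then A (x div 2) (y div 2) i * B (x div 2) (y div 2) j
        else if x div 2 = y div 2 then q (x div 2) i j else 0
      else
        if even y then if x div 2 = y div 2 then r (x div 2) i j else 0
        else A (y div 2) (x div 2) i * B (y div 2) (x div 2) j)"

lemma doubled_simps [simp]:
  "doubled A B q r i j (2 * v) (2 * t) = A v t i * B v t j"
  "doubled A B q r i j (2 * v) (Suc (2 * t)) = (if v = t then q v i j else 0)"
  "doubled A B q r i j (Suc (2 * v)) (2 * t) = (if v = t then r v i j else 0)"
  "doubled A B q r i j (Suc (2 * v)) (Suc (2 * t)) = A t v i * B t v j"
  by (simp_all add: doubled_def)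

lemma sum_double: "(\<Sum>y<2 * M. f y) = (\<Sum>t<M. f (2 * t)) + (\<Sum>t<M. f (Suc (2 * t)))"
  for f :: "nat \<Rightarrow> 'a::comm_monoid_add"
  by (induction M) (simp_all add: ac_simps)

text \<open>For \<open>x = z\<close> the edges of the graph contribute the projection onto their
  \<open>A\<close> labels and the connecting matrix the complementary one. Distinct original
  vertices, or distinct copies, have orthogonal \<open>B\<close> labels wherever their rows meet.
  Between a vertex and a copy, every term applies a connecting matrix to a \<open>B\<close> label
  that it annihilates.\<close>

lemma doubled_rows:
  assumes "bipartial S M A B"
    and q: "\<And>v. v < M \<Longrightarrow> complements S M (A v) (B v) (q v)"
    and r: "\<And>v. v < M \<Longrightarrow> complements S M (\<lambda>t. A t v) (\<lambda>t. B t v) (r v)"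
    and ij: "i \<in> S" "j \<in> S" and xz: "x < 2 * M" "z < 2 * M"
  shows "(\<Sum>y<2 * M. \<Sum>k\<in>S. doubled A B q r i k x y * doubled A B q r j k z y) = (if i = j \<and> x = z then 1 else 0)"
proof -
  have g1: "(\<Sum>k\<in>S. A v t i * B v t k * (A u t j * B u t k)) = (if v = u then A v t i * A v t j else 0)"
    if "v < M" "u < M" "t < M" for v t u
  proof -
    have "(\<Sum>k\<in>S. A v t i * B v t k * (A u t j * B u t k)) = A v t i * A u t j * (\<Sum>k\<in>S. B v t k * B u t k)"
      unfolding sum_distrib_left by (intro sum.cong) simp_all
    moreover have "v \<noteq> u \<Longrightarrow> (\<Sum>k\<in>S. B v t k * B u t k) = 0"
      "(\<Sum>k\<in>S. B v t k * B v t k) = 1 \<or> A v t i = 0"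
      using assms(1) that unfolding bipartial_def by blast+
    ultimately show ?thesis by (cases "v = u") auto
  qed
  have g2: "(\<Sum>k\<in>S. A t v i * B t v k * (A t u j * B t u k)) = (if v = u then A t v i * A t v j else 0)"
    if "v < M" "u < M" "t < M" for v t u
  proof -
    have "(\<Sum>k\<in>S. A t v i * B t v k * (A t u j * B t u k)) = A t v i * A t u j * (\<Sum>k\<in>S. B t v k * B t u k)"
      unfolding sum_distrib_left by (intro sum.cong) simp_all
    moreover have "v \<noteq> u \<Longrightarrow> (\<Sum>k\<in>S. B t v k * B t u k) = 0"
      "(\<Sum>k\<in>S. B t v k * B t v k) = 1 \<or> A t v i = 0"
      using assms(1) that unfolding bipartial_def by blast+
    ultimately show ?thesis by (cases "v = u") auto
  qed
  have qB: "(\<Sum>k\<in>S. q v l k * (A v t m * B v t k)) = 0" "(\<Sum>k\<in>S. A v t m * B v t k * q v l k) = 0"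
    if "v < M" "t < M" "l \<in> S" for v t l m
  proof -
    have "(\<Sum>k\<in>S. q v l k * (A v t m * B v t k)) = A v t m * (\<Sum>k\<in>S. q v l k * B v t k)"
      unfolding sum_distrib_left by (intro sum.cong) simp_all
    then show "(\<Sum>k\<in>S. q v l k * (A v t m * B v t k)) = 0"
      using q[OF that(1)] that by (simp add: complements_def)
    then show "(\<Sum>k\<in>S. A v t m * B v t k * q v l k) = 0"
      by (simp add: mult.commute)
  qed
  have rB: "(\<Sum>k\<in>S. r v l k * (A t v m * B t v k)) = 0" "(\<Sum>k\<in>S. A t v m * B t v k * r v l k) = 0"
    if "v < M" "t < M" "l \<in> S" for v t l m
  proof -
    have "(\<Sum>k\<in>S. r v l k * (A t v m * B t v k)) = A t v m * (\<Sum>k\<in>S. r v l k * B t v k)"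
      unfolding sum_distrib_left by (intro sum.cong) simp_all
    then show "(\<Sum>k\<in>S. r v l k * (A t v m * B t v k)) = 0"
      using r[OF that(1)] that by (simp add: complements_def)
    then show "(\<Sum>k\<in>S. A t v m * B t v k * r v l k) = 0"
      by (simp add: mult.commute)
  qed
  have qq: "(\<Sum>k\<in>S. q v i k * q v j k) = (if i = j then 1 else 0) - (\<Sum>t<M. A v t i * A v t j)"
    and rr: "(\<Sum>k\<in>S. r v i k * r v j k) = (if i = j then 1 else 0) - (\<Sum>t<M. A t v i * A t v j)"
    if "v < M" for v
    using q[OF that] r[OF that] ij by (simp_all add: complements_def)
  have if_sum: "(\<Sum>k\<in>S. (if v = t then f k else 0) * g k) = (if v = t then \<Sum>k\<in>S. f k * g k else 0)"
    "(\<Sum>k\<in>S. g k * (if v = t then f k else 0)) = (if v = t then \<Sum>k\<in>S. g k * f k else 0)"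
    for v t :: nat and f g :: "nat \<Rightarrow> real"
    by simp_all
  have pick: "(\<Sum>t<M. if v = t then f t else 0) = f v" if "v < M" for v and f :: "nat \<Rightarrow> real"
    using that by simp
  obtain v u where vu: "v < M" "u < M" "x = 2 * v \<or> x = Suc (2 * v)" "z = 2 * u \<or> z = Suc (2 * u)"
    using xz by (metis (no_types, lifting) less_mult_imp_div_less mult.commute even_two_times_div_two odd_two_times_div_two_succ Suc_eq_plus1)
  have eq: "Suc (2 * v) \<noteq> 2 * u" "Suc (2 * u) \<noteq> 2 * v"
    by presburger+
  from vu(3,4) show ?thesis
  proof (elim disjE)
    assume [simp]: "x = 2 * v" "z = 2 * u"
    have "(\<Sum>y<2 * M. \<Sum>k\<in>S. doubled A B q r i k x y * doubled A B q r j k z y) =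
      (\<Sum>t<M. if v = u then A v t i * A v t j else 0) + (\<Sum>t<M. if v = t then (if u = t then \<Sum>k\<in>S. q v i k * q u j k else 0) else 0)"
      unfolding sum_double using vu(1,2) by (simp add: g1 if_sum)
    also have "\<dots> = (if i = j \<and> x = z then 1 else 0)"
      using vu(1,2) qq[OF vu(1)] by (auto simp: pick)
    finally show ?thesis .
  next
    assume [simp]: "x = Suc (2 * v)" "z = Suc (2 * u)"
    have "(\<Sum>y<2 * M. \<Sum>k\<in>S. doubled A B q r i k x y * doubled A B q r j k z y) =
      (\<Sum>t<M. if v = t then (if u = t then \<Sum>k\<in>S. r v i k * r u j k else 0) else 0) + (\<Sum>t<M. if v = u then A t v i * A t v j else 0)"
      unfolding sum_double using vu(1,2) by (simp add: g2 if_sum)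
    also have "\<dots> = (if i = j \<and> x = z then 1 else 0)"
      using vu(1,2) rr[OF vu(1)] by (auto simp: pick)
    finally show ?thesis .
  next
    assume [simp]: "x = 2 * v" "z = Suc (2 * u)"
    have "(\<Sum>y<2 * M. \<Sum>k\<in>S. doubled A B q r i k x y * doubled A B q r j k z y) =
      (\<Sum>t<M. if u = t then \<Sum>k\<in>S. A v t i * B v t k * r u j k else 0) + (\<Sum>t<M. if v = t then \<Sum>k\<in>S. q v i k * (A t u j * B t u k) else 0)"
      unfolding sum_double using vu(1,2) by (simp only: doubled_simps if_sum \<open>x = 2 * v\<close> \<open>z = Suc (2 * u)\<close>)
    also have "\<dots> = 0"
      using vu(1,2) ij by (simp only: pick qB rB add_0_right)
    finally show ?thesis using eq by simp
  next
    assume [simp]: "x = Suc (2 * v)" "z = 2 * u"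
    have "(\<Sum>y<2 * M. \<Sum>k\<in>S. doubled A B q r i k x y * doubled A B q r j k z y) =
      (\<Sum>t<M. if v = t then \<Sum>k\<in>S. r v i k * (A u t j * B u t k) else 0) + (\<Sum>t<M. if u = t then \<Sum>k\<in>S. A t v i * B t v k * q u j k else 0)"
      unfolding sum_double using vu(1,2) by (simp only: doubled_simps if_sum \<open>z = 2 * u\<close> \<open>x = Suc (2 * v)\<close>)
    also have "\<dots> = 0"
      using vu(1,2) ij by (simp only: pick qB rB add_0_right)
    finally show ?thesis using eq by simp
  qed
qed

text \<open>Entries are real, so adjoints are transposes. The first and fourth equations say that
  the matrix of the \<open>U i j\<close> is unitary, the second and third that its entrywise adjoint
  is.\<close>

definition biunitary :: "nat set \<Rightarrow> nat \<Rightarrow> (nat \<Rightarrow> nat \<Rightarrow> nat \<Rightarrow> nat \<Rightarrow> real) \<Rightarrow> bool" where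
  "biunitary S n U \<longleftrightarrow> (\<forall>i\<in>S. \<forall>j\<in>S. \<forall>x<n. \<forall>z<n.
     (\<Sum>y<n. \<Sum>k\<in>S. U i k x y * U j k z y) = (if i = j \<and> x = z then 1 else 0) \<and>
     (\<Sum>y<n. \<Sum>k\<in>S. U k i x y * U k j z y) = (if i = j \<and> x = z then 1 else 0) \<and>
     (\<Sum>y<n. \<Sum>k\<in>S. U i k y x * U j k y z) = (if i = j \<and> x = z then 1 else 0) \<and>
     (\<Sum>y<n. \<Sum>k\<in>S. U k i y x * U k j y z) = (if i = j \<and> x = z then 1 else 0))"

lemma complements_swap: "complements S n \<alpha> \<beta> r \<Longrightarrow> complements S n \<beta> \<alpha> (\<lambda>i j. r j i)"
  by (simp add: complements_def)

lemma biunitary_extension: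
  assumes "finite S" "bipartial S M A B"
  shows "\<exists>U. biunitary S (2 * M) U \<and>
    (\<forall>i j v t. U i j (2 * v) (2 * t) = A v t i * B v t j) \<and>
    (\<forall>i j v t. U i j (Suc (2 * v)) (Suc (2 * t)) = A t v i * B t v j) \<and>
    (\<forall>i j v t. v \<noteq> t \<longrightarrow> U i j (2 * v) (Suc (2 * t)) = 0 \<and> U i j (Suc (2 * v)) (2 * t) = 0) \<and>
    ((\<forall>v t. A v t = A t v) \<longrightarrow> (\<forall>v t. B v t = B t v) \<longrightarrow> (\<forall>i j x y. U i j x y = U i j y x))"
proof -
  \<comment> \<open>Choosing \<open>q v\<close> and \<open>r v\<close> by \<open>SOME\<close> from
    their defining property makes them coincide as soon as \<open>A\<close> and \<open>B\<close> are
    symmetric. This yields the symmetry of \<open>U\<close> needed for self-adjoint entries.\<close>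
  define q where "q v = (SOME s. complements S M (A v) (B v) s)" for v
  define r where "r v = (SOME s. complements S M (\<lambda>t. A t v) (\<lambda>t. B t v) s)" for v
  have q: "complements S M (A v) (B v) (q v)" if "v < M" for v
    unfolding q_def
    by (rule someI_ex[of "complements S M (A v) (B v)"], rule complements_exists) (use assms that in \<open>auto simp: bipartial_def\<close>)
  have r: "complements S M (\<lambda>t. A t v) (\<lambda>t. B t v) (r v)" if "v < M" for v
    unfolding r_def
    by (rule someI_ex[of "complements S M (\<lambda>t. A t v) (\<lambda>t. B t v)"], rule complements_exists) (use assms that in \<open>auto simp: bipartial_def\<close>)
  have swap: "bipartial S M B A" and transpose: "bipartial S M (\<lambda>v t. A t v) (\<lambda>v t. B t v)"
    and both: "bipartial S M (\<lambda>v t. B t v) (\<lambda>v t. A t v)"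
    using assms(2) unfolding bipartial_def by blast+
  define U where "U = doubled A B q r"
  \<comment> \<open>Exchanging \<open>A\<close> with \<open>B\<close>, reversing all edges, or doing
    both turns \<open>U\<close> into one of its transposes, so \<open>doubled_rows\<close> gives all
    four relations.\<close>
  have U_swap: "doubled B A (\<lambda>v i j. q v j i) (\<lambda>v i j. r v j i) j i x y = U i j x y"
    and U_transpose: "doubled (\<lambda>v t. A t v) (\<lambda>v t. B t v) r q i j x y = U i j y x"
    and U_both: "doubled (\<lambda>v t. B t v) (\<lambda>v t. A t v) (\<lambda>v i j. r v j i) (\<lambda>v i j. q v j i) j i x y = U i j y x"
    for i j x y
    by (auto simp: U_def doubled_def)
  have "biunitary S (2 * M) U"
    unfolding biunitary_def
  proof (intro ballI allI impI conjI)
    fix i j x z assume *: "i \<in> S" "j \<in> S" "x < 2 * M" "z < 2 * M"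
    show "(\<Sum>y<2 * M. \<Sum>k\<in>S. U i k x y * U j k z y) = (if i = j \<and> x = z then 1 else 0)"
      unfolding U_def by (rule doubled_rows[OF assms(2) q r *])
    show "(\<Sum>y<2 * M. \<Sum>k\<in>S. U k i x y * U k j z y) = (if i = j \<and> x = z then 1 else 0)"
      using doubled_rows[OF swap complements_swap[OF q] complements_swap[OF r] *]
      by (simp only: U_swap)
    show "(\<Sum>y<2 * M. \<Sum>k\<in>S. U i k y x * U j k y z) = (if i = j \<and> x = z then 1 else 0)"
      using doubled_rows[OF transpose r q *]
      by (simp only: U_transpose)
    show "(\<Sum>y<2 * M. \<Sum>k\<in>S. U k i y x * U k j y z) = (if i = j \<and> x = z then 1 else 0)"
      using doubled_rows[OF both complements_swap[OF r] complements_swap[OF q] *]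
      by (simp only: U_both)
  qed
  moreover have "U i j x y = U i j y x" if "\<forall>v t. A v t = A t v" "\<forall>v t. B v t = B t v" for i j x y
  proof -
    have "(\<lambda>t. A t v) = A v" "(\<lambda>t. B t v) = B v" for v
      using that by (auto intro!: ext)
    then have "(\<lambda>v t. A t v) = A" "(\<lambda>v t. B t v) = B" "\<And>v. q v = r v"
      by (simp_all add: q_def r_def)
    then have "(\<lambda>v t. A t v) = A" "(\<lambda>v t. B t v) = B" "q = r"
      by (simp_all add: fun_eq_iff)
    then show ?thesis using U_transpose[of i j x y] by (simp add: U_def)
  qed
  ultimately show ?thesis
    by (intro exI[of _ U] conjI) (simp_all add: U_def)
qed

section \<open>Representations attached to paths\<close>

fun letter_matrix :: "('g \<Rightarrow> nat \<Rightarrow> nat \<Rightarrow> complex) \<Rightarrow> 'g \<times> bool \<Rightarrow> nat \<Rightarrow> nat \<Rightarrow> complex" where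
  "letter_matrix U (g, b) x z = (if b then cnj (U g z x) else U g x z)"

fun word_matrix :: "nat \<Rightarrow> ('g \<Rightarrow> nat \<Rightarrow> nat \<Rightarrow> complex) \<Rightarrow> ('g \<times> bool) list \<Rightarrow> nat \<Rightarrow> nat \<Rightarrow> complex" where
  "word_matrix n U [] x y = (if x = y then 1 else 0)"
| "word_matrix n U (l # w) x y = (\<Sum>z<n. letter_matrix U l x z * word_matrix n U w z y)"

text \<open>The vertices are \<open>0\<close> to \<open>length cs\<close>, and edge \<open>k\<close>
  joins \<open>k\<close> and \<open>Suc k\<close>. It is stored in row \<open>k\<close> for an
  unstarred letter and in row \<open>Suc k\<close> for a starred one, whose matrix gets transposed;
  either way, reading the letter leads from \<open>k\<close> to \<open>Suc k\<close>. With
  \<open>ort\<close> both entries are filled and the labels are symmetric.\<close>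

definition path_label :: "bool \<Rightarrow> bool list \<Rightarrow> (nat \<Rightarrow> real) list \<Rightarrow> nat \<Rightarrow> nat \<Rightarrow> nat \<Rightarrow> real" where
  "path_label ort cs as v t =
     (if t = Suc v \<and> v < length cs \<and> (ort \<or> \<not> cs ! v) then as ! v
      else if v = Suc t \<and> t < length cs \<and> (ort \<or> cs ! t) then as ! t
      else (\<lambda>_. 0))"

lemma chain_nth:
  assumes "chain N F cs as" "length cs = length as" "Suc k < length as" "F (cs ! k) (cs ! Suc k)"
  shows "dot N (as ! k) (as ! Suc k) = 0"
  using assms
proof (induction cs arbitrary: as k)
  case (Cons c cs)
  then obtain c' cs' a b bs where *: "cs = c' # cs'" "as = a # b # bs"
    by (cases cs; cases as; cases "tl as") auto
  show ?case
  proof (cases k)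
    case 0
    then show ?thesis using Cons.prems * by simp
  next
    case (Suc k')
    then show ?thesis using Cons.IH[of "b # bs" k'] Cons.prems * by simp
  qed
qed simp

text \<open>Two edges share a row or column only if they are consecutive and, unless
  \<open>ort\<close> holds, their stars differ. These are the places where a chain has orthogonal
  vectors.\<close>

lemma bipartial_path:
  assumes as: "length as = length cs" "chain N (\<lambda>c c'. ort \<or> c \<noteq> c') cs as" "\<forall>a\<in>set as. dot N a a = 1"
    and bs: "length bs = length cs" "chain N (\<lambda>c c'. ort \<or> c \<noteq> c') cs bs" "\<forall>b\<in>set bs. dot N b b = 1"
  shows "bipartial {1..N} (Suc (length cs)) (path_label ort cs as) (path_label ort cs bs)"
proof -
  have orth: "(\<Sum>k=1..N. path_label ort cs xs v t k * path_label ort cs xs v u k) = 0 \<and>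
      (\<Sum>k=1..N. path_label ort cs xs t v k * path_label ort cs xs u v k) = 0"
    if xs: "length xs = length cs" "chain N (\<lambda>c c'. ort \<or> c \<noteq> c') cs xs" and tu: "t \<noteq> u" for xs v t u
  proof -
    have fwd: "(\<Sum>k=1..N. (xs ! i) k * (xs ! Suc i) k) = 0" and bwd: "(\<Sum>k=1..N. (xs ! Suc i) k * (xs ! i) k) = 0"
      if "Suc i < length cs" "ort \<or> cs ! i \<noteq> cs ! Suc i" for i
      using chain_nth[OF xs(2)] xs(1) that by (simp_all add: dot_def mult.commute)
    have up: "path_label ort cs xs v (Suc v) = (if v < length cs \<and> (ort \<or> \<not> cs ! v) then xs ! v else (\<lambda>_. 0))"
      and down: "path_label ort cs xs (Suc v) v = (if v < length cs \<and> (ort \<or> cs ! v) then xs ! v else (\<lambda>_. 0))" for v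
      by (auto simp: path_label_def)
    have far: "path_label ort cs xs v t = (\<lambda>_. 0)" if "t \<noteq> Suc v" "v \<noteq> Suc t" for v t
      using that by (simp add: path_label_def)
    consider "t = Suc v" "v = Suc u" | "u = Suc v" "v = Suc t" | "t \<noteq> Suc v" "v \<noteq> Suc t" | "u \<noteq> Suc v" "v \<noteq> Suc u"
      using tu by linarith
    then show ?thesis
    proof cases
      case 1
      show ?thesis unfolding 1 up down using bwd[of u] by simp
    next
      case 2
      show ?thesis unfolding 2 up down using fwd[of t] by simp
    next
      case 3
      then show ?thesis using far[of t v] far[of v t] by simp
    next
      case 4
      then show ?thesis using far[of u v] far[of v u] by simp
    qed
  qed
  have "(\<Sum>k=1..N. path_label ort cs as v t k * path_label ort cs as v t k) = 1 \<and>
      (\<Sum>k=1..N. path_label ort cs bs v t k * path_label ort cs bs v t k) = 1 \<or>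
      (\<forall>k. path_label ort cs as v t k = 0 \<and> path_label ort cs bs v t k = 0)" for v t
  proof -
    have "path_label ort cs as v t \<in> set as \<and> path_label ort cs bs v t \<in> set bs \<or>
        path_label ort cs as v t = (\<lambda>_. 0) \<and> path_label ort cs bs v t = (\<lambda>_. 0)"
      using as(1) bs(1) by (auto simp: path_label_def)
    then show ?thesis
      using as(3) bs(3) unfolding dot_def by (elim disjE conjE) simp_all
  qed
  then show ?thesis
    using orth[OF as(1,2)] orth[OF bs(1,2)] unfolding bipartial_def by blast
qed

text \<open>A letter changes the underlying vertex \<open>x div 2\<close> by at most one, and
  passing between a vertex and its copy leaves it unchanged. Words shorter than the path therefore
  never reach its end, and words of equal length must advance along the original path at every step,
  which leaves a single product of labels.\<close>

lemma path_representation: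
  assumes as: "length as = length cs" "chain N (\<lambda>c c'. ort \<or> c \<noteq> c') cs as" "\<forall>a\<in>set as. dot N a a = 1"
    and bs: "length bs = length cs" "chain N (\<lambda>c c'. ort \<or> c \<noteq> c') cs bs" "\<forall>b\<in>set bs. dot N b b = 1"
  shows "\<exists>U. biunitary {1..N} (2 * Suc (length cs)) U \<and> (ort \<longrightarrow> (\<forall>i j x y. U i j x y = U i j y x)) \<and>
    (\<forall>w. length w \<le> length cs \<longrightarrow>
      word_matrix (2 * Suc (length cs)) (\<lambda>(i, j) x y. of_real (U i j x y)) w 0 (2 * length cs) =
        (if length w = length cs then \<Prod>k<length cs. if ort \<or> snd (w ! k) = cs ! k
           then of_real ((as ! k) (fst (fst (w ! k))) * (bs ! k) (snd (fst (w ! k)))) else 0 else 0))"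
proof -
  define A where "A = path_label ort cs as"
  define B where "B = path_label ort cs bs"
  define m where "m = length cs"
  obtain U where U: "biunitary {1..N} (2 * Suc m) U"
    and even: "\<forall>i j v t. U i j (2 * v) (2 * t) = A v t i * B v t j"
    and odd: "\<forall>i j v t. U i j (Suc (2 * v)) (Suc (2 * t)) = A t v i * B t v j"
    and off: "\<forall>i j v t. v \<noteq> t \<longrightarrow> U i j (2 * v) (Suc (2 * t)) = 0 \<and> U i j (Suc (2 * v)) (2 * t) = 0"
    and sym: "(\<forall>v t. A v t = A t v) \<longrightarrow> (\<forall>v t. B v t = B t v) \<longrightarrow> (\<forall>i j x y. U i j x y = U i j y x)"
    using biunitary_extension[OF finite_atLeastAtMost bipartial_path[OF as bs]]
    unfolding A_def[symmetric] B_def[symmetric] m_def[symmetric] by (elim exE conjE) (rule that)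
  have ee: "U i j (2 * v) (2 * t) = A v t i * B v t j"
    and oo: "U i j (Suc (2 * v)) (Suc (2 * t)) = A t v i * B t v j"
    for i j v t
    using even odd by blast+
  have eo: "U i j (2 * v) (Suc (2 * t)) = 0" and oe: "U i j (Suc (2 * v)) (2 * t) = 0" if "v \<noteq> t" for i j v t
    using off that by blast+
  define n where "n = 2 * Suc m"
  define V where "V = (\<lambda>(i, j) x y. complex_of_real (U i j x y))"
  have V: "V g x y = of_real (U (fst g) (snd g) x y)" for g x y
    by (simp add: V_def case_prod_beta)
  have far: "U i j x z = 0" "U i j z x = 0" if "z div 2 > Suc (x div 2)" for i j x z
  proof -
    obtain v where v: "x = 2 * v \<or> x = Suc (2 * v)" by (metis evenE oddE Suc_eq_plus1)
    obtain t where t: "z = 2 * t \<or> z = Suc (2 * t)" by (metis evenE oddE Suc_eq_plus1)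
    have "t > Suc v" using v t that by auto
    then have "A v t = (\<lambda>_. 0)" "A t v = (\<lambda>_. 0)" "v \<noteq> t" "t \<noteq> v"
      by (auto simp: A_def path_label_def)
    then show "U i j x z = 0" "U i j z x = 0"
      using v t by (auto simp: ee eo oe oo)
  qed
  have letter_far: "letter_matrix V l x z = 0" if "z div 2 > Suc (x div 2)" for l x z
    using far[OF that] by (cases l) (simp add: V)
  have short: "word_matrix n V w x (2 * m) = 0" if "x div 2 + length w < m" for w x
    using that
  proof (induction w arbitrary: x)
    case (Cons l w)
    have "letter_matrix V l x z * word_matrix n V w z (2 * m) = 0" for z
      using letter_far[of x z l] Cons.IH[of z] Cons.prems by (cases "z div 2 > Suc (x div 2)") auto
    then show ?case by simp
  qed auto
  have step: "letter_matrix V l (2 * v) (2 * Suc v) =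
      (if ort \<or> snd l = cs ! v then of_real ((as ! v) (fst (fst l)) * (bs ! v) (snd (fst l))) else 0)"
    if "v < m" for l v
  proof -
    obtain g c where l: "l = (g, c)" by (cases l)
    show ?thesis
    proof (cases c)
      case True
      then show ?thesis
        using that ee[of _ _ "Suc v" v] by (simp add: l V m_def A_def B_def path_label_def)
    next
      case False
      then show ?thesis
        using that ee[of _ _ v "Suc v"] by (simp add: l V m_def A_def B_def path_label_def)
    qed
  qed
  \<comment> \<open>Vertices are joined only to their own copies, so a step forward cannot end in a
    copy.\<close>
  have odd_step: "letter_matrix V l (2 * v) (Suc (2 * Suc v)) = 0" for l v
    using eo[of v "Suc v"] oe[of "Suc v" v] by (cases l) (simp add: V)
  have long: "word_matrix n V w (2 * v) (2 * m) =
      (\<Prod>k<length w. if ort \<or> snd (w ! k) = cs ! (v + k)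
           then of_real ((as ! (v + k)) (fst (fst (w ! k))) * (bs ! (v + k)) (snd (fst (w ! k)))) else 0)"
    if "v + length w = m" for w v
    using that
  proof (induction w arbitrary: v)
    case (Cons l w)
    \<comment> \<open>Only the next vertex of the original path contributes: its copy and all
      farther vertices have zero letter entries, and from the vertices up to \<open>v\<close> the
      remaining word is too short to reach the end.\<close>
    have "letter_matrix V l (2 * v) z * word_matrix n V w z (2 * m) = 0"
      if "z \<noteq> 2 * Suc v" for z
    proof -
      consider "z div 2 > Suc v" | "z div 2 = Suc v" | "z div 2 \<le> v"
        by linarith
      then show ?thesis
      proof cases
        case 1
        then show ?thesis using letter_far[of "2 * v" z l] by simp
      next
        case 2
        then have "z = Suc (2 * Suc v)" using that by presburger
        then show ?thesis using odd_step by simp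
      next
        case 3
        then show ?thesis using short[of z w] Cons.prems by simp
      qed
    qed
    then have "word_matrix n V (l # w) (2 * v) (2 * m) =
        (\<Sum>z<n. if z = 2 * Suc v
           then letter_matrix V l (2 * v) (2 * Suc v) * word_matrix n V w (2 * Suc v) (2 * m) else 0)"
      unfolding word_matrix.simps by (intro sum.cong refl) (simp del: mult_Suc_right)
    also have "\<dots> = letter_matrix V l (2 * v) (2 * Suc v) * word_matrix n V w (2 * Suc v) (2 * m)"
      using Cons.prems by (simp add: n_def)
    finally have eq: "word_matrix n V (l # w) (2 * v) (2 * m) =
        letter_matrix V l (2 * v) (2 * Suc v) * word_matrix n V w (2 * Suc v) (2 * m)" .
    have v: "v < m" "Suc v + length w = m" using Cons.prems by simp_all
    show ?case
      unfolding eq step[OF v(1)] Cons.IH[OF v(2)]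
      by (simp only: prod.lessThan_Suc_shift length_Cons nth_Cons_0 nth_Cons_Suc add_0_right add_Suc_right add_Suc)
  qed simp
  have symmetric: "ort \<longrightarrow> (\<forall>i j x y. U i j x y = U i j y x)"
  proof
    assume ort
    then have "path_label ort cs xs v t = path_label ort cs xs t v" for xs v t
      by (auto simp: path_label_def)
    then show "\<forall>i j x y. U i j x y = U i j y x" using sym by (simp add: A_def B_def)
  qed
  have entry: "word_matrix n V w 0 (2 * m) = (if length w = m then \<Prod>k<m. if ort \<or> snd (w ! k) = cs ! k
           then of_real ((as ! k) (fst (fst (w ! k))) * (bs ! k) (snd (fst (w ! k)))) else 0 else 0)"
    if "length w \<le> m" for w
    using short[of 0 w] long[of 0 w, unfolded add_0 mult_0_right] that by (cases "length w = m") simp_all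
  have "biunitary {1..N} n U \<and> (ort \<longrightarrow> (\<forall>i j x y. U i j x y = U i j y x)) \<and>
    (\<forall>w. length w \<le> m \<longrightarrow> word_matrix n V w 0 (2 * m) =
        (if length w = m then \<Prod>k<m. if ort \<or> snd (w ! k) = cs ! k
           then of_real ((as ! k) (fst (fst (w ! k))) * (bs ! k) (snd (fst (w ! k)))) else 0 else 0))"
  proof (intro conjI)
    show "biunitary {1..N} n U" using U by (simp only: n_def)
    show "ort \<longrightarrow> (\<forall>i j x y. U i j x y = U i j y x)" by (rule symmetric)
  qed (intro allI impI entry)
  then show ?thesis
    unfolding n_def V_def m_def by (intro exI[of _ U])
qed

section \<open>Matrix evaluations of noncommutative polynomials\<close>

definition linear_extension :: "('g star_word \<Rightarrow> complex) \<Rightarrow> 'g star_poly \<Rightarrow> complex" where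
  "linear_extension f p = (\<Sum>w\<in>Poly_Mapping.keys p. Poly_Mapping.lookup p w * f w)"

lemma linear_extension_superset:
  assumes "finite S" "Poly_Mapping.keys p \<subseteq> S"
  shows "linear_extension f p = (\<Sum>w\<in>S. Poly_Mapping.lookup p w * f w)"
  unfolding linear_extension_def
  by (rule sum.mono_neutral_left) (use assms in \<open>auto simp: in_keys_iff\<close>)

lemma linear_extension_add: "linear_extension f (p + q) = linear_extension f p + linear_extension f q"
proof -
  let ?S = "Poly_Mapping.keys p \<union> Poly_Mapping.keys q"
  have "Poly_Mapping.keys (p + q) \<subseteq> ?S" by (rule keys_add)
  then show ?thesis
    using linear_extension_superset[of ?S p f] linear_extension_superset[of ?S q f]
      linear_extension_superset[of ?S "p + q" f]
    by (simp add: lookup_add distrib_right sum.distrib)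
qed

lemma linear_extension_zero [simp]: "linear_extension f 0 = 0"
  by (simp add: linear_extension_def)

lemma linear_extension_sum: "linear_extension f (sum g S) = (\<Sum>x\<in>S. linear_extension f (g x))"
  by (induction S rule: infinite_finite_induct) (simp_all add: linear_extension_add)

lemma linear_extension_uminus: "linear_extension f (- p) = - linear_extension f p"
  using linear_extension_add[of f p "- p"] by (simp add: eq_neg_iff_add_eq_0 add.commute)

lemma linear_extension_diff: "linear_extension f (p - q) = linear_extension f p - linear_extension f q"
  using linear_extension_add[of f p "- q"] by (simp add: linear_extension_uminus)

lemma linear_extension_single [simp]: "linear_extension f (Poly_Mapping.single w c) = c * f w"
  by (simp add: linear_extension_def)

lemma linear_extension_mult:
  "linear_extension f (p * q) = (\<Sum>v\<in>Poly_Mapping.keys p. \<Sum>w\<in>Poly_Mapping.keys q.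
     Poly_Mapping.lookup p v * Poly_Mapping.lookup q w * f (v + w))"
  by (subst star_poly_mult_expand) (simp add: linear_extension_sum)

lemma linear_extension_poly_star:
  "linear_extension f (poly_star p) = (\<Sum>w\<in>Poly_Mapping.keys p. cnj (Poly_Mapping.lookup p w) * f (adjoint_word w))"
  by (simp add: poly_star_def linear_extension_sum)

definition poly_matrix :: "nat \<Rightarrow> ('g \<Rightarrow> nat \<Rightarrow> nat \<Rightarrow> complex) \<Rightarrow> 'g star_poly \<Rightarrow> nat \<Rightarrow> nat \<Rightarrow> complex" where
  "poly_matrix n U p x y = linear_extension (\<lambda>w. word_matrix n U (letters w) x y) p"

lemma word_matrix_append:
  assumes "x < n"
  shows "word_matrix n U (v @ w) x y = (\<Sum>z<n. word_matrix n U v x z * word_matrix n U w z y)"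
  using assms
proof (induction v arbitrary: x)
  case Nil
  have "(\<Sum>z<n. word_matrix n U [] x z * word_matrix n U w z y) = (\<Sum>z<n. if x = z then word_matrix n U w z y else 0)"
    by (intro sum.cong) auto
  then show ?case using Nil by simp
next
  case (Cons l v)
  have "word_matrix n U ((l # v) @ w) x y =
      (\<Sum>u<n. \<Sum>z<n. letter_matrix U l x u * (word_matrix n U v u z * word_matrix n U w z y))"
    using Cons.IH by (simp add: sum_distrib_left)
  also have "\<dots> = (\<Sum>z<n. word_matrix n U (l # v) x z * word_matrix n U w z y)"
    by (subst sum.swap) (simp add: sum_distrib_right mult.assoc)
  finally show ?case .
qed

lemma word_matrix_single: "y < n \<Longrightarrow> word_matrix n U [l] x y = letter_matrix U l x y"
proof -
  assume "y < n"
  have "word_matrix n U [l] x y = (\<Sum>z<n. if z = y then letter_matrix U l x z else 0)"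
    unfolding word_matrix.simps by (intro sum.cong) auto
  then show ?thesis using \<open>y < n\<close> by simp
qed

lemma word_matrix_adjoint:
  assumes "x < n" "y < n"
  shows "word_matrix n U (letters (adjoint_word (Word w))) x y = cnj (word_matrix n U w y x)"
  using assms
proof (induction w arbitrary: y)
  case (Cons l w)
  obtain g b where l: "l = (g, b)" by (cases l)
  have "word_matrix n U (letters (adjoint_word (Word (l # w)))) x y =
      (\<Sum>z<n. word_matrix n U (letters (adjoint_word (Word w))) x z * letter_matrix U (g, \<not> b) z y)"
    using Cons.prems by (simp add: adjoint_word_def l word_matrix_append word_matrix_single del: word_matrix.simps letter_matrix.simps)
  also have "\<dots> = (\<Sum>z<n. cnj (letter_matrix U l y z * word_matrix n U w z x))"
    using Cons by (intro sum.cong) (auto simp: l)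
  finally show ?case by simp
qed (auto simp: adjoint_word_def)

lemma poly_matrix_add: "poly_matrix n U (p + q) x y = poly_matrix n U p x y + poly_matrix n U q x y"
  by (simp add: poly_matrix_def linear_extension_add)

lemma poly_matrix_diff: "poly_matrix n U (p - q) x y = poly_matrix n U p x y - poly_matrix n U q x y"
  by (simp add: poly_matrix_def linear_extension_diff)

lemma poly_matrix_sum: "poly_matrix n U (sum f S) x y = (\<Sum>i\<in>S. poly_matrix n U (f i) x y)"
  by (simp add: poly_matrix_def linear_extension_sum)

lemma poly_matrix_mult:
  assumes "x < n"
  shows "poly_matrix n U (p * q) x y = (\<Sum>z<n. poly_matrix n U p x z * poly_matrix n U q z y)"
proof -
  define W where "W w = word_matrix n U (letters w)" for w
  have "poly_matrix n U (p * q) x y = (\<Sum>v\<in>Poly_Mapping.keys p. \<Sum>w\<in>Poly_Mapping.keys q. \<Sum>z<n.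
      (Poly_Mapping.lookup p v * W v x z) * (Poly_Mapping.lookup q w * W w z y))"
    using assms by (simp add: poly_matrix_def linear_extension_mult word_matrix_append sum_distrib_left W_def mult_ac)
  also have "\<dots> = (\<Sum>v\<in>Poly_Mapping.keys p. \<Sum>z<n. \<Sum>w\<in>Poly_Mapping.keys q.
      (Poly_Mapping.lookup p v * W v x z) * (Poly_Mapping.lookup q w * W w z y))"
    by (intro sum.cong refl) (rule sum.swap)
  also have "\<dots> = (\<Sum>z<n. \<Sum>v\<in>Poly_Mapping.keys p. \<Sum>w\<in>Poly_Mapping.keys q.
      (Poly_Mapping.lookup p v * W v x z) * (Poly_Mapping.lookup q w * W w z y))"
    by (rule sum.swap)
  finally show ?thesis
    by (simp add: poly_matrix_def linear_extension_def W_def sum_product)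
qed

lemma poly_matrix_star:
  assumes "x < n" "y < n"
  shows "poly_matrix n U (poly_star p) x y = cnj (poly_matrix n U p y x)"
proof -
  have "word_matrix n U (letters (adjoint_word w)) x y = cnj (word_matrix n U (letters w) y x)" for w
    using word_matrix_adjoint[OF assms, of U "letters w"] by simp
  then show ?thesis
    unfolding poly_matrix_def linear_extension_poly_star by (simp add: linear_extension_def)
qed

lemma poly_matrix_single_0: "poly_matrix n U (Poly_Mapping.single 0 c) x y = (if x = y then c else 0)"
  by (simp add: poly_matrix_def)

lemma poly_matrix_one: "poly_matrix n U 1 x y = (if x = y then 1 else 0)"
  using poly_matrix_single_0[of n U 1 x y] by simp

lemma poly_matrix_gen: "y < n \<Longrightarrow> poly_matrix n U (gen g) x y = U g x y"
  by (simp add: poly_matrix_def gen_def word_matrix_single del: word_matrix.simps)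

definition evaluation :: "nat \<Rightarrow> ('g \<Rightarrow> nat \<Rightarrow> nat \<Rightarrow> complex) \<Rightarrow> 'g star_poly \<Rightarrow> complex mat" where
  "evaluation n U p = mat n n (\<lambda>(x, y). poly_matrix n U p x y)"

text \<open>The free algebra imposes no relations, so every family of matrices \<open>U\<close> is
  admissible.\<close>

lemma evaluation_star_hom: "evaluation n U \<in> star_hom (free_star_algebra X) (matrix_star_algebra n)"
proof -
  have "evaluation n U (p * q) = evaluation n U p * evaluation n U q" for p q
    by (rule eq_matI) (auto simp: evaluation_def poly_matrix_mult scalar_prod_def lessThan_atLeast0 intro!: sum.cong)
  moreover have "evaluation n U (p + q) = evaluation n U p + evaluation n U q" for p q
    by (rule eq_matI) (auto simp: evaluation_def poly_matrix_add)
  moreover have "evaluation n U 1 = 1\<^sub>m n"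
    by (rule eq_matI) (auto simp: evaluation_def poly_matrix_one)
  moreover have "evaluation n U (Poly_Mapping.single 0 c * p) = c \<cdot>\<^sub>m evaluation n U p" for c p
  proof (rule eq_matI)
    fix x y assume "x < dim_row (c \<cdot>\<^sub>m evaluation n U p)" "y < dim_col (c \<cdot>\<^sub>m evaluation n U p)"
    then have xy: "x < n" "y < n" by (simp_all add: evaluation_def)
    have "(\<Sum>z<n. (if x = z then c else 0) * poly_matrix n U p z y) = (\<Sum>z<n. if x = z then c * poly_matrix n U p z y else 0)"
      by (intro sum.cong) auto
    then show "evaluation n U (Poly_Mapping.single 0 c * p) $$ (x, y) = (c \<cdot>\<^sub>m evaluation n U p) $$ (x, y)"
      using xy by (simp add: evaluation_def poly_matrix_mult poly_matrix_single_0)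
  qed (simp_all add: evaluation_def)
  moreover have "evaluation n U (poly_star p) = mat_adjoint (evaluation n U p)" for p
  proof -
    have c: "evaluation n U p \<in> carrier_mat n n" by (simp add: evaluation_def)
    show ?thesis
      by (rule eq_matI; use carrier_mat_adjoint[OF c] in \<open>auto simp: index_mat_adjoint[OF c]\<close>)
        (simp_all add: evaluation_def poly_matrix_star)
  qed
  moreover have "evaluation n U p \<in> carrier_mat n n" for p
    by (simp add: evaluation_def)
  ultimately show ?thesis
    by (auto simp: star_hom_def Ring.ring_hom_def free_star_algebra_def matrix_star_algebra_def)
qed

section \<open>Separating normal words\<close>

lemma words_0: "words N 0 = {[]}"
  by (auto simp: words_def)

lemma words_Suc_image: "words N (Suc m) = (\<lambda>(i, l). i # l) ` ({1..N} \<times> words N m)"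
  by (auto simp: words_def length_Suc_conv image_iff)

lemma finite_words: "finite (words N m)"
  by (induction m) (simp_all add: words_0 words_Suc_image)

section \<open>Multilinear forms on chains of unit vectors\<close>

lemma tensor_eval_sum:
  "tensor_eval N \<xi> as = (\<Sum>l\<in>words N (length as). (\<Prod>k<length as. of_real ((as ! k) (l ! k))) * \<xi> l)"
proof (induction as arbitrary: \<xi>)
  case (Cons a as)
  have "(\<Sum>l\<in>words N (length (a # as)). (\<Prod>k<length (a # as). of_real (((a # as) ! k) (l ! k))) * \<xi> l) =
     (\<Sum>(i, l)\<in>{1..N} \<times> words N (length as). of_real (a i) * ((\<Prod>k<length as. of_real ((as ! k) (l ! k))) * \<xi> (i # l)))"
    unfolding length_Cons words_Suc_image
    by (subst sum.reindex) (auto simp: inj_on_def prod.lessThan_Suc_shift simp del: prod.lessThan_Suc intro!: sum.cong)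
  also have "\<dots> = tensor_eval N \<xi> (a # as)"
    by (simp add: sum.cartesian_product[symmetric] Cons.IH sum_distrib_left)
  finally show ?case by simp
qed (simp add: words_0)

lemma tensor_eval_scale:
  "tensor_eval N \<xi> (map (\<lambda>a k. c a * a k) as) = (\<Prod>a\<leftarrow>as. of_real (c a)) * tensor_eval N \<xi> as"
  by (induction as arbitrary: \<xi>) (simp_all add: sum_distrib_left mult_ac)

lemma dot_scale: "dot N (\<lambda>k. c * a k) (\<lambda>k. d * b k) = c * d * dot N a b"
  by (simp add: dot_def sum_distrib_left mult_ac)

text \<open>Edge labels are unit vectors, whereas \<open>reduced_vanishing\<close> tests arbitrary
  chains. Normalizing preserves orthogonality and multiplies the value by nonzero factors; a chain
  containing a zero vector evaluates to zero anyway.\<close>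

lemma tensor_eval_unit_chains:
  assumes unit: "\<And>as. length as = length cs \<Longrightarrow> chain N F cs as \<Longrightarrow> \<forall>a\<in>set as. dot N a a = 1 \<Longrightarrow> tensor_eval N \<xi> as = 0"
    and as: "length as = length cs" "chain N F cs as"
  shows "tensor_eval N \<xi> as = 0"
proof (cases "\<exists>a\<in>set as. dot N a a = 0")
  case True
  then obtain a where a: "a \<in> set as" "dot N a a = 0" by blast
  have "a i = 0" if "i \<in> {1..N}" for i
    using a(2) that unfolding dot_def by (subst (asm) sum_nonneg_eq_0_iff) auto
  then show ?thesis
    using a(1) by (induction as arbitrary: \<xi>) auto
next
  case False
  define c where "c a = 1 / sqrt (dot N a a)" for a
  define bs where "bs = map (\<lambda>a k. c a * a k) as"
  have pos: "dot N a a > 0" if "a \<in> set as" for a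
    using False that sum_nonneg[of "{1..N}" "\<lambda>i. a i * a i"] by (force simp: dot_def less_le)
  have "chain N F cs bs"
    using as(2) unfolding bs_def
  proof (induction cs arbitrary: as)
    case (Cons c cs)
    show ?case
    proof (cases "\<exists>c' cs' a b as'. cs = c' # cs' \<and> as = a # b # as'")
      case True
      then obtain c' cs' a b as' where eq: "cs = c' # cs'" "as = a # b # as'" by blast
      then show ?thesis using Cons.IH[of "b # as'"] Cons.prems by (simp add: dot_scale)
    next
      case False
      then show ?thesis by (cases cs; cases as; cases "tl as") auto
    qed
  qed simp
  moreover have "\<forall>b\<in>set bs. dot N b b = 1"
  proof
    fix b assume "b \<in> set bs"
    then obtain a where a: "a \<in> set as" "b = (\<lambda>k. c a * a k)" by (auto simp: bs_def)
    have "c a * c a * dot N a a = 1"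
      using pos[OF a(1)] by (simp add: c_def)
    then show "dot N b b = 1"
      unfolding a(2) dot_scale .
  qed
  ultimately have "tensor_eval N \<xi> bs = 0"
    using unit[of bs] as(1) by (simp add: bs_def)
  then have "(\<Prod>a\<leftarrow>as. complex_of_real (c a)) = 0 \<or> tensor_eval N \<xi> as = 0"
    unfolding bs_def tensor_eval_scale by simp
  moreover have "(\<Prod>a\<leftarrow>as. complex_of_real (c a)) \<noteq> 0"
    by (auto simp: prod_list_zero_iff c_def dest!: pos)
  ultimately show ?thesis by blast
qed

text \<open>Row and column indices are reduced separately, both with pivot \<open>1\<close> for the
  first pair, so that vanishing can be proved in one kind of index after the other.\<close>

definition normal_word :: "bool \<Rightarrow> nat \<Rightarrow> ((nat \<times> nat) \<times> bool) list \<Rightarrow> bool" where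
  "normal_word ort N w \<longleftrightarrow> (ort \<longrightarrow> (\<forall>l\<in>set w. \<not> snd l)) \<and>
     reduced N (\<lambda>c c'. ort \<or> c \<noteq> c') True (map snd w) (map (fst \<circ> fst) w) \<and>
     reduced N (\<lambda>c c'. ort \<or> c \<noteq> c') True (map snd w) (map (snd \<circ> fst) w)"

lemma zip_words:
  assumes "w = zip (zip l l') cs" "length l = length cs" "length l' = length cs"
  shows "map snd w = cs" "map (fst \<circ> fst) w = l" "map (snd \<circ> fst) w = l'"
proof -
  show "map snd w = cs" using assms by simp
  have "map (fst \<circ> fst) w = map fst (map fst w)" "map (snd \<circ> fst) w = map snd (map fst w)"
    by simp_all
  then show "map (fst \<circ> fst) w = l" "map (snd \<circ> fst) w = l'"
    using assms by simp_all
qed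

lemma zip_of_word: "zip (zip (map (fst \<circ> fst) w) (map (snd \<circ> fst) w)) (map snd w) = w"
  by (induction w) auto

text \<open>If \<open>q\<close> is nonzero, fix the pattern of stars \<open>cs\<close> of one of its
  longest words. Path representations with this pattern evaluate exactly the coefficients of the
  longest words with pattern \<open>cs\<close> at pairs of chains, and
  \<open>reduced_vanishing\<close> makes these coefficients zero.\<close>

lemma separating_representation:
  fixes q :: "(nat \<times> nat) star_poly"
  assumes N: "N \<ge> 2"
    and keys: "\<And>w. w \<in> Poly_Mapping.keys q \<Longrightarrow> fst ` set (letters w) \<subseteq> {1..N} \<times> {1..N} \<and> normal_word ort N (letters w)"
    and vanish: "\<And>n U. n \<ge> 1 \<Longrightarrow> biunitary {1..N} n U \<Longrightarrow> ort \<longrightarrow> (\<forall>i j x y. U i j x y = U i j y x) \<Longrightarrow>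
      (\<forall>x<n. \<forall>y<n. poly_matrix n (\<lambda>(i, j) x y. of_real (U i j x y)) q x y = 0)"
  shows "q = 0"
proof (rule ccontr)
  assume "q \<noteq> 0"
  then have ne: "Poly_Mapping.keys q \<noteq> {}" by simp
  define m where "m = Max ((length \<circ> letters) ` Poly_Mapping.keys q)"
  have max: "length (letters w) \<le> m" if "w \<in> Poly_Mapping.keys q" for w
    using that by (simp add: m_def)
  have "m \<in> (length \<circ> letters) ` Poly_Mapping.keys q"
    unfolding m_def by (rule Max_in) (use ne in auto)
  then obtain w0 where w0: "w0 \<in> Poly_Mapping.keys q" "length (letters w0) = m"
    by auto
  define cs where "cs = map snd (letters w0)"
  have cs: "length cs = m" by (simp add: cs_def w0)
  define F where "F = (\<lambda>c c' :: bool. ort \<or> c \<noteq> c')"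
  define \<omega> where "\<omega> l l' = Word (zip (zip l l') cs)" for l l' :: "nat list"
  define \<xi> where "\<xi> l l' = Poly_Mapping.lookup q (\<omega> l l')" for l l'
  have \<omega>_simps: "map snd (letters (\<omega> l l')) = cs" "map (fst \<circ> fst) (letters (\<omega> l l')) = l"
    "map (snd \<circ> fst) (letters (\<omega> l l')) = l'" if "l \<in> words N m" "l' \<in> words N m" for l l'
    using zip_words[of "letters (\<omega> l l')" l l' cs] that cs by (simp_all add: \<omega>_def words_def)
  have inj: "inj_on (\<lambda>(l, l'). \<omega> l l') (words N m \<times> words N m)"
  proof (rule inj_onI, clarify)
    fix l l' k k'
    assume "l \<in> words N m" "l' \<in> words N m" "k \<in> words N m" "k' \<in> words N m" "\<omega> l l' = \<omega> k k'"
    then show "l = k \<and> l' = k'"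
      using \<omega>_simps[of l l'] \<omega>_simps[of k k'] by simp
  qed
  have key_word: "\<exists>l\<in>words N m. \<exists>l'\<in>words N m. w = \<omega> l l'"
    if "w \<in> Poly_Mapping.keys q" "map snd (letters w) = cs" for w
  proof -
    have len: "length (letters w) = m" using that(2) cs by (metis length_map)
    have sub: "fst ` set (letters w) \<subseteq> {1..N} \<times> {1..N}" using keys[OF that(1)] by blast
    have "map (fst \<circ> fst) (letters w) \<in> words N m" "map (snd \<circ> fst) (letters w) \<in> words N m"
      using sub len by (fastforce simp: words_def)+
    moreover have "w = \<omega> (map (fst \<circ> fst) (letters w)) (map (snd \<circ> fst) (letters w))"
      unfolding \<omega>_def that(2)[symmetric] zip_of_word by simp
    ultimately show ?thesis by blast
  qed
  have eval0: "tensor_eval N (\<lambda>l. tensor_eval N (\<xi> l) bs) as = 0"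
    if as: "length as = length cs" "chain N F cs as" "\<forall>a\<in>set as. dot N a a = 1"
      and bs: "length bs = length cs" "chain N F cs bs" "\<forall>b\<in>set bs. dot N b b = 1" for as bs
  proof -
    from path_representation[OF as[unfolded F_def] bs[unfolded F_def]] obtain U where
      U: "biunitary {1..N} (2 * Suc m) U" "ort \<longrightarrow> (\<forall>i j x y. U i j x y = U i j y x)"
      and word: "\<forall>w. length w \<le> m \<longrightarrow>
      word_matrix (2 * Suc m) (\<lambda>(i, j) x y. of_real (U i j x y)) w 0 (2 * m) =
        (if length w = m then \<Prod>k<m. if ort \<or> snd (w ! k) = cs ! k
           then of_real ((as ! k) (fst (fst (w ! k))) * (bs ! k) (snd (fst (w ! k)))) else 0 else 0)"
      unfolding cs by (elim exE conjE) (rule that)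
    define V where "V = (\<lambda>(i, j) x y. complex_of_real (U i j x y))"
    define f where "f w = Poly_Mapping.lookup q w * word_matrix (2 * Suc m) V (letters w) 0 (2 * m)" for w
    have "sum f (Poly_Mapping.keys q) = poly_matrix (2 * Suc m) V q 0 (2 * m)"
      by (simp add: poly_matrix_def linear_extension_def f_def)
    also have "\<dots> = 0"
      using vanish[OF _ U] by (simp add: V_def)
    finally have f0: "sum f (Poly_Mapping.keys q) = 0" .
    \<comment> \<open>Words that are shorter or have other stars have a zero matrix entry, and the
      words \<open>\<omega> l l'\<close> not occurring in \<open>q\<close> have a zero
      coefficient.\<close>
    have "sum f (Poly_Mapping.keys q) = sum f ((\<lambda>(l, l'). \<omega> l l') ` (words N m \<times> words N m))"
    proof (rule sum.mono_neutral_cong)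
      fix w assume w: "w \<in> Poly_Mapping.keys q - (\<lambda>(l, l'). \<omega> l l') ` (words N m \<times> words N m)"
      then have ncs: "map snd (letters w) \<noteq> cs" using key_word[of w] by auto
      show "f w = 0"
      proof (cases "length (letters w) = m")
        case True
        have "map snd (letters w) = cs" if "\<forall>k<m. snd (letters w ! k) = cs ! k"
          using that True cs by (intro nth_equalityI) auto
        then obtain k where k: "k < m" "snd (letters w ! k) \<noteq> cs ! k"
          using ncs by blast
        \<comment> \<open>With \<open>ort\<close>, normal words carry no stars, so all words of
          length \<open>m\<close> in \<open>q\<close> have the pattern \<open>cs\<close> and no
          mismatch can occur.\<close>
        have "\<not> ort"
        proof
          assume ort
          then have "\<not> snd (letters w ! k)" "\<not> cs ! k"
            using keys[of w] keys[OF w0(1)] w k(1) True w0(2) by (auto simp: normal_word_def cs_def)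
          then show False using k(2) by simp
        qed
        then have "(\<Prod>k<m. if ort \<or> snd (letters w ! k) = cs ! k
           then complex_of_real ((as ! k) (fst (fst (letters w ! k))) * (bs ! k) (snd (fst (letters w ! k)))) else 0) = 0"
          using k by (intro prod_zero) auto
        then show ?thesis
          using word True by (simp add: f_def V_def)
      next
        case False
        then show ?thesis using word max[of w] w by (simp add: f_def V_def)
      qed
    qed (auto simp: f_def in_keys_iff finite_words)
    also have "\<dots> = (\<Sum>(l, l')\<in>words N m \<times> words N m. f (\<omega> l l'))"
      using sum.reindex[OF inj, of f] by (simp add: case_prod_beta o_def)
    also have "\<dots> = (\<Sum>(l, l')\<in>words N m \<times> words N m.
        (\<Prod>k<m. of_real ((as ! k) (l ! k))) * ((\<Prod>k<m. of_real ((bs ! k) (l' ! k))) * \<xi> l l'))"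
    proof (rule sum.cong[OF refl], clarify)
      fix l l' assume ll: "l \<in> words N m" "l' \<in> words N m"
      then have len: "length l = m" "length l' = m" by (simp_all add: words_def)
      have "(\<Prod>k<m. if ort \<or> snd (letters (\<omega> l l') ! k) = cs ! k
           then complex_of_real ((as ! k) (fst (fst (letters (\<omega> l l') ! k))) * (bs ! k) (snd (fst (letters (\<omega> l l') ! k)))) else 0)
        = (\<Prod>k<m. of_real ((as ! k) (l ! k)) * of_real ((bs ! k) (l' ! k)))"
        using len cs by (intro prod.cong) (auto simp: \<omega>_def)
      moreover have "length (letters (\<omega> l l')) = m"
        using len cs by (simp add: \<omega>_def)
      then have "f (\<omega> l l') = \<xi> l l' * (\<Prod>k<m. if ort \<or> snd (letters (\<omega> l l') ! k) = cs ! k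
           then complex_of_real ((as ! k) (fst (fst (letters (\<omega> l l') ! k))) * (bs ! k) (snd (fst (letters (\<omega> l l') ! k)))) else 0)"
        using word[rule_format, of "letters (\<omega> l l')"] by (simp only: f_def V_def \<xi>_def order_refl if_True simp_thms)
      ultimately show "f (\<omega> l l') = (\<Prod>k<m. of_real ((as ! k) (l ! k))) * ((\<Prod>k<m. of_real ((bs ! k) (l' ! k))) * \<xi> l l')"
        by (simp only: prod.distrib mult_ac)
    qed
    also have "\<dots> = tensor_eval N (\<lambda>l. tensor_eval N (\<xi> l) bs) as"
      using as(1) bs(1) cs by (simp add: tensor_eval_sum sum.cartesian_product[symmetric] sum_distrib_left)
    finally show ?thesis using f0 by simp
  qed
  have notnormal: "\<xi> l l' = 0"
    if "l \<in> words N m" "l' \<in> words N m" "\<not> reduced N F True cs l \<or> \<not> reduced N F True cs l'" for l l'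
  proof (rule ccontr)
    assume "\<xi> l l' \<noteq> 0"
    then have "normal_word ort N (letters (\<omega> l l'))"
      using keys[of "\<omega> l l'"] by (simp add: \<xi>_def in_keys_iff)
    then show False
      using that \<omega>_simps[OF that(1,2)] unfolding normal_word_def F_def by simp
  qed
  \<comment> \<open>The row indices come first: for fixed \<open>bs\<close> the value in the column
    indices depends on the row word alone and inherits the support condition of
    \<open>\<xi>\<close>.\<close>
  have inner: "tensor_eval N (\<xi> l) bs = 0"
    if l: "l \<in> words N m" and bs: "length bs = length cs" "chain N F cs bs" "\<forall>b\<in>set bs. dot N b b = 1" for l bs
  proof (rule reduced_vanishing[OF N, of cs F True _ False])
    fix l assume "l \<in> words N (length cs)" "\<not> reduced N F True cs l"
    then show "tensor_eval N (\<xi> l) bs = 0"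
      using notnormal bs(1) cs by (intro tensor_eval_eq_0) auto
  next
    fix as :: "(nat \<Rightarrow> real) list"
    assume as: "length as = length cs" "chain N F cs as"
    show "tensor_eval N (\<lambda>l. tensor_eval N (\<xi> l) bs) as = 0"
    proof (rule tensor_eval_unit_chains[OF _ as])
      fix xs :: "(nat \<Rightarrow> real) list"
      assume "length xs = length cs" "chain N F cs xs" "\<forall>a\<in>set xs. dot N a a = 1"
      then show "tensor_eval N (\<lambda>l. tensor_eval N (\<xi> l) bs) xs = 0"
        using bs by (rule eval0)
    qed
  qed (use l cs in auto)
  \<comment> \<open>Now the column indices: for a fixed row word, \<open>inner\<close> is the
    vanishing on unit chains.\<close>
  have "\<xi> l l' = 0" if l: "l \<in> words N m" "l' \<in> words N m" for l l'
  proof (rule reduced_vanishing[OF N, of cs F True _ False])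
    fix as :: "(nat \<Rightarrow> real) list"
    assume as: "length as = length cs" "chain N F cs as"
    show "tensor_eval N (\<xi> l) as = 0"
      by (rule tensor_eval_unit_chains[OF inner[OF l(1)] as])
  qed (use l cs notnormal in auto)
  moreover obtain l l' where "l \<in> words N m" "l' \<in> words N m" "w0 = \<omega> l l'"
    using key_word[OF w0(1)] cs_def by blast
  ultimately show False
    using w0(1) by (simp add: \<xi>_def in_keys_iff)
qed

section \<open>Reduction to normal words\<close>

text \<open>Read as a binary number with the last letter as its leading digit, the positions holding a pivot
  decrease when two adjacent pivots are replaced, although the left one may become a pivot again.\<close>

fun pivot_value :: "nat \<Rightarrow> bool \<Rightarrow> nat list \<Rightarrow> nat" where
  "pivot_value N d [] = 0"
| "pivot_value N d (i # l) = (if i = pivot N (\<not> d) then 1 else 0) + 2 * pivot_value N (\<not> d) l"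

text \<open>The pair found is the last forbidden one. At its right position the digit
  \<open>1\<close> turns into \<open>0\<close>, while only the left position, of half the weight,
  can gain a digit; the digits elsewhere stay the same.\<close>

lemma not_reduced_split:
  assumes "N \<ge> 2" "\<not> reduced N F d (map snd w) (map \<pi> w)"
  shows "\<exists>x l l' y s. w = x @ l # l' # y \<and> F (snd l) (snd l') \<and> \<pi> l = s \<and> \<pi> l' = s \<and> s \<in> {1..N} \<and>
    (\<forall>i. i \<noteq> s \<longrightarrow> pivot_value N d (map \<pi> x @ i # i # map \<pi> y) < pivot_value N d (map \<pi> w))"
  using assms(2)
proof (induction w arbitrary: d)
  case (Cons l w)
  then obtain l' y where w: "w = l' # y"
    by (cases w) auto
  show ?case
  proof (cases "reduced N F (\<not> d) (map snd w) (map \<pi> w)")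
    case True
    then have *: "F (snd l) (snd l')" "\<pi> l = pivot N d" "\<pi> l' = pivot N d"
      using Cons.prems w by auto
    have "pivot N d \<noteq> pivot N (\<not> d)" "pivot N d \<in> {1..N}"
      using assms(1) by (auto simp: pivot_def)
    then show ?thesis
      using w * by (intro exI[of _ "[]"] exI[of _ l] exI[of _ l'] exI[of _ y] exI[of _ "pivot N d"]) auto
  next
    case False
    from Cons.IH[OF False] obtain x m m' y s where
      *: "w = x @ m # m' # y" "F (snd m) (snd m')" "\<pi> m = s" "\<pi> m' = s" "s \<in> {1..N}"
      "\<forall>i. i \<noteq> s \<longrightarrow> pivot_value N (\<not> d) (map \<pi> x @ i # i # map \<pi> y) < pivot_value N (\<not> d) (map \<pi> w)"
      by (elim exE conjE) (rule that)
    then show ?thesis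
      by (intro exI[of _ "l # x"] exI[of _ m] exI[of _ m'] exI[of _ y] exI[of _ s]) auto
  qed
qed simp

section \<open>Monomials and ideals of the free star-algebra\<close>

definition monomial :: "('g \<times> bool) list \<Rightarrow> 'g star_poly" where
  "monomial w = Poly_Mapping.single (Word w) 1"

lemma monomial_append: "monomial (v @ w) = monomial v * monomial w"
  by (simp add: monomial_def mult_single plus_star_word_def)

lemma monomial_Cons: "monomial (l # w) = monomial [l] * monomial w"
  using monomial_append[of "[l]" w] by simp

lemma monomial_Nil: "monomial [] = 1"
  by (simp add: monomial_def zero_star_word_def[symmetric])

lemma monomial_carrier: "fst ` set w \<subseteq> X \<Longrightarrow> monomial w \<in> carrier (free_star_algebra X)"
  by (simp add: monomial_def free_star_algebra_def)

lemma free_carrier_iff: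
  "p \<in> carrier (free_star_algebra X) \<longleftrightarrow> (\<forall>w\<in>Poly_Mapping.keys p. fst ` set (letters w) \<subseteq> X)"
  by (simp add: free_star_algebra_def)

lemma single_carrier: "fst ` set (letters w) \<subseteq> X \<Longrightarrow> Poly_Mapping.single w c \<in> carrier (free_star_algebra X)"
  by (simp add: free_carrier_iff)

lemma free_ideal_facts:
  assumes "ideal J (free_star_algebra X)"
  shows "0 \<in> J" "p \<in> J \<Longrightarrow> q \<in> J \<Longrightarrow> p + q \<in> J" "p \<in> J \<Longrightarrow> q \<in> J \<Longrightarrow> p - q \<in> J"
    "p \<in> J \<Longrightarrow> q \<in> carrier (free_star_algebra X) \<Longrightarrow> q * p \<in> J"
    "p \<in> J \<Longrightarrow> q \<in> carrier (free_star_algebra X) \<Longrightarrow> p * q \<in> J"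
    "(\<And>i. i \<in> S \<Longrightarrow> f i \<in> J) \<Longrightarrow> sum f S \<in> J"
    "p \<in> J \<Longrightarrow> p \<in> carrier (free_star_algebra X)"
proof -
  interpret ideal J "free_star_algebra X" by fact
  have ops: "mult (free_star_algebra X) = (*)" "add (free_star_algebra X) = (+)" "zero (free_star_algebra X) = 0"
    by (simp_all add: free_star_algebra_def)
  show z: "0 \<in> J" using additive_subgroup.zero_closed[OF is_additive_subgroup] by (simp add: ops)
  show add: "p \<in> J \<Longrightarrow> q \<in> J \<Longrightarrow> p + q \<in> J" for p q
    using additive_subgroup.a_closed[OF is_additive_subgroup, of p q] by (simp add: ops)
  show l: "p \<in> J \<Longrightarrow> q \<in> carrier (free_star_algebra X) \<Longrightarrow> q * p \<in> J" for p q
    using I_l_closed[of p q] by (simp add: ops)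
  show "p \<in> J \<Longrightarrow> q \<in> carrier (free_star_algebra X) \<Longrightarrow> p * q \<in> J"
    using I_r_closed[of p q] by (simp add: ops)
  show "p \<in> J \<Longrightarrow> q \<in> J \<Longrightarrow> p - q \<in> J"
  proof -
    assume "p \<in> J" "q \<in> J"
    moreover have "Poly_Mapping.single 0 (- 1) * q = - q"
      by (simp add: single_uminus)
    ultimately show "p - q \<in> J"
      using add[of p "- q"] l[of q "Poly_Mapping.single 0 (- 1)"] by (simp add: single_carrier)
  qed
  show "(\<And>i. i \<in> S \<Longrightarrow> f i \<in> J) \<Longrightarrow> sum f S \<in> J"
    by (induction S rule: infinite_finite_induct) (auto intro: z add)
  show "p \<in> J \<Longrightarrow> p \<in> carrier (free_star_algebra X)"
    using a_Hcarr by blast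
qed

lemma keys_single_mult:
  "Poly_Mapping.keys (Poly_Mapping.single 0 c * p) \<subseteq> Poly_Mapping.keys p"
  using keys_mult[of "Poly_Mapping.single 0 c" p] by (auto split: if_splits)

text \<open>A forbidden pair with row index \<open>s\<close> is the summand \<open>k = s\<close> of
  a column relation. Modulo \<open>J\<close> the word thus equals a word two letters shorter, or
  zero, minus the words with \<open>k \<noteq> s\<close>, which keep their column indices and stars
  and have a smaller pivot value in the rows. Column indices are treated alike by row relations. The
  number of stars enters the measure because with \<open>ort\<close> starred letters are first
  replaced by unstarred ones.\<close>

lemma monomial_reduction:
  fixes N :: nat and J :: "(nat \<times> nat) star_poly set"
  defines "A \<equiv> free_star_algebra ({1..N} \<times> {1..N})"
  assumes N: "N \<ge> 2" and J: "ideal J A"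
    and selfadjoint: "\<And>g. ort \<Longrightarrow> g \<in> {1..N} \<times> {1..N} \<Longrightarrow> monomial [(g, True)] - monomial [(g, False)] \<in> J"
    and row: "\<And>i j c c'. i \<in> {1..N} \<Longrightarrow> j \<in> {1..N} \<Longrightarrow> (if ort then \<not> c \<and> \<not> c' else c \<noteq> c') \<Longrightarrow>
      (\<Sum>k=1..N. monomial [((i, k), c), ((j, k), c')]) - (if i = j then 1 else 0) \<in> J"
    and column: "\<And>i j c c'. i \<in> {1..N} \<Longrightarrow> j \<in> {1..N} \<Longrightarrow> (if ort then \<not> c \<and> \<not> c' else c \<noteq> c') \<Longrightarrow>
      (\<Sum>k=1..N. monomial [((k, i), c), ((k, j), c')]) - (if i = j then 1 else 0) \<in> J"
    and w: "fst ` set w \<subseteq> {1..N} \<times> {1..N}"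
  shows "\<exists>q\<in>carrier A. (\<forall>v\<in>Poly_Mapping.keys q. normal_word ort N (letters v)) \<and> monomial w - q \<in> J"
  using w
proof (induction "(length w,
      pivot_value N True (map (fst \<circ> fst) w) + pivot_value N True (map (snd \<circ> fst) w) + length (filter snd w))"
    arbitrary: w rule: wf_induct_rule[OF wf_lex_prod[OF wf_less_than wf_less_than]])
  case (1 w)
  note Jf = free_ideal_facts[OF J[unfolded A_def], folded A_def]
  define val where "val w =
      pivot_value N True (map (fst \<circ> fst) w) + pivot_value N True (map (snd \<circ> fst) w) + length (filter snd w)"
    for w :: "((nat \<times> nat) \<times> bool) list"
  define nf where "nf p q \<longleftrightarrow> q \<in> carrier A \<and> (\<forall>v\<in>Poly_Mapping.keys q. normal_word ort N (letters v)) \<and> p - q \<in> J" for p q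
  have IH: "\<exists>q. nf (monomial v) q"
    if "length v < length w \<or> length v = length w \<and> val v < val w" "fst ` set v \<subseteq> {1..N} \<times> {1..N}" for v
    using 1(1)[OF _ that(2)] that(1) unfolding val_def nf_def by auto
  have nf_0: "nf 0 0"
    using Jf(1) by (simp add: nf_def A_def free_carrier_iff)
  have nf_diff: "nf (p - p') (q - q')" if "nf p q" "nf p' q'" for p p' q q'
  proof -
    have "Poly_Mapping.keys (q - q') \<subseteq> Poly_Mapping.keys q \<union> Poly_Mapping.keys q'"
      by (auto simp: in_keys_iff lookup_minus)
    moreover have "(p - p') - (q - q') \<in> J"
    proof -
      have eq: "(p - p') - (q - q') = (p - q) - (p' - q')" by simp
      show ?thesis unfolding eq by (rule Jf(3)) (use that in \<open>simp_all add: nf_def\<close>)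
    qed
    moreover have "q - q' \<in> carrier A"
      using that free_carrier_simps(4)[of q _ q'] by (simp add: nf_def A_def)
    ultimately show ?thesis
      using that unfolding nf_def by auto
  qed
  have nf_sum: "\<exists>q. nf (\<Sum>k\<in>K. p k) q" if "\<And>k. k \<in> K \<Longrightarrow> \<exists>q. nf (p k) q" for K :: "nat set" and p
    using that
  proof (induction K rule: infinite_finite_induct)
    case (insert k K)
    then obtain q q' where q: "nf (p k) q" "nf (\<Sum>k\<in>K. p k) q'" by blast
    \<comment> \<open>The sum is written as a double difference, to which \<open>nf_diff\<close>
      applies.\<close>
    have "nf (p k - (0 - (\<Sum>k\<in>K. p k))) (q - (0 - q'))"
      by (intro nf_diff q nf_0)
    then show ?case using insert.hyps by auto
  qed (use nf_0 in auto)
  have nf_cong: "\<exists>q. nf p q" if ex: "\<exists>q. nf p' q" and d: "p - p' \<in> J" for p p'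
  proof -
    obtain q where q: "nf p' q" using ex by blast
    have "p - q = (p - p') + (p' - q)" by simp
    then have "nf p q" using q d Jf(2)[of "p - p'" "p' - q"] by (simp add: nf_def)
    then show ?thesis by blast
  qed
  have W: "fst ` set w \<subseteq> {1..N} \<times> {1..N}" by (rule 1(2))
  have carr: "monomial u \<in> carrier A" if "fst ` set u \<subseteq> {1..N} \<times> {1..N}" for u
    unfolding A_def using that by (rule monomial_carrier)
  \<comment> \<open>This is the common form of both rewriting rules: \<open>f k\<close> is the
    \<open>k\<close>-th summand of the relation and \<open>f s\<close> the forbidden pair.\<close>
  have rewrite: "\<exists>q. nf (monomial w) q"
    if w: "w = x @ f s @ y" and s: "s \<in> {1..N}" and rel: "(\<Sum>k=1..N. monomial (f k)) - (if i = j then 1 else 0) \<in> J"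
      and len: "\<And>k. length (f k) = 2" and f: "\<And>k. k \<in> {1..N} \<Longrightarrow> fst ` set (f k) \<subseteq> {1..N} \<times> {1..N}"
      and val: "\<And>k. k \<noteq> s \<Longrightarrow> val (x @ f k @ y) < val w" for x f s y and i j :: nat
  proof -
    have xy: "fst ` set x \<subseteq> {1..N} \<times> {1..N}" "fst ` set y \<subseteq> {1..N} \<times> {1..N}"
      using W w by (simp_all add: image_Un)
    have short: "\<exists>q. nf (monomial (x @ y)) q"
      by (rule IH) (use w len[of s] xy in auto)
    have other: "\<exists>q. nf (monomial (x @ f k @ y)) q" if k: "k \<in> {1..N} - {s}" for k
    proof (rule IH)
      have "length (x @ f k @ y) = length w" by (simp add: w len)
      moreover have "val (x @ f k @ y) < val w" by (rule val) (use k in simp)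
      ultimately show "length (x @ f k @ y) < length w \<or> length (x @ f k @ y) = length w \<and> val (x @ f k @ y) < val w"
        by simp
      show "fst ` set (x @ f k @ y) \<subseteq> {1..N} \<times> {1..N}"
        using xy f[of k] k by (simp add: image_Un)
    qed
    have delta: "\<exists>q. nf (if i = j then monomial (x @ y) else 0) q"
      using short nf_0 by (cases "i = j") auto
    have rest: "\<exists>q. nf (\<Sum>k\<in>{1..N} - {s}. monomial (x @ f k @ y)) q"
      by (rule nf_sum, rule other)
    obtain q1 q2 where q: "nf (if i = j then monomial (x @ y) else 0) q1"
      "nf (\<Sum>k\<in>{1..N} - {s}. monomial (x @ f k @ y)) q2"
      using delta rest by blast
    show ?thesis
    proof (rule nf_cong)
      show "\<exists>q. nf ((if i = j then monomial (x @ y) else 0) - (\<Sum>k\<in>{1..N} - {s}. monomial (x @ f k @ y))) q"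
        using nf_diff[OF q] by blast
      have "monomial x * ((\<Sum>k=1..N. monomial (f k)) - (if i = j then 1 else 0)) * monomial y \<in> J"
        by (intro Jf carr xy rel)
      also have "monomial x * ((\<Sum>k=1..N. monomial (f k)) - (if i = j then 1 else 0)) * monomial y =
        (\<Sum>k=1..N. monomial (x @ f k @ y)) - (if i = j then monomial (x @ y) else 0)"
        by (simp add: algebra_simps sum_distrib_left sum_distrib_right monomial_append)
      also have "(\<Sum>k=1..N. monomial (x @ f k @ y)) = monomial w + (\<Sum>k\<in>{1..N} - {s}. monomial (x @ f k @ y))"
        using s w by (subst sum.remove[of _ s]) auto
      finally show "monomial w - ((if i = j then monomial (x @ y) else 0) - (\<Sum>k\<in>{1..N} - {s}. monomial (x @ f k @ y))) \<in> J"
        by (simp add: algebra_simps)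
    qed
  qed
  have "\<exists>q. nf (monomial w) q"
  proof (cases "normal_word ort N w")
    case True
    then have "nf (monomial w) (monomial w)"
      using Jf(1) carr[of w] 1(2) by (simp add: nf_def monomial_def)
    then show ?thesis by blast
  next
    case False
    then consider l where "ort" "l \<in> set w" "snd l"
      | "ort \<longrightarrow> (\<forall>l\<in>set w. \<not> snd l)" "\<not> reduced N (\<lambda>c c'. ort \<or> c \<noteq> c') True (map snd w) (map (fst \<circ> fst) w)"
      | "ort \<longrightarrow> (\<forall>l\<in>set w. \<not> snd l)" "\<not> reduced N (\<lambda>c c'. ort \<or> c \<noteq> c') True (map snd w) (map (snd \<circ> fst) w)"
      unfolding normal_word_def by blast
    then show ?thesis
    proof cases
      case (1 l)
      then obtain g x y where w: "w = x @ (g, True) # y"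
        by (metis (full_types) split_list surjective_pairing)
      have xy: "fst ` set x \<subseteq> {1..N} \<times> {1..N}" "fst ` set y \<subseteq> {1..N} \<times> {1..N}" "g \<in> {1..N} \<times> {1..N}"
        using W w by (simp_all add: image_Un)
      show ?thesis
      proof (rule nf_cong)
        show "\<exists>q. nf (monomial (x @ (g, False) # y)) q"
          by (rule IH) (use w xy in \<open>auto simp: val_def\<close>)
        have "monomial x * (monomial [(g, True)] - monomial [(g, False)]) * monomial y \<in> J"
          by (intro Jf carr xy selfadjoint 1)
        then show "monomial w - monomial (x @ (g, False) # y) \<in> J"
          by (simp add: w monomial_append monomial_Cons[of _ y] algebra_simps)
      qed
    next
      case 2
      from not_reduced_split[OF N 2(2)] obtain x l l' y s where
        *: "w = x @ l # l' # y" "ort \<or> snd l \<noteq> snd l'" "(fst \<circ> fst) l = s" "(fst \<circ> fst) l' = s" "s \<in> {1..N}"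
        "\<forall>i. i \<noteq> s \<longrightarrow> pivot_value N True (map (fst \<circ> fst) x @ i # i # map (fst \<circ> fst) y) < pivot_value N True (map (fst \<circ> fst) w)"
        by (elim exE conjE) (rule that)
      define j j' c c' where "j = snd (fst l)" "j' = snd (fst l')" "c = snd l" "c' = snd l'"
      have l: "l = ((s, j), c)" "l' = ((s, j'), c')"
        using *(3,4) by (simp_all add: j_j'_c_c'_def prod_eq_iff)
      have jj: "j \<in> {1..N}" "j' \<in> {1..N}"
        using W *(1) l by (simp_all add: image_Un)
      \<comment> \<open>A forbidden pair is one to which a relation applies: either its stars
        differ, or \<open>ort\<close> holds and the word has no stars left.\<close>
      have cc: "if ort then \<not> c \<and> \<not> c' else c \<noteq> c'"
        using 2(1) *(1,2) l by auto
      show ?thesis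
        by (rule rewrite[where f = "\<lambda>k. [((k, j), c), ((k, j'), c')]" and x = x and y = y and s = s, OF _ *(5) column[OF jj cc]])
          (use * l jj in \<open>auto simp: val_def\<close>)
    next
      case 3
      from not_reduced_split[OF N 3(2)] obtain x l l' y s where
        *: "w = x @ l # l' # y" "ort \<or> snd l \<noteq> snd l'" "(snd \<circ> fst) l = s" "(snd \<circ> fst) l' = s" "s \<in> {1..N}"
        "\<forall>i. i \<noteq> s \<longrightarrow> pivot_value N True (map (snd \<circ> fst) x @ i # i # map (snd \<circ> fst) y) < pivot_value N True (map (snd \<circ> fst) w)"
        by (elim exE conjE) (rule that)
      define j j' c c' where "j = fst (fst l)" "j' = fst (fst l')" "c = snd l" "c' = snd l'"
      have l: "l = ((j, s), c)" "l' = ((j', s), c')"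
        using *(3,4) by (simp_all add: j_j'_c_c'_def prod_eq_iff)
      have jj: "j \<in> {1..N}" "j' \<in> {1..N}"
        using W *(1) l by (simp_all add: image_Un)
      have cc: "if ort then \<not> c \<and> \<not> c' else c \<noteq> c'"
        using 3(1) *(1,2) l by auto
      show ?thesis
        by (rule rewrite[where f = "\<lambda>k. [((j, k), c), ((j', k), c')]" and x = x and y = y and s = s, OF _ *(5) row[OF jj cc]])
          (use * l jj in \<open>auto simp: val_def\<close>)
    qed
  qed
  then show ?case by (auto simp: nf_def)
qed

section \<open>Residual finiteness of presented algebras\<close>

lemma free_star_algebra_ops:
  "mult (free_star_algebra X) = (*)" "add (free_star_algebra X) = (+)"
  "zero (free_star_algebra X) = 0" "one (free_star_algebra X) = 1"
  "smult (free_star_algebra X) = (\<lambda>c p. Poly_Mapping.single 0 c * p)" "star (free_star_algebra X) = poly_star"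
  by (simp_all add: free_star_algebra_def)

lemma free_coset_iff:
  assumes "ideal J (free_star_algebra X)"
  shows "p \<in> J +>\<^bsub>free_star_algebra X\<^esub> a \<longleftrightarrow> p - a \<in> J"
proof
  assume "p \<in> J +>\<^bsub>free_star_algebra X\<^esub> a"
  then obtain j where "j \<in> J" "p = j + a"
    by (auto simp: a_r_coset_def r_coset_def free_star_algebra_def)
  then show "p - a \<in> J" by simp
next
  assume "p - a \<in> J"
  moreover have "p = (p - a) + a" by simp
  ultimately show "p \<in> J +>\<^bsub>free_star_algebra X\<^esub> a"
    by (force simp: a_r_coset_def r_coset_def free_star_algebra_def)
qed

lemma free_coset_eq_iff:
  assumes J: "ideal J (free_star_algebra X)"
  shows "J +>\<^bsub>free_star_algebra X\<^esub> a = J +>\<^bsub>free_star_algebra X\<^esub> b \<longleftrightarrow> a - b \<in> J"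
proof
  assume "J +>\<^bsub>free_star_algebra X\<^esub> a = J +>\<^bsub>free_star_algebra X\<^esub> b"
  then have "a \<in> J +>\<^bsub>free_star_algebra X\<^esub> b"
    using free_coset_iff[OF J, of a a] free_ideal_facts(1)[OF J] by simp
  then show "a - b \<in> J" by (simp add: free_coset_iff[OF J])
next
  assume ab: "a - b \<in> J"
  have "p - a \<in> J \<longleftrightarrow> p - b \<in> J" for p
    using free_ideal_facts(2)[OF J ab, of "p - a"] free_ideal_facts(3)[OF J _ ab, of "p - b"] by auto
  then show "J +>\<^bsub>free_star_algebra X\<^esub> a = J +>\<^bsub>free_star_algebra X\<^esub> b"
    by (intro Set.set_eqI) (simp add: free_coset_iff[OF J])
qed

lemma quotient_carrier:
  "Y \<in> carrier (quotient_star_algebra A J) \<longleftrightarrow> (\<exists>a\<in>carrier A. Y = J +>\<^bsub>A\<^esub> a)"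
  by (simp add: quotient_star_algebra_def A_RCOSETS_def' RCOSETS_def a_r_coset_def r_coset_def)

lemma quotient_free_ops:
  fixes X :: "'g set"
  defines "A \<equiv> free_star_algebra X"
  assumes J: "ideal J A" and a: "a \<in> carrier A"
  shows "b \<in> carrier A \<Longrightarrow> (J +>\<^bsub>A\<^esub> a) \<otimes>\<^bsub>quotient_star_algebra A J\<^esub> (J +>\<^bsub>A\<^esub> b) = J +>\<^bsub>A\<^esub> (a * b)"
    and "b \<in> carrier A \<Longrightarrow> (J +>\<^bsub>A\<^esub> a) \<oplus>\<^bsub>quotient_star_algebra A J\<^esub> (J +>\<^bsub>A\<^esub> b) = J +>\<^bsub>A\<^esub> (a + b)"
    and "\<one>\<^bsub>quotient_star_algebra A J\<^esub> = J +>\<^bsub>A\<^esub> 1"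
    and "\<zero>\<^bsub>quotient_star_algebra A J\<^esub> = J +>\<^bsub>A\<^esub> 0"
    and "c \<odot>\<^bsub>quotient_star_algebra A J\<^esub> (J +>\<^bsub>A\<^esub> a) = J +>\<^bsub>A\<^esub> (Poly_Mapping.single 0 c * a)"
    and "star A ` J \<subseteq> J \<Longrightarrow> star (quotient_star_algebra A J) (J +>\<^bsub>A\<^esub> a) = J +>\<^bsub>A\<^esub> poly_star a"
proof -
  interpret ideal J A by fact
  have ops: "mult A = (*)" "add A = (+)" "zero A = 0" "one A = 1"
    "smult A = (\<lambda>c p. Poly_Mapping.single 0 c * p)" "star A = poly_star"
    by (simp_all add: A_def free_star_algebra_def)
  note eq = free_coset_eq_iff[OF J[unfolded A_def], folded A_def]
  note mem = free_coset_iff[OF J[unfolded A_def], folded A_def]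
  show "b \<in> carrier A \<Longrightarrow> (J +>\<^bsub>A\<^esub> a) \<otimes>\<^bsub>quotient_star_algebra A J\<^esub> (J +>\<^bsub>A\<^esub> b) = J +>\<^bsub>A\<^esub> (a * b)"
    using rcoset_mult_add[OF a] by (simp add: quotient_star_algebra_def ops)
  show "b \<in> carrier A \<Longrightarrow> (J +>\<^bsub>A\<^esub> a) \<oplus>\<^bsub>quotient_star_algebra A J\<^esub> (J +>\<^bsub>A\<^esub> b) = J +>\<^bsub>A\<^esub> (a + b)"
    using a_rcos_sum[OF a] by (simp add: quotient_star_algebra_def ops)
  show "\<one>\<^bsub>quotient_star_algebra A J\<^esub> = J +>\<^bsub>A\<^esub> 1"
    by (simp add: quotient_star_algebra_def ops)
  show "\<zero>\<^bsub>quotient_star_algebra A J\<^esub> = J +>\<^bsub>A\<^esub> 0"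
    using mem[of _ 0] by (auto simp: quotient_star_algebra_def)
  \<comment> \<open>Scalar multiplication and star of the quotient are unions over all
    representatives; they collapse to one coset when \<open>f\<close> respects congruence modulo
    \<open>J\<close>.\<close>
  have union: "(\<Union>x\<in>J +>\<^bsub>A\<^esub> a. J +>\<^bsub>A\<^esub> f x) = J +>\<^bsub>A\<^esub> f a"
    if "\<And>x. x - a \<in> J \<Longrightarrow> f x - f a \<in> J" for f :: "'g star_poly \<Rightarrow> 'g star_poly"
  proof -
    have "J +>\<^bsub>A\<^esub> f x = J +>\<^bsub>A\<^esub> f a" if "x \<in> J +>\<^bsub>A\<^esub> a" for x
      using that \<open>\<And>x. x - a \<in> J \<Longrightarrow> f x - f a \<in> J\<close>[of x] by (simp add: eq mem)
    moreover have "a \<in> J +>\<^bsub>A\<^esub> a"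
      using free_ideal_facts(1)[OF J[unfolded A_def]] by (simp add: mem)
    ultimately show ?thesis by blast
  qed
  show "c \<odot>\<^bsub>quotient_star_algebra A J\<^esub> (J +>\<^bsub>A\<^esub> a) = J +>\<^bsub>A\<^esub> (Poly_Mapping.single 0 c * a)"
  proof -
    have "Poly_Mapping.single 0 c * x - Poly_Mapping.single 0 c * a \<in> J" if "x - a \<in> J" for x
      using free_ideal_facts(4)[OF J[unfolded A_def] that, of "Poly_Mapping.single 0 c"]
      by (simp add: single_carrier right_diff_distrib)
    then show ?thesis
      using union[of "\<lambda>x. Poly_Mapping.single 0 c * x"] by (simp add: quotient_star_algebra_def ops)
  qed
  show "star (quotient_star_algebra A J) (J +>\<^bsub>A\<^esub> a) = J +>\<^bsub>A\<^esub> poly_star a" if star: "star A ` J \<subseteq> J"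
  proof -
    have "poly_star x - poly_star a \<in> J" if "x - a \<in> J" for x
    proof -
      have "poly_star (x - a) = poly_star x - poly_star a"
        by (rule poly_mapping_eqI) (simp add: lookup_poly_star lookup_minus)
      then show ?thesis using star that by (auto simp: ops)
    qed
    then show ?thesis
      using union[of poly_star] by (simp add: quotient_star_algebra_def ops)
  qed
qed

lemma finitely_generated_presented:
  fixes X :: "'g set"
  assumes "finite X" "R \<subseteq> carrier (free_star_algebra X)"
  shows "finitely_generated (presented_star_algebra X R)"
proof -
  define A where "A = free_star_algebra X"
  define J where "J = star_ideal_generated A R"
  define Q where "Q = quotient_star_algebra A J"
  have J: "ideal J A"
    unfolding J_def A_def by (rule star_ideal_generated(1)[OF star_algebra_free assms(2)])
  note ops = quotient_free_ops[OF J[unfolded A_def], folded A_def, folded Q_def]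
  have sa: "star_algebra Q"
    using star_algebra_presented[OF assms(2)] by (simp add: Q_def J_def A_def presented_star_algebra_def)
  interpret Q: star_algebra Q by fact
  \<comment> \<open>The adjoints of the generators are included, since the subalgebras in
    \<open>finitely_generated\<close> are not assumed closed under the star.\<close>
  define S where "S = (\<lambda>l. J +>\<^bsub>A\<^esub> monomial [l]) ` (X \<times> UNIV)"
  have carr: "Y \<in> carrier Q \<longleftrightarrow> (\<exists>a\<in>carrier A. Y = J +>\<^bsub>A\<^esub> a)" for Y
    unfolding Q_def by (rule quotient_carrier)
  have mono: "monomial w \<in> carrier A" if "fst ` set w \<subseteq> X" for w
    unfolding A_def using that by (rule monomial_carrier)
  have "monomial [l] \<in> carrier A" if "fst l \<in> X" for l
    using mono[of "[l]"] that by simp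
  then have S: "finite S" "S \<subseteq> carrier Q"
    using assms(1) by (auto simp: S_def carr intro!: bexI)
  have "carrier Q \<subseteq> B" if B: "unital_subalgebra B Q" "S \<subseteq> B" for B
  proof -
    have sub: "subring B Q" using B(1) by (simp add: unital_subalgebra_def)
    have word: "J +>\<^bsub>A\<^esub> monomial w \<in> B" if "fst ` set w \<subseteq> X" for w
      using that
    proof (induction w)
      case Nil
      then show ?case
        using subringE(3)[OF sub] ops(3)[of 0] by (simp add: monomial_Nil A_def free_carrier_iff)
    next
      case (Cons l w)
      have "J +>\<^bsub>A\<^esub> monomial [l] \<in> B"
        using Cons.prems B(2) by (auto simp: S_def mem_Times_iff)
      moreover have "(J +>\<^bsub>A\<^esub> monomial [l]) \<otimes>\<^bsub>Q\<^esub> (J +>\<^bsub>A\<^esub> monomial w) = J +>\<^bsub>A\<^esub> monomial (l # w)"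
        using ops(1)[of "monomial [l]" "monomial w"] mono[of "[l]"] mono[of w] Cons.prems by (simp add: monomial_Cons[of l w])
      ultimately show ?case
        using subringE(6)[OF sub, of "J +>\<^bsub>A\<^esub> monomial [l]" "J +>\<^bsub>A\<^esub> monomial w"] Cons by simp
    qed
    have single_mem: "J +>\<^bsub>A\<^esub> Poly_Mapping.single w c \<in> B" if "fst ` set (letters w) \<subseteq> X" for w c
    proof -
      have "Poly_Mapping.single w c = Poly_Mapping.single 0 c * monomial (letters w)"
        by (simp add: monomial_def mult_single)
      moreover have "c \<odot>\<^bsub>Q\<^esub> (J +>\<^bsub>A\<^esub> monomial (letters w)) \<in> B"
        using B(1) word[OF that] by (simp add: unital_subalgebra_def)
      ultimately show ?thesis
        using ops(5)[OF mono[OF that], of c] by simp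
    qed
    have sum_mem: "J +>\<^bsub>A\<^esub> sum f T \<in> B" if "\<And>t. t \<in> T \<Longrightarrow> f t \<in> carrier A \<and> J +>\<^bsub>A\<^esub> f t \<in> B"
      for f :: "'g star_word \<Rightarrow> 'g star_poly" and T
      using that
    proof (induction T rule: infinite_finite_induct)
      case (insert t T)
      have c: "f t \<in> carrier A" "sum f T \<in> carrier A"
        using insert.prems unfolding A_def by (auto intro!: free_carrier_simps(7))
      show ?case
        using subringE(7)[OF sub, of "J +>\<^bsub>A\<^esub> f t" "J +>\<^bsub>A\<^esub> sum f T"] insert ops(2)[OF c] by simp
    qed (use subringE(2)[OF sub] ops(4)[of 0] in \<open>simp_all add: A_def free_carrier_iff\<close>)
    show ?thesis
    proof
      fix Y assume "Y \<in> carrier Q"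
      then obtain p where p: "p \<in> carrier A" "Y = J +>\<^bsub>A\<^esub> p" by (auto simp: carr)
      have "J +>\<^bsub>A\<^esub> (\<Sum>w\<in>Poly_Mapping.keys p. Poly_Mapping.single w (Poly_Mapping.lookup p w)) \<in> B"
        by (rule sum_mem) (use p(1) single_mem single_carrier in \<open>auto simp: A_def free_carrier_iff\<close>)
      then show "Y \<in> B" using p(2) star_poly_expand[of p] by simp
    qed
  qed
  moreover have "unital_subalgebra (carrier Q) Q"
    using Q.carrier_is_subring Q.smult_closed by (simp add: unital_subalgebra_def)
  ultimately have "\<Inter>{B. unital_subalgebra B Q \<and> S \<subseteq> B} = carrier Q"
    using S(2) by blast
  then show ?thesis
    using S unfolding finitely_generated_def presented_star_algebra_def Q_def J_def A_def by blast
qed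

text \<open>The kernel of a star homomorphism is an ideal closed under the star, so it contains the
  ideal generated by the relators once it contains the relators.\<close>

lemma evaluation_kernel:
  assumes R: "R \<subseteq> carrier (free_star_algebra X)"
    and zero: "\<And>r x y. r \<in> R \<Longrightarrow> x < n \<Longrightarrow> y < n \<Longrightarrow> poly_matrix n U r x y = 0"
    and p: "p \<in> star_ideal_generated (free_star_algebra X) R" and xy: "x < n" "y < n"
  shows "poly_matrix n U p x y = 0"
proof -
  let ?A = "free_star_algebra X" and ?M = "matrix_star_algebra n"
  define K where "K = a_kernel ?A ?M (evaluation n U)"
  have K: "q \<in> K \<longleftrightarrow> q \<in> carrier ?A \<and> (\<forall>x<n. \<forall>y<n. poly_matrix n U q x y = 0)" for q
    by (auto simp: K_def a_kernel_def' matrix_star_algebra_def evaluation_def mat_eq_iff)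
  have "ring_hom_ring ?A ?M (evaluation n U)"
    using evaluation_star_hom[of n U X] star_algebra_free[of X] star_algebra_matrix[of n]
    by (intro ring_hom_ringI2) (auto simp: star_hom_def star_algebra_def)
  then have "ideal K ?A"
    unfolding K_def by (rule ring_hom_ring.kernel_is_ideal)
  moreover have "star ?A ` K \<subseteq> K"
    using star_algebra.star_closed[OF star_algebra_free[of X]]
    by (auto simp: K free_star_algebra_ops poly_matrix_star)
  moreover have "R \<subseteq> K"
    using R zero by (auto simp: K)
  ultimately have "star_ideal_generated ?A R \<subseteq> K"
    unfolding star_ideal_generated_def by blast
  then show ?thesis using p xy K by blast
qed

text \<open>All matrix representations together map the algebra into one product, and
  \<open>separate\<close> makes their common kernel trivial. The product is indexed by the
  representations themselves; \<open>residually_finiteI\<close> moves it to the prescribed index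
  type.\<close>

theorem residually_finite_presented:
  fixes X :: "'g set" and R :: "'g star_poly set"
  assumes "finite X" and R: "R \<subseteq> carrier (free_star_algebra X)"
    and separate: "\<And>p. p \<in> carrier (free_star_algebra X) \<Longrightarrow>
      (\<And>n U x y. n \<ge> 1 \<Longrightarrow> \<forall>r\<in>R. \<forall>x<n. \<forall>y<n. poly_matrix n U r x y = 0 \<Longrightarrow> x < n \<Longrightarrow> y < n \<Longrightarrow> poly_matrix n U p x y = 0) \<Longrightarrow>
      p \<in> star_ideal_generated (free_star_algebra X) R"
  shows "residually_finite (presented_star_algebra X R)"
proof -
  define A where "A = free_star_algebra X"
  define J where "J = star_ideal_generated A R"
  define Q where "Q = quotient_star_algebra A J"
  have J: "ideal J A" "star A ` J \<subseteq> J"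
    unfolding J_def A_def by (rule star_ideal_generated[OF star_algebra_free R])+
  note ops = quotient_free_ops[OF J(1)[unfolded A_def], folded A_def, folded Q_def]
  have carr: "Y \<in> carrier Q \<longleftrightarrow> (\<exists>a\<in>carrier A. Y = J +>\<^bsub>A\<^esub> a)" for Y
    unfolding Q_def by (rule quotient_carrier)
  define I :: "(nat \<times> ('g \<Rightarrow> nat \<Rightarrow> nat \<Rightarrow> complex)) set" where
    "I = {(n, U). n \<ge> 1 \<and> (\<forall>r\<in>R. \<forall>x<n. \<forall>y<n. poly_matrix n U r x y = 0)}"
  \<comment> \<open>The choice of the representative is immaterial, because these evaluations kill
    the relators and hence \<open>J\<close>.\<close>
  define h where "h Y = (\<lambda>i\<in>I. evaluation (fst i) (snd i) (SOME a. a \<in> Y))" for Y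
  have ev: "evaluation n U \<in> star_hom A (matrix_star_algebra n)" for n U
    unfolding A_def by (rule evaluation_star_hom)
  have h: "h (J +>\<^bsub>A\<^esub> a) = (\<lambda>i\<in>I. evaluation (fst i) (snd i) a)" for a
  proof -
    have "evaluation n U (SOME b. b \<in> J +>\<^bsub>A\<^esub> a) = evaluation n U a" if i: "(n, U) \<in> I" for n U
    proof -
      have "a \<in> J +>\<^bsub>A\<^esub> a"
        using free_coset_iff[OF J(1)[unfolded A_def]] free_ideal_facts(1)[OF J(1)[unfolded A_def]] by (simp add: A_def)
      then have "(SOME b. b \<in> J +>\<^bsub>A\<^esub> a) \<in> J +>\<^bsub>A\<^esub> a"
        by (rule someI)
      then have "(SOME b. b \<in> J +>\<^bsub>A\<^esub> a) - a \<in> J"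
        using free_coset_iff[OF J(1)[unfolded A_def]] by (simp add: A_def)
      then have "poly_matrix n U ((SOME b. b \<in> J +>\<^bsub>A\<^esub> a) - a) x y = 0" if "x < n" "y < n" for x y
        using evaluation_kernel[OF R, of n U _ x y] i that by (simp add: I_def J_def A_def)
      then show ?thesis
        by (auto simp: evaluation_def poly_matrix_diff)
    qed
    then show ?thesis
      by (auto simp: h_def restrict_def)
  qed
  have "h \<in> star_hom Q (product_star_algebra I (\<lambda>i. matrix_star_algebra (fst i)))"
    unfolding star_hom_def Ring.ring_hom_def
  proof (intro CollectI conjI ballI allI impI funcsetI; (elim conjE)?)
    note A_ops = free_star_algebra_ops[of X, folded A_def]
    have one: "1 \<in> carrier A" unfolding A_def by (rule free_carrier_simps)
    let ?P = "product_star_algebra I (\<lambda>i. matrix_star_algebra (fst i))"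
    have ev_closed: "evaluation n U a \<in> carrier (matrix_star_algebra n)"
      and ev_mult: "evaluation n U (a * b) = evaluation n U a \<otimes>\<^bsub>matrix_star_algebra n\<^esub> evaluation n U b"
      and ev_add: "evaluation n U (a + b) = evaluation n U a \<oplus>\<^bsub>matrix_star_algebra n\<^esub> evaluation n U b"
      and ev_one: "evaluation n U 1 = \<one>\<^bsub>matrix_star_algebra n\<^esub>"
      and ev_smult: "evaluation n U (Poly_Mapping.single 0 c * a) = c \<odot>\<^bsub>matrix_star_algebra n\<^esub> evaluation n U a"
      and ev_star: "evaluation n U (poly_star a) = star (matrix_star_algebra n) (evaluation n U a)"
      if "a \<in> carrier A" "b \<in> carrier A" for n U a b c
      using ev[of n U] that by (auto simp: star_hom_def Ring.ring_hom_def A_ops)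
    {
      fix Y assume "Y \<in> carrier Q"
      then obtain a where a: "a \<in> carrier A" "Y = J +>\<^bsub>A\<^esub> a" by (auto simp: carr)
      show "h Y \<in> carrier ?P"
        using ev_closed[OF a(1) a(1)] by (simp add: a(2) h product_star_algebra_def)
      show "h (c \<odot>\<^bsub>Q\<^esub> Y) = c \<odot>\<^bsub>?P\<^esub> h Y" for c
        unfolding a(2) ops(5)[OF a(1)] h by (auto simp: product_star_algebra_def ev_smult[OF a(1) a(1)])
      show "h (star Q Y) = star ?P (h Y)"
        unfolding a(2) ops(6)[OF a(1) J(2)] h by (auto simp: product_star_algebra_def ev_star[OF a(1) a(1)])
      fix Z assume "Z \<in> carrier Q"
      then obtain b where b: "b \<in> carrier A" "Z = J +>\<^bsub>A\<^esub> b" by (auto simp: carr)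
      show "h (Y \<otimes>\<^bsub>Q\<^esub> Z) = h Y \<otimes>\<^bsub>?P\<^esub> h Z"
        unfolding a(2) b(2) ops(1)[OF a(1) b(1)] h by (auto simp: product_star_algebra_def ev_mult[OF a(1) b(1)])
      show "h (Y \<oplus>\<^bsub>Q\<^esub> Z) = h Y \<oplus>\<^bsub>?P\<^esub> h Z"
        unfolding a(2) b(2) ops(2)[OF a(1) b(1)] h by (auto simp: product_star_algebra_def ev_add[OF a(1) b(1)])
    }
    show "h \<one>\<^bsub>Q\<^esub> = \<one>\<^bsub>?P\<^esub>"
      unfolding ops(3)[OF one] h by (auto simp: product_star_algebra_def ev_one[OF one one])
  qed
  moreover have "inj_on h (carrier Q)"
  proof (rule inj_onI)
    fix Y Z assume YZ: "Y \<in> carrier Q" "Z \<in> carrier Q" "h Y = h Z"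
    then obtain a b where ab: "a \<in> carrier A" "b \<in> carrier A" "Y = J +>\<^bsub>A\<^esub> a" "Z = J +>\<^bsub>A\<^esub> b"
      by (auto simp: carr)
    have "a - b \<in> J"
      unfolding J_def A_def
    proof (rule separate)
      show "a - b \<in> carrier (free_star_algebra X)"
        using ab free_carrier_simps(4) unfolding A_def by blast
      fix n U x y assume *: "n \<ge> (1::nat)" "\<forall>r\<in>R. \<forall>x<n. \<forall>y<n. poly_matrix n U r x y = 0" "x < n" "y < n"
      then have "(n, U) \<in> I" by (simp add: I_def)
      then have "evaluation n U a = evaluation n U b"
        using YZ(3) by (auto simp: ab h restrict_def fun_eq_iff split: if_splits)
      then have "evaluation n U a $$ (x, y) = evaluation n U b $$ (x, y)" by simp
      then show "poly_matrix n U (a - b) x y = 0"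
        using * by (simp add: evaluation_def poly_matrix_diff)
    qed
    then show "Y = Z"
      using free_coset_eq_iff[OF J(1)[unfolded A_def]] by (simp add: ab A_def)
  qed
  moreover have "\<forall>i\<in>I. fst i \<ge> 1" by (auto simp: I_def)
  ultimately have "embeds_in_matrix_product TYPE(nat \<times> ('g \<Rightarrow> nat \<Rightarrow> nat \<Rightarrow> complex)) Q"
    unfolding embeds_in_matrix_product_def by blast
  moreover have "presented_star_algebra X R = Q"
    by (simp add: presented_star_algebra_def Q_def J_def A_def)
  ultimately show ?thesis
    using residually_finiteI star_algebra_presented[OF R] finitely_generated_presented[OF assms(1) R] by metis
qed

section \<open>The free quantum groups\<close>

lemma gen_monomial: "gen g = monomial [(g, False)]" "poly_star (monomial [(g, False)]) = monomial [(g, True)]"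
  by (simp_all add: gen_def monomial_def poly_star_single adjoint_word_def)

lemma unitarity_relatorsI:
  assumes "i \<in> {1..N}" "j \<in> {1..N}"
  shows "(\<Sum>k=1..N. v i k * poly_star (v j k)) - (if i = j then 1 else 0) \<in> unitarity_relators N v"
    and "(\<Sum>k=1..N. poly_star (v k i) * v k j) - (if i = j then 1 else 0) \<in> unitarity_relators N v"
proof -
  show "(\<Sum>k=1..N. v i k * poly_star (v j k)) - (if i = j then 1 else 0) \<in> unitarity_relators N v"
    unfolding unitarity_relators_def by (rule UnI1, rule CollectI) (intro exI[of _ i] exI[of _ j] conjI refl assms)
  show "(\<Sum>k=1..N. poly_star (v k i) * v k j) - (if i = j then 1 else 0) \<in> unitarity_relators N v"
    unfolding unitarity_relators_def by (rule UnI2, rule CollectI) (intro exI[of _ i] exI[of _ j] conjI refl assms)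
qed

lemma biunitary_kills_unitarity_relators:
  fixes U :: "nat \<Rightarrow> nat \<Rightarrow> nat \<Rightarrow> nat \<Rightarrow> real"
  defines "V \<equiv> \<lambda>(i, j) x y. complex_of_real (U i j x y)"
  assumes U: "biunitary {1..N} n U" and xy: "x < n" "y < n"
    and r: "r \<in> free_unitary_relators N"
  shows "poly_matrix n V r x y = 0"
proof -
  have g: "poly_matrix n V (gen (i, j)) x z = of_real (U i j x z)"
    "poly_matrix n V (poly_star (gen (i, j))) x z = of_real (U i j z x)" if "x < n" "z < n" for i j x z
    using that by (simp_all add: poly_matrix_gen poly_matrix_star V_def)
  \<comment> \<open>The instance \<open>0 - 0\<close> of \<open>poly_matrix_diff\<close> shows that
    the zero polynomial evaluates to zero.\<close>
  have delta: "poly_matrix n V (if i = j then 1 else 0) x y = (if i = j \<and> x = y then 1 else 0)" for i j :: nat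
    using poly_matrix_one[of n V x y] poly_matrix_diff[of n V 0 0 x y] by auto
  have sum: "poly_matrix n V (\<Sum>k=1..N. a k * b k) x y = of_real (\<Sum>z<n. \<Sum>k=1..N. f k x z * h k z y)"
    if "\<And>k z. z < n \<Longrightarrow> poly_matrix n V (a k) x z = of_real (f k x z)"
      "\<And>k z. z < n \<Longrightarrow> poly_matrix n V (b k) z y = of_real (h k z y)"
    for a b :: "nat \<Rightarrow> (nat \<times> nat) star_poly" and f h :: "nat \<Rightarrow> nat \<Rightarrow> nat \<Rightarrow> real"
    by (subst sum.swap) (simp add: poly_matrix_sum poly_matrix_mult[OF xy(1)] that)
  have B: "(\<Sum>z<n. \<Sum>k=1..N. U i k x z * U j k y z) = (if i = j \<and> x = y then 1 else 0)"
    "(\<Sum>z<n. \<Sum>k=1..N. U k i x z * U k j y z) = (if i = j \<and> x = y then 1 else 0)"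
    "(\<Sum>z<n. \<Sum>k=1..N. U i k z x * U j k z y) = (if i = j \<and> x = y then 1 else 0)"
    "(\<Sum>z<n. \<Sum>k=1..N. U k i z x * U k j z y) = (if i = j \<and> x = y then 1 else 0)"
    if "i \<in> {1..N}" "j \<in> {1..N}" for i j
    using U that xy unfolding biunitary_def by blast+
  from r consider
    (1) i j where "i \<in> {1..N}" "j \<in> {1..N}" "r = (\<Sum>k=1..N. gen (i, k) * poly_star (gen (j, k))) - (if i = j then 1 else 0)"
  | (2) i j where "i \<in> {1..N}" "j \<in> {1..N}" "r = (\<Sum>k=1..N. poly_star (gen (k, i)) * gen (k, j)) - (if i = j then 1 else 0)"
  | (3) i j where "i \<in> {1..N}" "j \<in> {1..N}" "r = (\<Sum>k=1..N. poly_star (gen (i, k)) * gen (j, k)) - (if i = j then 1 else 0)"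
  | (4) i j where "i \<in> {1..N}" "j \<in> {1..N}" "r = (\<Sum>k=1..N. gen (k, i) * poly_star (gen (k, j))) - (if i = j then 1 else 0)"
    unfolding free_unitary_relators_def unitarity_relators_def conjugate_matrix_def fundamental_matrix_def poly_star_poly_star
    by blast
  then show ?thesis
  proof cases
    case 1
    have "poly_matrix n V (\<Sum>k=1..N. gen (i, k) * poly_star (gen (j, k))) x y = of_real (\<Sum>z<n. \<Sum>k=1..N. U i k x z * U j k y z)"
      by (rule sum) (use xy in \<open>simp_all add: g\<close>)
    then show ?thesis unfolding 1(3) poly_matrix_diff delta B(1)[OF 1(1,2)] by simp
  next
    case 2
    have "poly_matrix n V (\<Sum>k=1..N. poly_star (gen (k, i)) * gen (k, j)) x y = of_real (\<Sum>z<n. \<Sum>k=1..N. U k i z x * U k j z y)"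
      by (rule sum) (use xy in \<open>simp_all add: g\<close>)
    then show ?thesis unfolding 2(3) poly_matrix_diff delta B(4)[OF 2(1,2)] by simp
  next
    case 3
    have "poly_matrix n V (\<Sum>k=1..N. poly_star (gen (i, k)) * gen (j, k)) x y = of_real (\<Sum>z<n. \<Sum>k=1..N. U i k z x * U j k z y)"
      by (rule sum) (use xy in \<open>simp_all add: g\<close>)
    then show ?thesis unfolding 3(3) poly_matrix_diff delta B(3)[OF 3(1,2)] by simp
  next
    case 4
    have "poly_matrix n V (\<Sum>k=1..N. gen (k, i) * poly_star (gen (k, j))) x y = of_real (\<Sum>z<n. \<Sum>k=1..N. U k i x z * U k j y z)"
      by (rule sum) (use xy in \<open>simp_all add: g\<close>)
    then show ?thesis unfolding 4(3) poly_matrix_diff delta B(2)[OF 4(1,2)] by simp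
  qed
qed

text \<open>Both algebras are treated at once, \<open>ort\<close> selecting the orthogonal one.
  Modulo the ideal \<open>p\<close> equals a combination \<open>q\<close> of normal words; if all
  representations kill \<open>p\<close>, the biunitary ones kill \<open>q\<close>, and then
  \<open>q = 0\<close>.\<close>

lemma residually_finite_quantum_group:
  fixes N :: nat and R :: "(nat \<times> nat) star_poly set"
  defines "X \<equiv> {1..N} \<times> {1..N}"
  assumes N: "N \<ge> 2" and R: "R \<subseteq> carrier (free_star_algebra X)" "free_unitary_relators N \<subseteq> R"
    and ort: "ort \<Longrightarrow> R = free_orthogonal_relators N" and not_ort: "\<not> ort \<Longrightarrow> R = free_unitary_relators N"
  shows "residually_finite (presented_star_algebra X R)"
proof (rule residually_finite_presented)
  let ?A = "free_star_algebra X"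
  define J where "J = star_ideal_generated ?A R"
  have J: "ideal J ?A" "R \<subseteq> J"
    unfolding J_def by (rule star_ideal_generated[OF star_algebra_free R(1)])+
  note Jf = free_ideal_facts[OF J(1)]
  have selfadjoint: "monomial [(g, True)] - monomial [(g, False)] \<in> J" if "ort" "g \<in> X" for g
  proof -
    obtain i j where "g = (i, j)" "i \<in> {1..N}" "j \<in> {1..N}" using \<open>g \<in> X\<close> by (auto simp: X_def)
    then have "gen g - poly_star (gen g) \<in> J"
      using J(2) ort[OF \<open>ort\<close>] by (auto simp: free_orthogonal_relators_def)
    then have "0 - (gen g - poly_star (gen g)) \<in> J" by (rule Jf(3)[OF Jf(1)])
    then show ?thesis by (simp add: gen_monomial)
  qed
  have relators: "(\<Sum>k=1..N. gen (i, k) * poly_star (gen (j, k))) - (if i = j then 1 else 0) \<in> J"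
    "(\<Sum>k=1..N. poly_star (gen (k, i)) * gen (k, j)) - (if i = j then 1 else 0) \<in> J"
    "(\<Sum>k=1..N. poly_star (gen (i, k)) * gen (j, k)) - (if i = j then 1 else 0) \<in> J"
    "(\<Sum>k=1..N. gen (k, i) * poly_star (gen (k, j))) - (if i = j then 1 else 0) \<in> J"
    if "i \<in> {1..N}" "j \<in> {1..N}" for i j
  proof -
    have *: "unitarity_relators N fundamental_matrix \<subseteq> J" "unitarity_relators N (conjugate_matrix fundamental_matrix) \<subseteq> J"
      using R(2) J(2) by (auto simp: free_unitary_relators_def)
    show "(\<Sum>k=1..N. gen (i, k) * poly_star (gen (j, k))) - (if i = j then 1 else 0) \<in> J"
      "(\<Sum>k=1..N. poly_star (gen (k, i)) * gen (k, j)) - (if i = j then 1 else 0) \<in> J"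
      using unitarity_relatorsI[OF that, THEN subsetD[OF *(1)]]
      unfolding fundamental_matrix_def .
    show "(\<Sum>k=1..N. poly_star (gen (i, k)) * gen (j, k)) - (if i = j then 1 else 0) \<in> J"
      "(\<Sum>k=1..N. gen (k, i) * poly_star (gen (k, j))) - (if i = j then 1 else 0) \<in> J"
      using unitarity_relatorsI[OF that, THEN subsetD[OF *(2)]]
      unfolding conjugate_matrix_def fundamental_matrix_def poly_star_poly_star .
  qed
  have pair: "monomial [(g, c), (g', c')] = monomial [(g, c)] * monomial [(g', c')]" for g g' :: "nat \<times> nat" and c c'
    by (rule monomial_Cons)
  have replace: "(\<Sum>k=1..N. monomial [(f k, False), (f' k, False)]) - e \<in> J"
    if "(\<Sum>k=1..N. monomial [(f k, False), (f' k, True)]) - e \<in> J" "ort" "\<And>k. k \<in> {1..N} \<Longrightarrow> f k \<in> X \<and> f' k \<in> X"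
    for f f' :: "nat \<Rightarrow> nat \<times> nat" and e
  proof -
    have "(\<Sum>k=1..N. monomial [(f k, False)] * (monomial [(f' k, True)] - monomial [(f' k, False)])) \<in> J"
      by (intro Jf(6) Jf(4) selfadjoint that monomial_carrier) (use that in auto)
    then have "((\<Sum>k=1..N. monomial [(f k, False), (f' k, True)]) - e)
        - (\<Sum>k=1..N. monomial [(f k, False)] * (monomial [(f' k, True)] - monomial [(f' k, False)])) \<in> J"
      by (intro Jf(3) that)
    then show ?thesis
      by (simp add: pair right_diff_distrib sum_subtractf)
  qed
  have row: "(\<Sum>k=1..N. monomial [((i, k), c), ((j, k), c')]) - (if i = j then 1 else 0) \<in> J"
    if ij: "i \<in> {1..N}" "j \<in> {1..N}" and c: "if ort then \<not> c \<and> \<not> c' else c \<noteq> c'" for i j c c'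
  proof (cases ort)
    case True
    then show ?thesis
      using replace[of "\<lambda>k. (i, k)" "\<lambda>k. (j, k)" "if i = j then 1 else 0"] relators(1)[OF ij] ij c
      by (simp add: pair gen_monomial X_def)
  next
    case False
    then show ?thesis
      using relators(1,3)[OF ij] c by (cases c) (simp_all add: pair gen_monomial)
  qed
  have column: "(\<Sum>k=1..N. monomial [((k, i), c), ((k, j), c')]) - (if i = j then 1 else 0) \<in> J"
    if ij: "i \<in> {1..N}" "j \<in> {1..N}" and c: "if ort then \<not> c \<and> \<not> c' else c \<noteq> c'" for i j c c'
  proof (cases ort)
    case True
    then show ?thesis
      using replace[of "\<lambda>k. (k, i)" "\<lambda>k. (k, j)" "if i = j then 1 else 0"] relators(4)[OF ij] ij c
      by (simp add: pair gen_monomial X_def)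
  next
    case False
    then show ?thesis
      using relators(2,4)[OF ij] c by (cases c) (simp_all add: pair gen_monomial)
  qed
  have kills: "poly_matrix n (\<lambda>(i, j) x y. of_real (U i j x y)) r x y = 0"
    if U: "biunitary {1..N} n U" "ort \<longrightarrow> (\<forall>i j x y. U i j x y = U i j y x)" and r: "r \<in> R" and xy: "x < n" "y < n"
    for n U r x y
  proof (cases "r \<in> free_unitary_relators N")
    case True
    then show ?thesis by (rule biunitary_kills_unitarity_relators[OF U(1) xy])
  next
    case False
    then have "ort" using r not_ort by blast
    then obtain i j where "r = gen (i, j) - poly_star (gen (i, j))"
      using r ort False by (auto simp: free_orthogonal_relators_def)
    \<comment> \<open>The matrix \<open>U i j\<close> is real and symmetric, hence
      self-adjoint.\<close>
    then show ?thesis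
      using xy U(2) \<open>ort\<close> by (simp add: poly_matrix_diff poly_matrix_gen poly_matrix_star)
  qed
  fix p assume p: "p \<in> carrier ?A"
    and vanish: "\<And>n U x y. n \<ge> 1 \<Longrightarrow> \<forall>r\<in>R. \<forall>x<n. \<forall>y<n. poly_matrix n U r x y = 0 \<Longrightarrow> x < n \<Longrightarrow> y < n \<Longrightarrow>
      poly_matrix n U p x y = 0"
  have "\<exists>q\<in>carrier ?A. (\<forall>v\<in>Poly_Mapping.keys q. normal_word ort N (letters v)) \<and> monomial w - q \<in> J"
    if "fst ` set w \<subseteq> X" for w
    unfolding X_def
    by (rule monomial_reduction[OF N J(1)[unfolded X_def]]) (use selfadjoint row column that in \<open>auto simp: X_def\<close>)
  then obtain nf where nf: "\<And>w. fst ` set w \<subseteq> X \<Longrightarrow> nf w \<in> carrier ?A \<and>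
      (\<forall>v\<in>Poly_Mapping.keys (nf w). normal_word ort N (letters v)) \<and> monomial w - nf w \<in> J"
    by metis
  define q where "q = (\<Sum>w\<in>Poly_Mapping.keys p. Poly_Mapping.single 0 (Poly_Mapping.lookup p w) * nf (letters w))"
  have letters_p: "fst ` set (letters w) \<subseteq> X" if "w \<in> Poly_Mapping.keys p" for w
    using p that by (simp add: free_carrier_iff)
  have "p = (\<Sum>w\<in>Poly_Mapping.keys p. Poly_Mapping.single 0 (Poly_Mapping.lookup p w) * monomial (letters w))"
    by (subst star_poly_expand) (simp add: monomial_def mult_single)
  then have "p - q = (\<Sum>w\<in>Poly_Mapping.keys p. Poly_Mapping.single 0 (Poly_Mapping.lookup p w) * (monomial (letters w) - nf (letters w)))"
    by (simp add: q_def right_diff_distrib sum_subtractf)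
  also have "\<dots> \<in> J"
    by (intro Jf(6) Jf(4) single_carrier) (use nf letters_p in auto)
  finally have pq: "p - q \<in> J" .
  have "q = 0"
  proof (rule separating_representation[OF N, of q ort])
    fix w assume "w \<in> Poly_Mapping.keys q"
    then obtain v where v: "v \<in> Poly_Mapping.keys p"
      "w \<in> Poly_Mapping.keys (Poly_Mapping.single 0 (Poly_Mapping.lookup p v) * nf (letters v))"
      using keys_sum[of "\<lambda>w. Poly_Mapping.single 0 (Poly_Mapping.lookup p w) * nf (letters w)" "Poly_Mapping.keys p"]
      unfolding q_def by blast
    then have "w \<in> Poly_Mapping.keys (nf (letters v))"
      using keys_single_mult by blast
    then show "fst ` set (letters w) \<subseteq> {1..N} \<times> {1..N} \<and> normal_word ort N (letters w)"
      using nf[OF letters_p[OF v(1)]] by (auto simp: free_carrier_iff X_def)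
  next
    fix n U assume n: "n \<ge> 1" and U: "biunitary {1..N} n U" "ort \<longrightarrow> (\<forall>i j x y. U i j x y = U i j y x)"
    let ?V = "\<lambda>(i, j) x y. complex_of_real (U i j x y)"
    show "\<forall>x<n. \<forall>y<n. poly_matrix n ?V q x y = 0"
    proof (intro allI impI)
      fix x y assume xy: "x < n" "y < n"
      have "poly_matrix n ?V p x y = 0"
        by (rule vanish[OF n _ xy]) (use kills[OF U] in blast)
      moreover have "poly_matrix n ?V (p - q) x y = 0"
        by (rule evaluation_kernel[OF R(1) kills[OF U] pq[unfolded J_def] xy])
      ultimately show "poly_matrix n ?V q x y = 0"
        by (simp add: poly_matrix_diff)
    qed
  qed
  then show "p \<in> star_ideal_generated ?A R"
    using pq by (simp add: J_def)
qed (use R in \<open>simp_all add: X_def\<close>)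

theorem theorem2p4:
  fixes N :: nat
  assumes "N \<ge> 2"
  shows "residually_finite (free_unitary_algebra N) \<and> residually_finite (free_orthogonal_algebra N)"
proof
  show "residually_finite (free_unitary_algebra N)"
    unfolding free_unitary_algebra_def
    by (rule residually_finite_quantum_group[OF assms free_unitary_relators_carrier, of False]) simp_all
  show "residually_finite (free_orthogonal_algebra N)"
    unfolding free_orthogonal_algebra_def
    by (rule residually_finite_quantum_group[OF assms free_orthogonal_relators_carrier, of True])
      (simp_all add: free_orthogonal_relators_def)
qed

end
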